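(* Let $p\ge3$ be an integer, $\beta>0$, and $\mu=m\delta_0+(1-m)\delta_q$ with $0<m,q<1$. Assume $f_\mu(q)=0$, $\Gamma_\mu(q)=q$ and $\Gamma_\mu'(q)\le1$. Then $$\Gamma_\mu''(u)<0\quad\text{and}\quad\Gamma_\mu(u)<u\qquad\text{for all }q<u\le1.$$ In particular, $f_\mu(u)<0$ for all $q<u\le1$.
   Context: Let $\xi(u)=\beta^2u^p$ on $[0,1]$. For a probability measure $\mu$ on $[0,1]$ let $\alpha_\mu(u)=\mu([0,u])$ and let $\Phi_\mu:\mathbb R\times[0,1]\to\mathbb R$ solve $$\partial_u\Phi_\mu(x,u)=-\frac{\xi''(u)}2\Big(\partial_{xx}\Phi_\mu(x,u)+\alpha_\mu(u)(\partial_x\Phi_\mu(x,u))^2\Big),\qquad \Phi_\mu(x,1)=\log\cosh x.$$ For $\mu=m\delta_0+(1-m)\delta_q$ this is explicit: $\Phi_\mu(x,u)=\log\cosh x+\frac12(\xi'(1)-\xi'(u))$ for $q\le u\le1$, and $\Phi_\mu(x,u)=\frac1m\log\mathbb E\exp\{m\Phi_\mu(x+g\sqrt{\xi'(q)-\xi'(u)},q)\}$ for $0\le u\le q$, with $g$ standard Gaussian. Let $B$ be a standard Brownian motion, $M(u)=B(\xi'(u))$, $$W_\mu(u)=\int_{[0,u]}\{\Phi_\mu(M(u),u)-\Phi_\mu(M(t),t)\}\,d\mu(t),\qquad \Gamma_\mu(u)=\mathbb E\big[(\partial_x\Phi_\mu(M(u),u))^2e^{W_\mu(u)}\big],$$ and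 $f_\mu(u)=\frac12\int_0^u\xi''(t)(\Gamma_\mu(t)-t)\,dt$. Primes on $\Gamma_\mu$ denote derivatives in $u$ (one-sided at $u=1$). *)

theory Defs
  imports "HOL-Probability.Probability"
begin

text \<open>The filtration-free definition: independence of the increments over every finite grid.
  The starting value and path continuity are only required almost surely.\<close>

definition standard_brownian_motion :: "'w measure \<Rightarrow> (real \<Rightarrow> 'w \<Rightarrow> real) \<Rightarrow> bool" where
  "standard_brownian_motion P B \<longleftrightarrow>
     prob_space P \<and>
     (\<forall>t\<ge>0. B t \<in> borel_measurable P) \<and>
     (AE \<omega> in P. B 0 \<omega> = 0) \<and>
     (\<forall>s t. 0 \<le> s \<and> s < t \<longrightarrow>
        distributed P lborel (\<lambda>\<omega>. B t \<omega> - B s \<omega>) (normal_density 0 (sqrt (t - s)))) \<and>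
     (\<forall>n (t :: nat \<Rightarrow> real). 0 \<le> t 0 \<and> (\<forall>i<n. t i < t (Suc i)) \<longrightarrow>
        prob_space.indep_vars P (\<lambda>_. borel) (\<lambda>i \<omega>. B (t (Suc i)) \<omega> - B (t i) \<omega>) {..<n}) \<and>
     (AE \<omega> in P. continuous_on {0..} (\<lambda>t. B t \<omega>))"

definition mixture :: "real \<Rightarrow> nat \<Rightarrow> real \<Rightarrow> real" where
  "mixture \<beta> p u = \<beta>\<^sup>2 * u ^ p"

text \<open>The two-atom measure \<open>m \<delta>\<^sub>0 + (1 - m) \<delta>\<^sub>q\<close>, for \<open>0 \<le> m \<le> 1\<close>.\<close>

definition two_atoms :: "real \<Rightarrow> real \<Rightarrow> real measure" where
  "two_atoms m q = measure_pmf (map_pmf (\<lambda>b. if b then 0 else q) (bernoulli_pmf m))"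

text \<open>For \<open>\<mu> = m \<delta>\<^sub>0 + (1 - m) \<delta>\<^sub>q\<close> one has \<open>\<mu>[0,u] = m\<close> on \<open>[0,q)\<close> and \<open>\<mu>[0,u] = 1\<close>
  on \<open>[q,1]\<close>, and the Parisi equation
  \<open>\<partial>\<^sub>u \<Phi> = - \<xi>''(u)/2 (\<partial>\<^sub>x\<^sub>x \<Phi> + \<mu>[0,u] (\<partial>\<^sub>x \<Phi>)\<^sup>2)\<close>, \<open>\<Phi>(x,1) = log cosh x\<close>,
  is solved on each of the two intervals by the Cole-Hopf transform. This explicit solution is
  taken as the definition; at \<open>u = q\<close> the two formulas agree.\<close>

definition Phi :: "(real \<Rightarrow> real) \<Rightarrow> real \<Rightarrow> real \<Rightarrow> real \<Rightarrow> real \<Rightarrow> real" where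
  "Phi \<xi> m q x u =
     (let \<Phi>1 = (\<lambda>y v. ln (cosh y) + (deriv \<xi> 1 - deriv \<xi> v) / 2) in
      if q \<le> u then \<Phi>1 x u
      else 1 / m * ln (\<integral>g. exp (m * \<Phi>1 (x + g * sqrt (deriv \<xi> q - deriv \<xi> u)) q)
                          \<partial>std_normal_distribution))"

text \<open>In the next two definitions \<open>\<Phi>\<close> stands for \<open>\<Phi>\<^sub>\<mu>\<close> and \<open>M\<close> for the time-changed
  Brownian motion \<open>M(u) = B(\<xi>'(u))\<close>.\<close>

definition W_fun ::
  "(real \<Rightarrow> real \<Rightarrow> real) \<Rightarrow> real measure \<Rightarrow> (real \<Rightarrow> 'w \<Rightarrow> real) \<Rightarrow> real \<Rightarrow> 'w \<Rightarrow> real" where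
  "W_fun \<Phi> \<mu> M u \<omega> = (LINT t:{0..u}|\<mu>. \<Phi> (M u \<omega>) u - \<Phi> (M t \<omega>) t)"

definition Gamma_fun ::
  "'w measure \<Rightarrow> (real \<Rightarrow> real \<Rightarrow> real) \<Rightarrow> real measure \<Rightarrow> (real \<Rightarrow> 'w \<Rightarrow> real) \<Rightarrow> real \<Rightarrow> real" where
  "Gamma_fun P \<Phi> \<mu> M u =
     prob_space.expectation P
       (\<lambda>\<omega>. (deriv (\<lambda>x. \<Phi> x u) (M u \<omega>))\<^sup>2 * exp (W_fun \<Phi> \<mu> M u \<omega>))"

definition f_fun :: "(real \<Rightarrow> real) \<Rightarrow> (real \<Rightarrow> real) \<Rightarrow> real \<Rightarrow> real" where
  "f_fun \<xi> \<Gamma> u = 1 / 2 * integral {0..u} (\<lambda>t. deriv (deriv \<xi>) t * (\<Gamma> t - t))"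

definition Gamma_mu ::
  "'w measure \<Rightarrow> (real \<Rightarrow> 'w \<Rightarrow> real) \<Rightarrow> (real \<Rightarrow> real) \<Rightarrow> real \<Rightarrow> real \<Rightarrow> real \<Rightarrow> real" where
  "Gamma_mu P B \<xi> m q = Gamma_fun P (Phi \<xi> m q) (two_atoms m q) (\<lambda>u. B (deriv \<xi> u))"

definition f_mu ::
  "'w measure \<Rightarrow> (real \<Rightarrow> 'w \<Rightarrow> real) \<Rightarrow> (real \<Rightarrow> real) \<Rightarrow> real \<Rightarrow> real \<Rightarrow> real \<Rightarrow> real" where
  "f_mu P B \<xi> m q = f_fun \<xi> (Gamma_mu P B \<xi> m q)"

text \<open>Derivative of a function on \<open>[0,1]\<close>: two-sided in the interior, one-sided at the end points.
  The value is unspecified where the function is not differentiable.\<close>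

definition deriv01 :: "(real \<Rightarrow> real) \<Rightarrow> real \<Rightarrow> real" where
  "deriv01 g u = vector_derivative g (at u within {0..1})"

end

theory Submission
  imports Defs
begin

text \<open>Write \<open>t = \<xi>'(u)\<close> and \<open>a = \<xi>'(q)\<close>; all quantities become Gaussian averages, smooth in \<open>t\<close>.

  Above the atom, \<open>tanh\<close> of the tilted process is a martingale and
  \<open>d\<Gamma>/dt = exp (- (t - a) / 2) Q(t)\<close>, where \<open>Q\<close> is, up to a constant, the average of
  \<open>cosh\<^bsup>m-1\<^esup>(M\<^sub>q) cosh\<^bsup>-3\<^esup>(M\<^sub>u)\<close>. Both factors are even and decreasing in the modulus, so \<open>Q\<close> is nonincreasing and
  \<open>d\<^sup>2\<Gamma>/dt\<^sup>2 \<le> - (1/2) d\<Gamma>/dt\<close>. Since \<open>u \<xi>'' = (p - 1) \<xi>'\<close>, this gives \<open>\<Gamma>'' < 0\<close> for \<open>u > q\<close> as soon as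
  \<open>(p - 1) a \<ge> 2 (p - 2)\<close>.

  Below the atom, \<open>\<Gamma> = k(t)\<close> with \<open>k(0) = 0\<close>, and \<open>k' = E[(\<partial>\<^sub>x\<^sub>x\<Phi>)\<^sup>2 e\<^sup>W]\<close>. Because \<open>0 \<le> \<partial>\<^sub>x\<^sub>x\<Phi> \<le> 1\<close>,
  the function \<open>k' + 2 k\<close> is nondecreasing. The hypothesis \<open>f(q) = 0\<close> prescribes the mean of \<open>k\<close> on
  \<open>[0, a]\<close> as \<open>k(a) (p - 1) / p\<close>, whence \<open>1/p \<ge> 1/(2a) - 1/(e\<^bsup>2a\<^esup> - 1) \<ge> 1/2 - a/6\<close>, that is
  \<open>a \<ge> 3 (p - 2) / p\<close>, which is enough for \<open>p \<ge> 3\<close>.\<close>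

section \<open>The Gaussian heat operator\<close>

text \<open>The 2 in \<open>k' + 2 k\<close> is a drift bound: under the law tilted by
  \<open>A\<close>, the square of \<open>Lam\<close> has, formally, drift
  \<open>Lam_x^2 - 2 Lam^3\<close>, at least \<open>- 2 m Lam^2\<close> because
  \<open>0 \<le> Lam \<le> m\<close>. The profile that makes \<open>k' + 2 k\<close> constant and
  vanishes at 0 is a multiple of \<open>1 - exp (- 2 s)\<close>; it turns the mean bound into an
  equality, hence the shape of the bound in \<open>exp (2 a)\<close>. The final comparison has no
  slack: at p = 3 both thresholds for \<open>a\<close> equal 1.

  The obstacle is regularity in time. Below the atom the averaging time and the averaged function
  both move with s, and no time derivative of \<Phi> is at hand. So derivatives are read off from
  increments: the semigroup law reduces a step of length h to a Gaussian expansion in space, with an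
  error of order h^(3/2) relative to the positive weight \<open>A 0 r\<close>, and such an error can
  be averaged again. Monotonicity likewise comes from variances over finite steps, not from the
  formal drift.

  The hypothesis on \<Gamma>'(q) concerns a derivative across the atom, where the two formulas for
  \<Gamma> meet; their one-sided slopes must be shown equal before it says anything about u >
  q.\<close>

definition heat :: "real \<Rightarrow> (real \<Rightarrow> real) \<Rightarrow> real \<Rightarrow> real" where
  "heat r f x = (\<integral>g. f (x + g * sqrt r) \<partial>std_normal_distribution)"

text \<open>This growth class is chosen because \<open>cosh\<close> is an eigenfunction of
  \<open>heat r\<close>, with eigenvalue \<open>exp (r / 2)\<close>: Gaussian means of its members
  are finite and the class is stable under averaging.\<close>

definition tame :: "(real \<Rightarrow> real) \<Rightarrow> bool" where
  "tame f \<longleftrightarrow> f \<in> borel_measurable borel \<and> (\<exists>C. \<forall>x. \<bar>f x\<bar> \<le> C * cosh x)"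

lemma prob_space_std_normal: "prob_space std_normal_distribution"
  by (rule prob_space_normal_density) simp

lemma integral_std_normal_eq:
  fixes f :: "real \<Rightarrow> real"
  assumes [measurable]: "f \<in> borel_measurable borel"
  shows "(\<integral>g. f g \<partial>std_normal_distribution) = (\<integral>x. std_normal_density x * f x \<partial>lborel)"
  by (subst integral_density) (auto simp: normal_density_nonneg)

lemma std_normal_exp:
  "integrable std_normal_distribution (\<lambda>g. exp (\<sigma> * g))"
  "(\<integral>g. exp (\<sigma> * g) \<partial>std_normal_distribution) = exp (\<sigma>\<^sup>2 / 2)"
proof -
  have eq: "std_normal_density x * exp (\<sigma> * x) = exp (\<sigma>\<^sup>2 / 2) * normal_density \<sigma> 1 x" for x
    by (simp add: normal_density_def mult_exp_exp power2_eq_square field_simps)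
  show "integrable std_normal_distribution (\<lambda>g. exp (\<sigma> * g))"
    by (subst integrable_density) (auto simp: normal_density_nonneg eq)
  show "(\<integral>g. exp (\<sigma> * g) \<partial>std_normal_distribution) = exp (\<sigma>\<^sup>2 / 2)"
    by (subst integral_std_normal_eq) (auto simp: eq)
qed

lemma std_normal_cosh:
  "integrable std_normal_distribution (\<lambda>g. cosh (x + g * \<sigma>))"
  "(\<integral>g. cosh (x + g * \<sigma>) \<partial>std_normal_distribution) = exp (\<sigma>\<^sup>2 / 2) * cosh x"
proof -
  have eq: "cosh (x + g * \<sigma>) = exp x / 2 * exp (\<sigma> * g) + exp (-x) / 2 * exp ((-\<sigma>) * g)" for g
    by (simp add: cosh_field_def exp_add exp_minus exp_diff field_simps)
  show "integrable std_normal_distribution (\<lambda>g. cosh (x + g * \<sigma>))"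
    unfolding eq by (intro Bochner_Integration.integrable_add integrable_mult_right std_normal_exp)
  show "(\<integral>g. cosh (x + g * \<sigma>) \<partial>std_normal_distribution) = exp (\<sigma>\<^sup>2 / 2) * cosh x"
    unfolding eq
    by (subst Bochner_Integration.integral_add, intro integrable_mult_right std_normal_exp,
        intro integrable_mult_right std_normal_exp, unfold integral_mult_right_zero std_normal_exp)
       (simp add: cosh_field_def field_simps)
qed

lemma tame_measurable [measurable_dest]: "tame f \<Longrightarrow> f \<in> borel_measurable borel"
  by (simp add: tame_def)

lemma tame_bound:
  assumes "tame f" obtains C where "C > 0" "\<And>x. \<bar>f x\<bar> \<le> C * cosh x"
proof -
  obtain C where C: "\<And>x. \<bar>f x\<bar> \<le> C * cosh x" using assms by (auto simp: tame_def)
  have "\<bar>f x\<bar> \<le> (\<bar>C\<bar> + 1) * cosh x" for x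
    using C[of x] mult_right_mono[of C "\<bar>C\<bar> + 1" "cosh x"] by (auto intro: order.trans)
  then show ?thesis by (intro that[of "\<bar>C\<bar> + 1"]) auto
qed

lemma tameI: "f \<in> borel_measurable borel \<Longrightarrow> (\<And>x. \<bar>f x\<bar> \<le> C * cosh x) \<Longrightarrow> tame f"
  by (auto simp: tame_def)

lemma tame_integrable:
  assumes "tame f" shows "integrable std_normal_distribution (\<lambda>g. f (x + g * \<sigma>))"
proof -
  note [measurable] = tame_measurable[OF assms]
  obtain C where C: "\<And>x. \<bar>f x\<bar> \<le> C * cosh x" using assms by (auto simp: tame_def)
  have "integrable std_normal_distribution (\<lambda>g. C * cosh (x + g * \<sigma>))"
    by (intro integrable_mult_right std_normal_cosh)
  then show ?thesis
    by (rule Bochner_Integration.integrable_bound) (use C in \<open>auto intro!: AE_I2 order.trans[OF C]\<close>)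
qed

lemma tame_add:
  assumes "tame f" "tame g" shows "tame (\<lambda>x. f x + g x)"
proof -
  note [measurable] = assms[THEN tame_measurable]
  obtain C D where C: "\<And>x. \<bar>f x\<bar> \<le> C * cosh x" and D: "\<And>x. \<bar>g x\<bar> \<le> D * cosh x"
    using assms by (auto simp: tame_def)
  show ?thesis
  proof (rule tameI[of _ "C + D"])
    show "\<bar>f x + g x\<bar> \<le> (C + D) * cosh x" for x
      using C[of x] D[of x] by (simp add: distrib_right)
  qed measurable
qed

lemma tame_cmult:
  assumes "tame f" shows "tame (\<lambda>x. c * f x)"
proof -
  note [measurable] = assms[THEN tame_measurable]
  obtain C where C: "\<And>x. \<bar>f x\<bar> \<le> C * cosh x" using assms by (auto simp: tame_def)
  show ?thesis
    by (rule tameI[of _ "\<bar>c\<bar> * C"]) (use C in \<open>auto simp: abs_mult mult.assoc intro!: mult_left_mono\<close>)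
qed

lemma tame_diff: "tame f \<Longrightarrow> tame g \<Longrightarrow> tame (\<lambda>x. f x - g x)"
  using tame_add[of f "\<lambda>x. (-1) * g x"] tame_cmult[of g "-1"] by simp

lemma tame_bounded_mult:
  assumes "tame f" "b \<in> borel_measurable borel" "\<And>x. \<bar>b x\<bar> \<le> D" shows "tame (\<lambda>x. b x * f x)"
proof -
  obtain C where C: "\<And>x. \<bar>f x\<bar> \<le> C * cosh x" using assms by (auto simp: tame_def)
  note [measurable] = tame_measurable[OF assms(1)] assms(2)
  have D: "0 \<le> D" using assms(3)[of 0] by linarith
  show ?thesis
    by (rule tameI[of _ "D * C"])
       (use C assms(3) D in \<open>auto simp: abs_mult mult.assoc intro!: mult_mono\<close>)
qed

lemma tame_bounded: "b \<in> borel_measurable borel \<Longrightarrow> (\<And>x. \<bar>b x\<bar> \<le> D) \<Longrightarrow> tame b"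
proof (rule tameI[of _ D])
  fix x assume *: "\<And>x. \<bar>b x\<bar> \<le> D"
  then have "D * 1 \<le> D * cosh x" using order.trans[OF abs_ge_zero *[of x]] 
    by (intro mult_left_mono cosh_real_ge_1) auto
  then show "\<bar>b x\<bar> \<le> D * cosh x" using *[of x] by simp
qed

lemma tame_cosh: "tame cosh"
  by (rule tameI[of _ 1]) (auto simp: cosh_real_nonneg intro!: borel_measurable_continuous_onI continuous_intros)

lemma heat_cosh: "0 \<le> r \<Longrightarrow> heat r cosh x = exp (r / 2) * cosh x"
  by (simp add: heat_def std_normal_cosh)

lemma heat_zero [simp]: "heat 0 f x = f x"
  using prob_space.prob_space[OF prob_space_std_normal] by (simp add: heat_def)

lemma heat_add: "tame f \<Longrightarrow> tame g \<Longrightarrow> heat r (\<lambda>x. f x + g x) x = heat r f x + heat r g x"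
  by (simp add: heat_def tame_integrable)

lemma heat_diff: "tame f \<Longrightarrow> tame g \<Longrightarrow> heat r (\<lambda>x. f x - g x) x = heat r f x - heat r g x"
  by (simp add: heat_def tame_integrable)

lemma heat_cmult: "heat r (\<lambda>x. c * f x) x = c * heat r f x"
  by (simp add: heat_def)

lemma heat_mono: "tame f \<Longrightarrow> tame g \<Longrightarrow> (\<And>x. f x \<le> g x) \<Longrightarrow> heat r f x \<le> heat r g x"
  unfolding heat_def by (intro integral_mono tame_integrable) auto

lemma heat_nonneg: "(\<And>x. 0 \<le> f x) \<Longrightarrow> 0 \<le> heat r f x"
  unfolding heat_def by (intro Bochner_Integration.integral_nonneg)

lemma heat_const: "heat r (\<lambda>x. c) x = c"
  using prob_space.prob_space[OF prob_space_std_normal] by (simp add: heat_def)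

lemma heat_abs_le:
  assumes "tame f" "tame g" "\<And>x. \<bar>f x\<bar> \<le> g x" shows "\<bar>heat r f x\<bar> \<le> heat r g x"
proof -
  have le: "f x \<le> g x" "-1 * g x \<le> f x" for x using assms(3)[of x] by auto
  show ?thesis
    using heat_mono[OF assms(1,2) le(1), of r x] heat_mono[OF tame_cmult[OF assms(2)] assms(1) le(2), of r x]
    unfolding heat_cmult by (auto simp: abs_le_iff)
qed

lemma measurable_heat [measurable]:
  assumes [measurable]: "f \<in> borel_measurable borel" shows "heat r f \<in> borel_measurable borel"
proof -
  interpret prob_space std_normal_distribution by (rule prob_space_std_normal)
  show ?thesis unfolding heat_def[abs_def] by measurable
qed

lemma tame_heat: assumes "tame f" "0 \<le> r" shows "tame (heat r f)"
proof -
  obtain C where C: "\<And>x. \<bar>f x\<bar> \<le> C * cosh x" using assms by (auto simp: tame_def)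
  show ?thesis
  proof (rule tameI[of _ "C * exp (r / 2)"])
    show "heat r f \<in> borel_measurable borel" using assms by (intro measurable_heat tame_measurable)
    fix x 
    show "\<bar>heat r f x\<bar> \<le> C * exp (r / 2) * cosh x"
      using heat_abs_le[OF assms(1) tame_cmult[OF tame_cosh] C, of r x]
      by (simp add: heat_cmult heat_cosh assms)
  qed
qed

lemma tame_const: "tame (\<lambda>x. c)"
  by (rule tame_bounded[of _ "\<bar>c\<bar>"]) auto

lemma heat_pos: assumes "tame f" "\<And>x. 0 < f x" shows "0 < heat r f x"
proof -
  interpret prob_space std_normal_distribution by (rule prob_space_std_normal)
  have "(\<integral>g. 0 \<partial>std_normal_distribution) < (\<integral>g. f (x + g * sqrt r) \<partial>std_normal_distribution)"
    using assms emeasure_space_1 by (intro integral_less_AE_space tame_integrable tame_const) auto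
  then show ?thesis by (simp add: heat_def)
qed

section \<open>Sums of independent Gaussians and the semigroup law\<close>

lemma distributed_std_normal_scale:
  assumes "0 < r" "prob_space M" "distributed M lborel X std_normal_density"
  shows "distributed M lborel (\<lambda>x. X x * sqrt r) (normal_density 0 (sqrt r))"
  using prob_space.normal_density_affine[OF assms(2,3), of "sqrt r" 0] assms(1) by (simp add: mult.commute)

lemma std_normal_pair:
  "prob_space.indep_var (std_normal_distribution \<Otimes>\<^sub>M std_normal_distribution) borel fst borel snd"
  "distributed (std_normal_distribution \<Otimes>\<^sub>M std_normal_distribution) lborel fst std_normal_density"
  "distributed (std_normal_distribution \<Otimes>\<^sub>M std_normal_distribution) lborel snd std_normal_density"
proof -
  interpret N: prob_space std_normal_distribution by (rule prob_space_std_normal)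
  interpret NN: pair_prob_space std_normal_distribution std_normal_distribution ..
  let ?N = "std_normal_distribution"
  have f: "distr (?N \<Otimes>\<^sub>M ?N) ?N fst = ?N" by (rule N.distr_pair_fst)
  have s: "distr (?N \<Otimes>\<^sub>M ?N) ?N snd = ?N"
  proof -
    have "distr (?N \<Otimes>\<^sub>M ?N) ?N snd = distr (distr (?N \<Otimes>\<^sub>M ?N) (?N \<Otimes>\<^sub>M ?N) (\<lambda>(x, y). (y, x))) ?N snd"
      using NN.distr_pair_swap by simp
    also have "\<dots> = distr (?N \<Otimes>\<^sub>M ?N) ?N fst"
      by (subst distr_distr) (auto simp: comp_def case_prod_beta)
    finally show ?thesis using f by simp
  qed
  have c: "distr (?N \<Otimes>\<^sub>M ?N) borel X = distr (?N \<Otimes>\<^sub>M ?N) ?N X"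
      "distr (?N \<Otimes>\<^sub>M ?N) lborel X = distr (?N \<Otimes>\<^sub>M ?N) ?N X" for X :: "_ \<Rightarrow> real"
    by (auto intro!: distr_cong)
  show "NN.indep_var borel fst borel snd"
    unfolding NN.indep_var_distribution_eq
    by (auto simp: c f s distr_id2 intro!: sym[OF distr_id2] sets_pair_measure_cong)
  show "distributed (?N \<Otimes>\<^sub>M ?N) lborel fst std_normal_density"
       "distributed (?N \<Otimes>\<^sub>M ?N) lborel snd std_normal_density"
    unfolding distributed_def by (auto simp: c f s)
qed

lemma integral_std_normal_pair:
  assumes "0 \<le> r" "0 \<le> s" and [measurable]: "f \<in> borel_measurable borel"
  shows "(\<integral>z. f (fst z * sqrt r + snd z * sqrt s) \<partial>(std_normal_distribution \<Otimes>\<^sub>M std_normal_distribution))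
    = (\<integral>g. f (g * sqrt (r + s)) \<partial>std_normal_distribution :: real)"
proof -
  interpret N: prob_space std_normal_distribution by (rule prob_space_std_normal)
  interpret NN: pair_prob_space std_normal_distribution std_normal_distribution ..
  have std: "(\<integral>g. f (g * sqrt r) \<partial>std_normal_distribution) = (\<integral>z. f (X z * sqrt r) \<partial>M)" 
    if "distributed M lborel X std_normal_density" for r M and X :: "'z \<Rightarrow> real"
    using distributed_integral[OF that, of "\<lambda>g. f (g * sqrt r)"] by (simp add: integral_std_normal_eq)
  show ?thesis
  \<comment> \<open>A vanishing variance has no normal density, so the degenerate cases are treated
    apart.\<close>
  proof (cases "r = 0 \<or> s = 0")
    case True
    then show ?thesis using std[OF std_normal_pair(2)] std[OF std_normal_pair(3)] by auto
  next
    case False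
    then have rs: "0 < r" "0 < s" using assms by auto
    have "NN.indep_var borel ((\<lambda>x. x * sqrt r) \<circ> fst) borel ((\<lambda>x. x * sqrt s) \<circ> snd)"
      by (rule NN.indep_var_compose[OF std_normal_pair(1)]) auto
    then have d: "distributed (std_normal_distribution \<Otimes>\<^sub>M std_normal_distribution) lborel 
       (\<lambda>z. fst z * sqrt r + snd z * sqrt s) (normal_density 0 (sqrt (r + s)))"
      using NN.add_indep_normal[of "\<lambda>z. fst z * sqrt r" "\<lambda>z. snd z * sqrt s" "sqrt r" "sqrt s" 0 0]
        distributed_std_normal_scale[OF rs(1) NN.prob_space_axioms std_normal_pair(2)]
        distributed_std_normal_scale[OF rs(2) NN.prob_space_axioms std_normal_pair(3)] rs
      by (simp add: comp_def)
    have "distributed std_normal_distribution lborel (\<lambda>x. x) std_normal_density"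
      by (auto simp: distributed_def intro!: distr_id2)
    then have e: "distributed std_normal_distribution lborel (\<lambda>g. g * sqrt (r + s)) (normal_density 0 (sqrt (r + s)))"
      using rs by (intro distributed_std_normal_scale N.prob_space_axioms) auto
    show ?thesis
      using distributed_integral[OF d, of f] distributed_integral[OF e, of f] by simp
  qed
qed

lemma tame_pair_integrable:
  assumes "0 \<le> r" "0 \<le> s" "tame f"
  shows "integrable (std_normal_distribution \<Otimes>\<^sub>M std_normal_distribution)
      (\<lambda>z. f (x + fst z * sqrt r + snd z * sqrt s))"
proof -
  interpret N: prob_space std_normal_distribution by (rule prob_space_std_normal)
  interpret NN: pair_prob_space std_normal_distribution std_normal_distribution ..
  note [measurable] = tame_measurable[OF assms(3)]
  have a: "tame (\<lambda>x. \<bar>f x\<bar>)" using assms(3) unfolding tame_def by auto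
  show ?thesis
  proof (rule NN.Fubini_integrable)
    have "(\<lambda>g. \<integral>h. norm (f (x + fst (g, h) * sqrt r + snd (g, h) * sqrt s)) \<partial>std_normal_distribution)
        = (\<lambda>g. heat s (\<lambda>x. \<bar>f x\<bar>) (x + g * sqrt r))"
      by (simp add: heat_def)
    then show "integrable std_normal_distribution (\<lambda>g. \<integral>h. norm (f (x + fst (g, h) * sqrt r + snd (g, h) * sqrt s)) \<partial>std_normal_distribution)"
      using tame_integrable[OF tame_heat[OF a \<open>0 \<le> s\<close>]] by simp
  qed (use tame_integrable[OF assms(3)] in auto)
qed

lemma heat_semigroup:
  assumes "0 \<le> r" "0 \<le> s" "tame f"
  shows "heat r (heat s f) x = heat (r + s) f x"
proof -
  interpret N: prob_space std_normal_distribution by (rule prob_space_std_normal)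
  interpret NN: pair_prob_space std_normal_distribution std_normal_distribution ..
  note [measurable] = tame_measurable[OF assms(3)]
  have "heat r (heat s f) x = (\<integral>z. f (x + fst z * sqrt r + snd z * sqrt s) \<partial>(std_normal_distribution \<Otimes>\<^sub>M std_normal_distribution))"
    using NN.integral_fst'[OF tame_pair_integrable[OF assms, of x]] by (simp add: heat_def add.assoc)
  also have "\<dots> = heat (r + s) f x"
    using integral_std_normal_pair[OF assms(1,2), of "\<lambda>y. f (x + y)"] by (simp add: heat_def add.assoc)
  finally show ?thesis .
qed

lemma heat_split:
  assumes "0 \<le> s" "s \<le> s'" "tame f" shows "heat s' f x = heat s (heat (s' - s) f) x"
  using heat_semigroup[of s "s' - s" f x] assms by simp

section \<open>Expansions of the heat operator and powers of cosh\<close>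

lemma cosh_add_le: "cosh (x + y) \<le> exp \<bar>y\<bar> * cosh (x :: real)"
proof -
  have "exp (x + y) \<le> exp \<bar>y\<bar> * exp x" "exp (- (x + y)) \<le> exp \<bar>y\<bar> * exp (- x)"
    by (auto simp flip: exp_add)
  then show ?thesis by (simp add: cosh_field_def field_simps)
qed

lemma exp_abs_le_cosh: "exp \<bar>x\<bar> \<le> 2 * cosh (x :: real)"
  by (cases "0 \<le> x") (auto simp: cosh_field_def)

text \<open>The linear term of the expansion integrates to zero by symmetry of the Gaussian.\<close>

lemma heat_expand:
  assumes f: "tame f" and h: "0 \<le> h" "h \<le> 1"
    and ex: "\<And>y. \<bar>f (x + y) - (a0 + a1 * y + a2 * y\<^sup>2)\<bar> \<le> b * (\<bar>y\<bar> ^ n * exp \<bar>y\<bar>)"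
  shows "\<bar>heat h f x - (a0 + a2 * h)\<bar> \<le> b * (2 * exp ((n + 1)\<^sup>2 / 2)) * sqrt h ^ n"
proof -
  interpret prob_space std_normal_distribution by (rule prob_space_std_normal)
  let ?N = std_normal_distribution
  have b: "0 \<le> b" using order.trans[OF abs_ge_zero ex[of 1]] by (simp add: zero_le_mult_iff)
  let ?p = "\<lambda>g. a0 + a1 * (g * sqrt h) + a2 * (g * sqrt h)\<^sup>2"
  have p_eq: "?p = (\<lambda>g. a0 + (a1 * sqrt h) * g ^ 1 + (a2 * h) * g ^ 2)"
    using h by (auto simp: power_mult_distrib algebra_simps)
  have p: "integrable ?N ?p"
    unfolding p_eq by (intro Bochner_Integration.integrable_add integrable_mult_right integrable_std_normal_distribution_moment integrable_const)
  have "(\<integral>g. ?p g \<partial>?N) = a0 + a2 * h"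
    unfolding p_eq using integrable_std_normal_distribution_moment[of 1] integrable_std_normal_distribution_moment[of 2]
      integral_std_normal_distribution_moment_odd[of 1] std_normal_distribution_even_moments(1)[of 1] prob_space
    by (simp add: fact_2)
  then have eq: "heat h f x - (a0 + a2 * h) = (\<integral>g. f (x + g * sqrt h) - ?p g \<partial>?N)"
    using p tame_integrable[OF f] by (simp add: heat_def)
  have bound: "integrable ?N (\<lambda>g. b * sqrt h ^ n * (2 * cosh (0 + g * real (n + 1))))"
    by (intro integrable_mult_right std_normal_cosh)
  have "\<bar>heat h f x - (a0 + a2 * h)\<bar> \<le> (\<integral>g. \<bar>f (x + g * sqrt h) - ?p g\<bar> \<partial>?N)"
    unfolding eq using integral_norm_bound[of ?N "\<lambda>g. f (x + g * sqrt h) - ?p g"] by (simp only: real_norm_def)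
  also have "\<dots> \<le> (\<integral>g. b * sqrt h ^ n * (2 * cosh (0 + g * real (n + 1))) \<partial>?N)"
  proof (rule integral_mono)
    fix g :: real
    have g: "\<bar>g * sqrt h\<bar> \<le> \<bar>g\<bar>" using h by (simp add: abs_mult mult_left_le)
    \<comment> \<open>Polynomial and exponential growth are absorbed into
      \<open>exp ((n + 1) * \<bar>g\<bar>)\<close>, at most twice a \<open>cosh\<close> whose
      Gaussian mean is explicit. This is the origin of the constant
      \<open>2 * exp ((n + 1)^2 / 2)\<close>.\<close>
    have "\<bar>g\<bar> ^ n \<le> exp \<bar>g\<bar> ^ n" by (intro power_mono order.trans[OF _ exp_ge_add_one_self]) auto
    also have "\<dots> = exp (n * \<bar>g\<bar>)" by (simp flip: exp_of_nat_mult)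
    finally have *: "\<bar>g\<bar> ^ n * exp \<bar>g\<bar> \<le> exp (n * \<bar>g\<bar>) * exp \<bar>g\<bar>" by simp
    also have "\<dots> = exp \<bar>g * real (n + 1)\<bar>"
      unfolding abs_mult exp_add[symmetric] by (simp add: algebra_simps)
    also have "\<dots> \<le> 2 * cosh (0 + g * real (n + 1))" using exp_abs_le_cosh by simp
    finally have 1: "\<bar>g\<bar> ^ n * exp \<bar>g\<bar> \<le> 2 * cosh (0 + g * real (n + 1))" .
    have "\<bar>f (x + g * sqrt h) - ?p g\<bar> \<le> b * (\<bar>g * sqrt h\<bar> ^ n * exp \<bar>g * sqrt h\<bar>)"
      by (rule ex)
    also have "\<dots> \<le> b * ((\<bar>g\<bar> * sqrt h) ^ n * exp \<bar>g\<bar>)"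
      using g b h by (intro mult_mono power_mono) (auto simp: abs_mult)
    also have "\<dots> = b * sqrt h ^ n * (\<bar>g\<bar> ^ n * exp \<bar>g\<bar>)" by (simp add: power_mult_distrib)
    also have "\<dots> \<le> b * sqrt h ^ n * (2 * cosh (0 + g * real (n + 1)))"
      using 1 b h by (intro mult_left_mono) auto
    finally show "\<bar>f (x + g * sqrt h) - ?p g\<bar> \<le> b * sqrt h ^ n * (2 * cosh (0 + g * real (n + 1)))" .
  qed (rule integrable_abs[OF Bochner_Integration.integrable_diff[OF tame_integrable[OF f] p]], rule bound)
  also have "\<dots> = b * sqrt h ^ n * (2 * exp ((real (n + 1))\<^sup>2 / 2))"
    using std_normal_cosh(2)[of 0 "real (n + 1)"] by simp
  finally show ?thesis by (simp add: mult_ac add.commute)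
qed

text \<open>A Gaussian displacement over time h has size sqrt h, so a cubic remainder in space
  becomes \<open>sqrt h ^ 3\<close>. Being o(h), it is enough for differentiability; all time
  derivatives below are obtained in this form.\<close>

lemma has_derivative_from_remainder:
  fixes F :: "real \<Rightarrow> real"
  assumes "\<And>y. y \<in> S \<Longrightarrow> \<bar>y - x\<bar> \<le> 1 \<Longrightarrow> \<bar>F y - F x - (y - x) * D\<bar> \<le> C * sqrt \<bar>y - x\<bar> ^ 3"
  shows "(F has_real_derivative D) (at x within S)"
  unfolding has_field_derivative_iff
proof (rule Lim_transform_within)
  have "((\<lambda>y. C * sqrt \<bar>y - x\<bar>) \<longlongrightarrow> C * sqrt \<bar>x - x\<bar>) (at x within S)"
    by (intro tendsto_intros)
  then have lim: "((\<lambda>y. C * sqrt \<bar>y - x\<bar>) \<longlongrightarrow> 0) (at x within S)" by simp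
  have ev: "\<forall>\<^sub>F y in at x within S. norm ((F y - F x) / (y - x) - D) \<le> C * sqrt \<bar>y - x\<bar>"
    unfolding eventually_at
  proof (intro exI[of _ 1] conjI ballI impI)
    fix y assume y: "y \<in> S" "y \<noteq> x \<and> dist y x < 1"
    then have yx: "0 < \<bar>y - x\<bar>" "\<bar>y - x\<bar> \<le> 1" by (auto simp: dist_real_def)
    have "sqrt \<bar>y - x\<bar> ^ 3 = sqrt \<bar>y - x\<bar> * \<bar>y - x\<bar>" using yx by (simp add: power3_eq_cube)
    then have "\<bar>F y - F x - (y - x) * D\<bar> \<le> C * sqrt \<bar>y - x\<bar> * \<bar>y - x\<bar>"
      using assms[OF y(1) yx(2)] by (simp add: mult.assoc)
    moreover have "(F y - F x) / (y - x) - D = (F y - F x - (y - x) * D) / (y - x)"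
      using yx by (simp add: field_simps)
    ultimately show "norm ((F y - F x) / (y - x) - D) \<le> C * sqrt \<bar>y - x\<bar>"
      using yx by (simp add: abs_divide divide_le_eq)
  qed auto
  show "((\<lambda>y. ((F y - F x) / (y - x) - D) + D) \<longlongrightarrow> D) (at x within S)"
    using tendsto_add[OF Lim_null_comparison[OF ev lim] tendsto_const[of D]] by simp
qed (auto intro: zero_less_one)

lemma taylor_remainder_le:
  fixes F :: "nat \<Rightarrow> real \<Rightarrow> real"
  assumes F: "\<And>m x. (F m has_real_derivative F (Suc m) x) (at x)"
    and B: "\<And>t. \<bar>t\<bar> \<le> \<bar>y\<bar> \<Longrightarrow> \<bar>F n (x + t)\<bar> \<le> B"
  shows "\<bar>F 0 (x + y) - (\<Sum>m<n. F m x / fact m * y ^ m)\<bar> \<le> B * \<bar>y\<bar> ^ n"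
proof -
  have "DERIV (\<lambda>t. F m (x + t)) t :> F (Suc m) (x + t)" for m t
    using DERIV_shift[of "F m" "F (Suc m) (x + t)" t x] F by (simp add: add.commute)
  then obtain t where t: "\<bar>t\<bar> \<le> \<bar>y\<bar>"
    "F 0 (x + y) = (\<Sum>m<n. F m (x + 0) / fact m * y ^ m) + F n (x + t) / fact n * y ^ n"
    using Maclaurin_all_le[of "\<lambda>m t. F m (x + t)" "\<lambda>t. F 0 (x + t)" y n] by auto
  have "\<bar>F 0 (x + y) - (\<Sum>m<n. F m x / fact m * y ^ m)\<bar> = \<bar>F n (x + t)\<bar> / fact n * \<bar>y\<bar> ^ n"
    using t(2) by (simp add: abs_mult power_abs)
  also have "\<dots> \<le> B * \<bar>y\<bar> ^ n"
  proof (intro mult_right_mono)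
    have "\<bar>F n (x + t)\<bar> / fact n \<le> \<bar>F n (x + t)\<bar> / 1" by (intro divide_left_mono) (auto simp: fact_ge_1)
    then show "\<bar>F n (x + t)\<bar> / fact n \<le> B" using B[OF t(1)] by simp
  qed auto
  finally show ?thesis .
qed

definition tame_tower :: "(nat \<Rightarrow> real \<Rightarrow> real) \<Rightarrow> bool" where
  "tame_tower F \<longleftrightarrow> (\<forall>m. tame (F m)) \<and> (\<forall>m x. (F m has_real_derivative F (Suc m) x) (at x))"

text \<open>Differentiation under the Gaussian mean by a quadratic Taylor bound: the second
  derivative is at most a multiple of \<open>cosh\<close>, whose average is explicit, so the error
  after averaging is still quadratic in the displacement.\<close>

lemma heat_has_derivative:
  assumes F: "tame_tower F" and r: "0 \<le> r"
  shows "(heat r (F m) has_real_derivative heat r (F (Suc m)) x) (at x)"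
proof -
  have t: "tame (F k)" for k using F by (simp add: tame_tower_def)
  have d: "(F k has_real_derivative F (Suc k) z) (at z)" for k z using F by (simp add: tame_tower_def)
  obtain C where C: "C > 0" "\<And>z. \<bar>F (Suc (Suc m)) z\<bar> \<le> C * cosh z"
    using tame_bound[OF t[of "Suc (Suc m)"]] by blast
  define E where "E = C * exp 1 * (exp (r / 2) * cosh x)"
  show ?thesis
  proof (rule has_derivative_from_remainder[where C = E])
    fix y :: real assume y: "\<bar>y - x\<bar> \<le> 1"
    define k where "k = y - x"
    have rem: "\<bar>F m (z + k) - F m z - k * F (Suc m) z\<bar> \<le> C * exp 1 * k\<^sup>2 * cosh z" for z
    proof -
      have "\<bar>F m (z + k) - (\<Sum>j<2. F (m + j) z / fact j * k ^ j)\<bar> \<le> (C * exp 1 * cosh z) * \<bar>k\<bar> ^ 2"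
      proof (rule taylor_remainder_le[of "\<lambda>j. F (m + j)" k 2 z, unfolded add_0_right])
        fix t assume tk: "\<bar>t\<bar> \<le> \<bar>k\<bar>"
        have "\<bar>F (Suc (Suc m)) (z + t)\<bar> \<le> C * cosh (z + t)" by (rule C)
        also have "\<dots> \<le> C * (exp \<bar>t\<bar> * cosh z)" using C cosh_add_le by (intro mult_left_mono) auto
        also have "\<dots> \<le> C * (exp 1 * cosh z)"
          using C tk y unfolding k_def by (intro mult_left_mono mult_right_mono) auto
        finally show "\<bar>F (m + 2) (z + t)\<bar> \<le> C * exp 1 * cosh z" by simp
      qed (use d in auto)
      then show ?thesis by (simp add: numeral_2_eq_2 mult_ac diff_diff_eq)
    qed
    have tk: "tame (\<lambda>z. F m (z + k))"
    proof -
      obtain C where C: "C > 0" "\<And>z. \<bar>F m z\<bar> \<le> C * cosh z" using tame_bound[OF t[of m]] by blast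
      note [measurable] = tame_measurable[OF t[of m]]
      show ?thesis
      proof (rule tameI[of _ "C * exp \<bar>k\<bar>"])
        show "\<bar>F m (z + k)\<bar> \<le> C * exp \<bar>k\<bar> * cosh z" for z
          using C(2)[of "z + k"] mult_left_mono[OF cosh_add_le[of z k], of C] C(1)
          by (simp only: mult.assoc) linarith
      qed measurable
    qed
    have "heat r (F m) y - heat r (F m) x - (y - x) * heat r (F (Suc m)) x
      = heat r (\<lambda>z. F m (z + k) - F m z - k * F (Suc m) z) x"
    proof -
      have "heat r (F m) y = heat r (\<lambda>z. F m (z + k)) x"
        by (simp add: heat_def k_def algebra_simps)
      moreover have "heat r (\<lambda>z. F m (z + k) - F m z - k * F (Suc m) z) x
          = heat r (\<lambda>z. F m (z + k)) x - heat r (F m) x - k * heat r (F (Suc m)) x"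
        by (simp add: heat_diff heat_cmult tame_diff tame_cmult tk t)
      ultimately show ?thesis by (simp add: k_def)
    qed
    also have "\<bar>\<dots>\<bar> \<le> heat r (\<lambda>z. C * exp 1 * k\<^sup>2 * cosh z) x"
      by (intro heat_abs_le tame_diff tame_cmult tk t tame_cosh rem)
    also have "\<dots> = E * \<bar>y - x\<bar> ^ 2"
      using r by (simp add: heat_cmult heat_cosh E_def k_def)
    also have "\<dots> \<le> E * sqrt \<bar>y - x\<bar> ^ 3"
    proof -
      have s: "sqrt \<bar>y - x\<bar> \<le> 1" using y by simp
      have "\<bar>y - x\<bar> ^ 2 = (sqrt \<bar>y - x\<bar> ^ 2) ^ 2" by simp
      also have "\<dots> = sqrt \<bar>y - x\<bar> ^ 4" unfolding power_mult[symmetric] by (simp del: real_sqrt_pow2 real_sqrt_pow2_iff)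
      also have "\<dots> \<le> sqrt \<bar>y - x\<bar> ^ 3" using s by (intro power_decreasing) auto
      finally show ?thesis using C by (intro mult_left_mono) (auto simp: E_def)
    qed
    finally show "\<bar>heat r (F m) y - heat r (F m) x - (y - x) * heat r (F (Suc m)) x\<bar> \<le> E * sqrt \<bar>y - x\<bar> ^ 3" .
  qed
qed

text \<open>Since tanh' = 1 - tanh^2, differentiating P(tanh) cosh^e gives (e t P + (1 - t^2) P')
  cosh^e at t = tanh, which is the recursion. As tanh stays in (-1, 1), every derivative of cosh^e
  is bounded by a multiple of cosh^e itself.\<close>

primrec cosh_poly :: "real \<Rightarrow> nat \<Rightarrow> real poly" where
  "cosh_poly e 0 = 1"
| "cosh_poly e (Suc k) = [:0, e:] * cosh_poly e k + [:1, 0, -1:] * pderiv (cosh_poly e k)"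

text \<open>The \<open>k\<close>-th derivative of \<open>cosh\<close> to the power \<open>e\<close>.\<close>

definition coshpow :: "real \<Rightarrow> nat \<Rightarrow> real \<Rightarrow> real" where
  "coshpow e k x = poly (cosh_poly e k) (tanh x) * cosh x powr e"

lemma coshpow_0: "coshpow e 0 x = cosh x powr e"
  and coshpow_1: "coshpow e (Suc 0) x = e * tanh x * cosh x powr e"
  and coshpow_2: "coshpow e (Suc (Suc 0)) x = (e\<^sup>2 * (tanh x)\<^sup>2 + e * (1 - (tanh x)\<^sup>2)) * cosh x powr e"
  by (simp_all add: coshpow_def pderiv_pCons power2_eq_square algebra_simps)

lemma coshpow_has_derivative: "(coshpow e k has_real_derivative coshpow e (Suc k) x) (at x)"
proof -
  have 1: "((\<lambda>x. cosh x powr e) has_real_derivative e * tanh x * cosh x powr e) (at x)"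
    by (auto intro!: derivative_eq_intros simp: tanh_def powr_diff)
  have 2: "((\<lambda>x. poly (cosh_poly e k) (tanh x)) has_real_derivative
      poly (pderiv (cosh_poly e k)) (tanh x) * (1 - (tanh x)\<^sup>2)) (at x)"
    by (rule DERIV_chain2[OF poly_DERIV]) (auto intro!: derivative_eq_intros)
  show ?thesis
    unfolding coshpow_def[abs_def]
    by (rule DERIV_cong[OF DERIV_mult[OF 2 1]]) (simp add: algebra_simps power2_eq_square)
qed

lemma coshpow_continuous [continuous_intros]: "continuous_on S (coshpow e k)"
  by (rule DERIV_continuous_on) (rule has_field_derivative_at_within[OF coshpow_has_derivative])

lemma coshpow_measurable [measurable]: "coshpow e k \<in> borel_measurable borel"
  by (intro borel_measurable_continuous_onI coshpow_continuous)

lemma coshpow_bound: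
  obtains C where "C > 0" "\<And>x. \<bar>coshpow e k x\<bar> \<le> C * coshpow e 0 x"
proof -
  have "compact (poly (cosh_poly e k) ` {-1..1})"
    by (intro compact_continuous_image continuous_intros compact_Icc)
  then obtain C where C: "C > 0" "\<And>t. t \<in> {-1..1} \<Longrightarrow> \<bar>poly (cosh_poly e k) t\<bar> \<le> C"
    using compact_imp_bounded[of "poly (cosh_poly e k) ` {-1..1}"] unfolding bounded_pos by auto
  have "\<bar>coshpow e k x\<bar> \<le> C * coshpow e 0 x" for x
    using C(2)[of "tanh x"] tanh_real_lt_1[of x] tanh_real_gt_neg1[of x]
    by (auto simp: coshpow_def abs_mult intro!: mult_right_mono)
  then show ?thesis using C that by blast
qed

lemma coshpow_0_le_cosh: "e \<le> 1 \<Longrightarrow> coshpow e 0 x \<le> cosh x"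
  using powr_mono[of e 1 "cosh x"] cosh_real_ge_1[of x] cosh_real_pos[of x] by (simp add: coshpow_0)

lemma coshpow_0_pos: "0 < coshpow e 0 x"
  using cosh_real_pos[of x] by (simp add: coshpow_0)

lemma tame_coshpow: assumes "e \<le> 1" shows "tame (coshpow e k)"
proof -
  obtain C where C: "C > 0" "\<And>x. \<bar>coshpow e k x\<bar> \<le> C * coshpow e 0 x" using coshpow_bound[of e k] by blast
  show ?thesis
    by (rule tameI[of _ C]) (use C coshpow_0_le_cosh[OF assms] in 
       \<open>auto intro!: order.trans[OF C(2)] mult_left_mono\<close>)
qed

lemma tame_tower_coshpow: "e \<le> 1 \<Longrightarrow> tame_tower (coshpow e)"
  by (simp add: tame_tower_def tame_coshpow coshpow_has_derivative)

lemma lipschitz_of_deriv_bound: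
  fixes f :: "real \<Rightarrow> real"
  assumes "\<And>z. (f has_real_derivative f' z) (at z)" "\<And>z. \<bar>f' z\<bar> \<le> C"
  shows "\<bar>f (x + y) - f x\<bar> \<le> C * \<bar>y\<bar>"
  using field_differentiable_bound[of UNIV f f' C "x + y" x] assms by simp

lemma sqrt_cube: "0 \<le> h \<Longrightarrow> sqrt h ^ 3 = h * sqrt h"
  by (simp add: power3_eq_cube)

text \<open>The slope in the hypothesis sits at the later end, so only the left derivative is
  immediate, and \<open>L\<close> is not assumed continuous. To the right, the hypothesis is applied
  to all three pairs among s - h, s, s + h; together they force \<open>L (s + h)\<close> to be close
  enough to \<open>L s\<close>.\<close>

lemma left_expansion_derivatives:
  fixes R L :: "real \<Rightarrow> real"
  assumes step: "\<And>s s'. 0 \<le> s \<Longrightarrow> s \<le> s' \<Longrightarrow> s' \<le> a \<Longrightarrow> s' - s \<le> 1 \<Longrightarrow>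
    \<bar>R s' - R s - (s' - s) * L s'\<bar> \<le> C * sqrt (s' - s) ^ 3"
  shows left_deriv_of_left_expansion: "s \<le> a \<Longrightarrow> (R has_real_derivative L s) (at s within {0..s})"
    and deriv_of_left_expansion: "0 < s \<Longrightarrow> s < a \<Longrightarrow> (R has_real_derivative L s) (at s)"
proof -
  have left: "\<bar>R y - R s - (y - s) * L s\<bar> \<le> C * sqrt \<bar>y - s\<bar> ^ 3"
    if "0 \<le> y" "y \<le> s" "s \<le> a" "\<bar>y - s\<bar> \<le> 1" for y s
  proof -
    have "\<bar>R y - R s - (y - s) * L s\<bar> = \<bar>R s - R y - (s - y) * L s\<bar>"
      by (subst abs_minus_commute) (simp add: algebra_simps)
    also have "\<dots> \<le> C * sqrt (s - y) ^ 3" using that by (intro step) auto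
    finally show ?thesis using that by (simp add: abs_of_nonpos)
  qed
  show "(R has_real_derivative L s) (at s within {0..s})" if "s \<le> a"
    by (rule has_derivative_from_remainder[where C = C]) (use left that in auto)
  assume s: "0 < s" "s < a"
  define d where "d = min (min s (a - s)) (1 / 2)"
  have d: "0 < d" "d \<le> s" "d \<le> a - s" "d \<le> 1 / 2" using s unfolding d_def by linarith+
  have C: "0 \<le> C"
  proof -
    have "0 \<le> C * sqrt d ^ 3" using order.trans[OF abs_ge_zero step[of "s - d" s]] d s by simp
    then show ?thesis using d by (simp add: zero_le_mult_iff)
  qed
  have right: "\<bar>R y - R s - (y - s) * L s\<bar> \<le> 7 * C * sqrt \<bar>y - s\<bar> ^ 3" if y: "s \<le> y" "y < s + d" for y
  proof -
    define h where "h = y - s"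
    have h: "0 \<le> h" "h \<le> d" "y = s + h" using y by (auto simp: h_def)
    have 1: "\<bar>R y - R s - h * L y\<bar> \<le> C * sqrt h ^ 3"
      using step[of s y] h d s by auto
    have 2: "\<bar>R s - R (s - h) - h * L s\<bar> \<le> C * sqrt h ^ 3"
      using step[of "s - h" s] h d s by auto
    have "\<bar>R y - R (s - h) - (2 * h) * L y\<bar> \<le> C * sqrt (2 * h) ^ 3"
      using step[of "s - h" y] h d s by auto
    also have "\<dots> \<le> C * (3 * sqrt h ^ 3)"
    proof (intro mult_left_mono C)
      have "sqrt 2 \<le> 3 / 2" by (rule real_le_lsqrt) (auto simp: power2_eq_square)
      then have "2 * h * (sqrt 2 * sqrt h) \<le> 2 * h * (3 / 2 * sqrt h)"
        using h by (intro mult_left_mono mult_right_mono) auto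
      moreover have "sqrt (2 * h) ^ 3 = 2 * h * sqrt (2 * h)" by (rule sqrt_cube) (use h in auto)
      ultimately show "sqrt (2 * h) ^ 3 \<le> 3 * sqrt h ^ 3"
        using h by (simp only: real_sqrt_mult sqrt_cube)
    qed
    finally have 3: "\<bar>R y - R (s - h) - 2 * (h * L y)\<bar> \<le> 3 * (C * sqrt h ^ 3)" by (simp add: algebra_simps)
    \<comment> \<open>Twice fact 1 plus fact 2 minus fact 3 eliminates \<open>L y\<close> and
      \<open>R (s - h)\<close>.\<close>
    have "\<bar>R y - R s - h * L s\<bar> \<le> 7 * (C * sqrt h ^ 3)" using 1 2 3 by linarith
    then show ?thesis using y(1) by (simp add: h_def)
  qed
  have "(R has_real_derivative L s) (at s within {s - d<..<s + d})"
  proof (rule has_derivative_from_remainder[where C = "7 * C"])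
    fix y assume y: "y \<in> {s - d<..<s + d}" "\<bar>y - s\<bar> \<le> 1"
    show "\<bar>R y - R s - (y - s) * L s\<bar> \<le> 7 * C * sqrt \<bar>y - s\<bar> ^ 3"
    proof (cases "s \<le> y")
      case True then show ?thesis using right y by auto
    next
      case False
      then have "\<bar>R y - R s - (y - s) * L s\<bar> \<le> C * sqrt \<bar>y - s\<bar> ^ 3" using left y d s by auto
      also have "\<dots> \<le> 7 * C * sqrt \<bar>y - s\<bar> ^ 3" using C by (intro mult_right_mono) auto
      finally show ?thesis .
    qed
  qed
  then show "(R has_real_derivative L s) (at s)"
    using d by (simp add: at_within_open[of s "{s - d<..<s + d}"])
qed

lemma tanh_square_real: "(tanh x)\<^sup>2 = 1 - 1 / (cosh x)\<^sup>2" for x :: real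
proof -
  have "(tanh x)\<^sup>2 = (sinh x)\<^sup>2 / (cosh x)\<^sup>2" by (simp add: tanh_def power_divide)
  also have "(sinh x)\<^sup>2 = (cosh x)\<^sup>2 - 1" by (simp add: cosh_square_eq)
  finally show ?thesis by (simp add: diff_divide_distrib)
qed

section \<open>The constraint on the time of the first atom\<close>

text \<open>The diagonal Pade approximant of order two. The difference of the two sides and its
  first two derivatives vanish at 0, and its third derivative is \<open>exp x * x^2\<close>. With x
  = 2 a it gives \<open>1 / (2 a) - 1 / (exp (2 a) - 1) \<ge> 1 / 2 - a / 6\<close>.\<close>

lemma exp_pade:
  assumes "0 \<le> (x :: real)" shows "12 + 6 * x + x\<^sup>2 \<le> exp x * (12 - 6 * x + x\<^sup>2)"
proof -
  define g0 g1 g2 :: "real \<Rightarrow> real"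
    where "g0 x = exp x * (12 - 6 * x + x\<^sup>2) - (12 + 6 * x + x\<^sup>2)"
    and "g1 x = exp x * (6 - 4 * x + x\<^sup>2) - (6 + 2 * x)" and "g2 x = exp x * (2 - 2 * x + x\<^sup>2) - 2" for x
  have d: "(g0 has_real_derivative g1 x) (at x)" "(g1 has_real_derivative g2 x) (at x)"
    "(g2 has_real_derivative exp x * x\<^sup>2) (at x)" for x
    unfolding g0_def[abs_def] g1_def[abs_def] g2_def[abs_def] g1_def g2_def
    by (auto intro!: derivative_eq_intros simp: algebra_simps power2_eq_square)
  have g2: "0 \<le> g2 x" if "0 \<le> x" for x
    using DERIV_nonneg_imp_nondecreasing[OF that, of g2] d(3) by (force simp: g2_def)
  have g1: "0 \<le> g1 x" if "0 \<le> x" for x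
    using DERIV_nonneg_imp_nondecreasing[OF that, of g1] d(2) g2 by (force simp: g1_def)
  have "0 \<le> g0 x"
    using DERIV_nonneg_imp_nondecreasing[OF assms, of g0] d(1) g1 by (force simp: g0_def)
  then show ?thesis by (simp add: g0_def)
qed

text \<open>The weight \<open>w s = exp (2 s) + k\<close> solves \<open>2 w - w' = const\<close>, which turns the integral of
  \<open>(f' + 2 f) w\<close> into boundary terms and the mean of \<open>f\<close>; \<open>k\<close> makes \<open>w\<close> have mean zero, so that
  the monotone factor can be compared with its value at the zero of \<open>w\<close>.\<close>

lemma mean_of_quasi_monotone_derivative:
  fixes f f' :: "real \<Rightarrow> real"
  assumes a: "0 < a" and cont: "continuous_on {0..a} f"
    and deriv: "\<And>s. 0 < s \<Longrightarrow> s < a \<Longrightarrow> (f has_real_derivative f' s) (at s)"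
    and mono: "\<And>s s'. 0 \<le> s \<Longrightarrow> s \<le> s' \<Longrightarrow> s' \<le> a \<Longrightarrow> f' s + 2 * f s \<le> f' s' + 2 * f s'"
    and f0: "f 0 = 0"
  shows "(exp (2 * a) - 1) / a * integral {0..a} f \<le> f a * (exp (2 * a) - (exp (2 * a) - 1) / (2 * a))"
proof -
  define k where "k = - (exp (2 * a) - 1) / (2 * a)"
  define w where "w s = exp (2 * s) + k" for s
  define s0 where "s0 = ln (- k) / 2"
  define y where "y = f' s0 + 2 * f s0"
  define F where "F s = integral {0..s} f" for s
  \<comment> \<open>A primitive of \<open>(f' + 2 f - y) * w\<close>, because
    \<open>w' + 2 k = 2 w\<close>. It vanishes at 0, and its \<open>y\<close> term vanishes at
    \<open>a\<close> as well because \<open>w\<close> has mean zero.\<close>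
  define \<Psi> where "\<Psi> s = f s * w s + 2 * k * F s - y * (k * s + (exp (2 * s) - 1) / 2)" for s
  have k_eq: "- k = (exp (2 * a) - 1) / (2 * a)" unfolding k_def minus_divide_left by simp
  \<comment> \<open>\<open>- k\<close> is the mean of \<open>exp (2 s)\<close> over
    \<open>{0..a}\<close>, so it lies between 1 and \<open>exp (2 a)\<close>; this puts the zero
    \<open>s0\<close> of \<open>w\<close> inside the interval.\<close>
  have k1: "1 \<le> - k"
    using exp_ge_add_one_self[of "2 * a"] a by (simp add: k_def field_simps)
  have k2: "- k \<le> exp (2 * a)"
    using exp_ge_add_one_self[of "- (2 * a)"] a
      mult_right_mono[of "1 - 2 * a" "exp (- (2 * a))" "exp (2 * a)"]
    unfolding k_eq by (simp add: divide_le_eq algebra_simps flip: exp_add)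
  have s0: "0 \<le> s0" "s0 \<le> a" "exp (2 * s0) = - k"
    using k1 k2 ln_le_cancel_iff[of "- k" "exp (2 * a)"] by (auto simp: s0_def)
  have Fd: "(F has_real_derivative f s) (at s)" if "0 < s" "s < a" for s
  proof -
    have "(F has_vector_derivative f s) (at s within {0..a})"
      unfolding F_def using that by (intro integral_has_vector_derivative cont) auto
    then show ?thesis
      using that at_within_Icc_at[of 0 s a] by (simp add: has_real_derivative_iff_has_vector_derivative)
  qed
  have Fc: "continuous_on {0..a} F"
    unfolding F_def by (intro indefinite_integral_continuous_1 integrable_continuous_interval cont)
  have "\<Psi> 0 \<le> \<Psi> a"
  proof (rule DERIV_nonneg_imp_increasing_open[of 0 a \<Psi>])
    show "continuous_on {0..a} \<Psi>"
      unfolding \<Psi>_def[abs_def] w_def by (intro continuous_intros cont Fc) auto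
    fix s assume s: "0 < s" "s < a"
    have "(\<Psi> has_real_derivative (f' s + 2 * f s - y) * w s) (at s)"
      unfolding \<Psi>_def[abs_def] w_def
      by (auto intro!: derivative_eq_intros deriv[OF s] Fd[OF s] simp: algebra_simps)
    moreover have "0 \<le> (f' s + 2 * f s - y) * w s"
    proof (cases "s \<le> s0")
      case True
      then have "f' s + 2 * f s - y \<le> 0" using mono[of s s0] s s0 by (simp add: y_def)
      moreover have "w s \<le> 0" using True s0(3) exp_le_cancel_iff[of "2 * s" "2 * s0"] by (simp add: w_def)
      ultimately show ?thesis by (rule mult_nonpos_nonpos)
    next
      case False
      then have "0 \<le> f' s + 2 * f s - y" using mono[of s0 s] s s0 by (simp add: y_def)
      moreover have "0 \<le> w s" using False s0(3) exp_le_cancel_iff[of "2 * s0" "2 * s"] by (simp add: w_def)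
      ultimately show ?thesis by simp
    qed
    ultimately show "\<exists>z. DERIV \<Psi> s :> z \<and> 0 \<le> z" by blast
  qed (use a in auto)
  moreover have "\<Psi> 0 = 0" by (simp add: \<Psi>_def f0 F_def)
  moreover have "k * a + (exp (2 * a) - 1) / 2 = 0" using a by (simp add: k_def field_simps)
  ultimately have "0 \<le> f a * w a + 2 * k * F a" by (simp add: \<Psi>_def)
  moreover have "2 * k = - ((exp (2 * a) - 1) / a)" using a by (simp add: k_def field_simps)
  moreover have "w a = exp (2 * a) - (exp (2 * a) - 1) / (2 * a)" by (simp add: w_def k_def diff_divide_distrib)
  ultimately show ?thesis by (simp add: F_def)
qed

text \<open>Cancelling \<open>f a\<close> from the mean bound leaves a scalar inequality between
  \<open>a\<close> and \<open>p\<close>, which the Pade bound for \<open>exp (2 a)\<close> makes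
  rational.\<close>

lemma threshold:
  fixes f f' :: "real \<Rightarrow> real"
  assumes a: "0 < a" and cont: "continuous_on {0..a} f"
    and deriv: "\<And>s. 0 < s \<Longrightarrow> s < a \<Longrightarrow> (f has_real_derivative f' s) (at s)"
    and mono: "\<And>s s'. 0 \<le> s \<Longrightarrow> s \<le> s' \<Longrightarrow> s' \<le> a \<Longrightarrow> f' s + 2 * f s \<le> f' s' + 2 * f s'"
    and f0: "f 0 = 0" and fa: "0 < f a"
    and p: "3 \<le> (p :: real)" and mean: "integral {0..a} f = f a * a * (p - 1) / p"
  shows "2 * (p - 2) \<le> (p - 1) * a"
proof -
  define E where "E = exp (2 * a) - 1"
  have E: "0 < E" using a by (simp add: E_def)
  have "E / a * (f a * a * (p - 1) / p) \<le> f a * (exp (2 * a) - E / (2 * a))"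
    using mean_of_quasi_monotone_derivative[OF a cont deriv mono f0] unfolding mean E_def by simp
  moreover have "E / a * (f a * a * (p - 1) / p) = f a * (E * (p - 1) / p)" using a by simp
  moreover have "exp (2 * a) = E + 1" by (simp add: E_def)
  ultimately have "f a * (E * (p - 1) / p) \<le> f a * (E + 1 - E / (2 * a))" by (simp only:)
  then have "E * (p - 1) / p \<le> E + 1 - E / (2 * a)" using fa by (simp only: mult_le_cancel_left_pos)
  then have 1: "E / (2 * a) - 1 \<le> E / p" using p by (simp add: field_simps)
  have "12 * (2 * a) \<le> E * (12 - 6 * (2 * a) + (2 * a)\<^sup>2)"
    using exp_pade[of "2 * a"] a by (simp add: E_def algebra_simps)
  then have "E * (1 / 2 - a / 6) \<le> E / (2 * a) - 1"
    using a by (simp add: field_simps power2_eq_square)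
  then have "E * (1 / 2 - a / 6) \<le> E * (1 / p)" using 1 by (simp only: times_divide_eq_right mult_1_right)
  then have "1 / 2 - a / 6 \<le> 1 / p" using E by (simp only: mult_le_cancel_left_pos)
  then have ap: "3 * (p - 2) \<le> p * a" using p by (simp add: field_simps)
  \<comment> \<open>Compares the obtained threshold 3 (p - 2) / p with the wanted one 2 (p - 2) / (p
    - 1). The two sides differ by (p - 3) (p - 2), so the comparison is an equality at p =
    3.\<close>
  have "p * (2 * (p - 2)) \<le> (p - 1) * (3 * (p - 2))"
  proof -
    have "0 \<le> (p - 3) * (p - 2)" using p by simp
    then show ?thesis by (simp add: algebra_simps)
  qed
  also have "\<dots> \<le> (p - 1) * (p * a)" using ap p by (intro mult_left_mono) auto
  finally have "p * (2 * (p - 2)) \<le> p * ((p - 1) * a)" by (simp add: algebra_simps)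
  then show ?thesis using p by (simp add: mult_le_cancel_left)
qed

section \<open>The flow below the atom\<close>

locale cosh_weight =
  fixes m :: real
  assumes m_pos: "0 < m" and m_less: "m < 1"
begin

text \<open>With \<open>r = \<xi>'(q) - \<xi>'(u)\<close> one has \<open>A 0 r = exp (m \<Phi>)\<close> up to a constant factor,
  \<open>rho r = m \<partial>\<^sub>x\<Phi>\<close> and \<open>Lam r = m \<partial>\<^sub>x\<^sub>x\<Phi>\<close> at time \<open>u \<le> q\<close>; \<open>Lam'\<close> is the derivative of \<open>Lam\<close> in \<open>x\<close>.\<close>

definition A :: "nat \<Rightarrow> real \<Rightarrow> real \<Rightarrow> real" where
  "A k r = heat r (coshpow m k)"

definition rho :: "real \<Rightarrow> real \<Rightarrow> real" where
  "rho r x = A 1 r x / A 0 r x"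

definition Lam :: "real \<Rightarrow> real \<Rightarrow> real" where
  "Lam r x = A 2 r x / A 0 r x - (rho r x)\<^sup>2"

definition Lam' :: "real \<Rightarrow> real \<Rightarrow> real" where
  "Lam' r x = A 3 r x / A 0 r x - A 2 r x / A 0 r x * rho r x - 2 * rho r x * Lam r x"

lemma tame_cw: "tame (coshpow m k)"
  using m_less by (intro tame_coshpow) simp

lemma A_tame: "0 \<le> r \<Longrightarrow> tame (A k r)"
  unfolding A_def by (intro tame_heat tame_cw)

lemma A_measurable [measurable]: "A k r \<in> borel_measurable borel"
  unfolding A_def by measurable

lemma A_pos: "0 < A 0 r x"
  unfolding A_def by (intro heat_pos tame_cw coshpow_0_pos)

lemma A_nz [simp]: "A 0 r x \<noteq> 0"
  using A_pos[of r x] by simp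

lemma A_deriv: "0 \<le> r \<Longrightarrow> (A k r has_real_derivative A (Suc k) r x) (at x)"
  unfolding A_def using m_less by (intro heat_has_derivative tame_tower_coshpow) auto

lemma A_semigroup: "0 \<le> r \<Longrightarrow> 0 \<le> h \<Longrightarrow> heat h (A k r) x = A k (h + r) x"
  unfolding A_def by (intro heat_semigroup tame_cw)

lemma A_bound: obtains C where "C > 0" "\<And>r x. 0 \<le> r \<Longrightarrow> \<bar>A k r x\<bar> \<le> C * A 0 r x"
proof -
  obtain C where C: "C > 0" "\<And>x. \<bar>coshpow m k x\<bar> \<le> C * coshpow m 0 x" using coshpow_bound[of m k] by blast
  have "\<bar>A k r x\<bar> \<le> C * A 0 r x" for r x
    using heat_abs_le[OF tame_cw tame_cmult[OF tame_cw] C(2), of r x] by (simp add: A_def heat_cmult)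
  then show ?thesis using C that by blast
qed

lemma rho_measurable [measurable]: "rho r \<in> borel_measurable borel"
  unfolding rho_def[abs_def] by measurable

lemma Lam_measurable [measurable]: "Lam r \<in> borel_measurable borel"
  unfolding Lam_def[abs_def] by measurable

lemma A_rho: "A 0 r x * rho r x = A 1 r x"
  by (simp add: rho_def)

lemma rho_bound: "\<bar>rho r x\<bar> \<le> 1"
proof -
  have "\<bar>coshpow m 1 z\<bar> \<le> coshpow m 0 z" for z
    using m_pos m_less tanh_real_abs[of z] tanh_real_lt_1[of "\<bar>z\<bar>"] 
    by (auto simp: coshpow_0 coshpow_1 abs_mult intro!: mult_left_le_one_le mult_le_one)
  then have "\<bar>A 1 r x\<bar> \<le> A 0 r x" unfolding A_def by (intro heat_abs_le tame_cw)
  then show ?thesis using A_pos[of r x] by (simp add: rho_def abs_divide divide_le_eq)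
qed

text \<open>Tilt the Gaussian law by cosh^m and let b and s be the means of tanh and tanh^2. Then
  \<open>Lam = m (1 - s) + m^2 (s - b^2) = m - m (1 - m) s - m^2 b^2\<close>. With
  \<open>b^2 \<le> s \<le> 1\<close> the first form is nonnegative, and the second is at most
  m.\<close>

lemma Lam_bounds: "0 \<le> Lam r x" "Lam r x \<le> m"
proof -
  define c where "c = coshpow m 0"
  have c: "tame c" "0 < c z" for z using tame_cw coshpow_0_pos by (auto simp: c_def)
  note [measurable] = tame_measurable[OF c(1)]
  have th: "\<bar>tanh z\<bar> \<le> 1" for z :: real
    using tanh_real_lt_1[of z] tanh_real_gt_neg1[of z] by linarith
  have [measurable]: "(tanh :: real \<Rightarrow> real) \<in> borel_measurable borel"
    by (intro borel_measurable_continuous_onI continuous_intros) auto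
  have t1: "tame (\<lambda>z. tanh z * c z)" by (rule tame_bounded_mult[OF c(1)]) (use th in auto)
  have t2: "tame (\<lambda>z. (tanh z)\<^sup>2 * c z)"
    by (rule tame_bounded_mult[OF c(1), where D = 1]) (use th in \<open>auto simp: abs_square_le_1\<close>)
  define b s where "b = heat r (\<lambda>z. tanh z * c z) x / A 0 r x"
    and "s = heat r (\<lambda>z. (tanh z)\<^sup>2 * c z) x / A 0 r x"
  have A0: "A 0 r = heat r c" by (simp add: A_def c_def)
  have A1: "A 1 r x = m * heat r (\<lambda>z. tanh z * c z) x"
  proof -
    have "coshpow m 1 = (\<lambda>z. m * (tanh z * c z))"
      by (auto simp: fun_eq_iff coshpow_1 coshpow_0 c_def)
    then show ?thesis unfolding A_def by (simp add: heat_cmult)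
  qed
  have A2: "A 2 r x = m * A 0 r x - m * (1 - m) * heat r (\<lambda>z. (tanh z)\<^sup>2 * c z) x"
  proof -
    have "coshpow m 2 = (\<lambda>z. m * c z - m * (1 - m) * ((tanh z)\<^sup>2 * c z))"
      by (auto simp: fun_eq_iff numeral_2_eq_2 coshpow_2 coshpow_0 c_def power2_eq_square algebra_simps)
    then show ?thesis unfolding A0 unfolding A_def
      by (simp add: heat_diff tame_cmult c t2 heat_cmult)
  qed
  have "0 \<le> heat r (\<lambda>z. (tanh z - b)\<^sup>2 * c z) x"
    using c by (intro heat_nonneg) (simp add: less_imp_le)
  also have "(\<lambda>z. (tanh z - b)\<^sup>2 * c z) = (\<lambda>z. ((tanh z)\<^sup>2 * c z - (2 * b) * (tanh z * c z)) + b\<^sup>2 * c z)"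
    by (auto simp: fun_eq_iff power2_eq_square algebra_simps)
  also have "heat r \<dots> x = (s - 2 * b * b + b\<^sup>2) * A 0 r x"
  proof -
    have b: "heat r (\<lambda>z. tanh z * c z) x = b * A 0 r x" and s: "heat r (\<lambda>z. (tanh z)\<^sup>2 * c z) x = s * A 0 r x"
      by (simp_all add: b_def s_def)
    have "heat r (\<lambda>z. ((tanh z)\<^sup>2 * c z - (2 * b) * (tanh z * c z)) + b\<^sup>2 * c z) x
        = heat r (\<lambda>z. (tanh z)\<^sup>2 * c z) x - (2 * b) * heat r (\<lambda>z. tanh z * c z) x + b\<^sup>2 * heat r c x"
      by (simp only: heat_add heat_diff heat_cmult tame_diff tame_cmult c t1 t2)
    then show ?thesis unfolding b s A0[symmetric] by (simp add: algebra_simps)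
  qed
  finally have bs: "b\<^sup>2 \<le> s"
    using A_pos[of r x] by (simp add: zero_le_mult_iff power2_eq_square)
  have "heat r (\<lambda>z. (tanh z)\<^sup>2 * c z) x \<le> A 0 r x"
    unfolding A0 by (intro heat_mono t2 c) (use th c in \<open>auto simp: abs_square_le_1 less_imp_le intro!: mult_left_le_one_le\<close>)
  then have s1: "s \<le> 1" using A_pos[of r x] by (simp add: s_def divide_le_eq)
  have L: "Lam r x = m - m * (1 - m) * s - m\<^sup>2 * b\<^sup>2"
    using A_nz[of r x] unfolding Lam_def rho_def A2 A1 by (simp add: b_def s_def field_simps power2_eq_square)
  have "m\<^sup>2 * b\<^sup>2 \<le> m\<^sup>2 * s" using bs by (intro mult_left_mono) auto
  then have "m * (1 - s) \<le> Lam r x" unfolding L by (simp add: algebra_simps power2_eq_square)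
  then show "0 \<le> Lam r x" using s1 m_pos mult_nonneg_nonneg[of m "1 - s"] by linarith
  have "0 \<le> s" using bs zero_le_power2[of b] by linarith
  then have "0 \<le> m * (1 - m) * s" using m_pos m_less by auto
  then show "Lam r x \<le> m" unfolding L using zero_le_power2[of "m * b"] by (simp only: power_mult_distrib)
qed

lemma Lam_abs: "\<bar>Lam r x\<bar> \<le> 1"
  using Lam_bounds[of r x] m_less by linarith

lemma rho_deriv: "0 \<le> r \<Longrightarrow> (rho r has_real_derivative Lam r x) (at x)"
  unfolding rho_def[abs_def]
  by (rule DERIV_cong[OF DERIV_divide[OF A_deriv A_deriv]])
     (auto simp: Lam_def rho_def numeral_2_eq_2 field_simps power2_eq_square)

lemma Lam_deriv: assumes "0 \<le> r" shows "(Lam r has_real_derivative Lam' r x) (at x)"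
proof -
  have 1: "((\<lambda>x. A 2 r x / A 0 r x) has_real_derivative A 3 r x / A 0 r x - A 2 r x / A 0 r x * rho r x) (at x)"
    by (rule DERIV_cong[OF DERIV_divide[OF A_deriv A_deriv]])
      (auto simp: assms Lam_def rho_def numeral_2_eq_2 numeral_3_eq_3 field_simps power2_eq_square)
  have 2: "((\<lambda>x. (rho r x)\<^sup>2) has_real_derivative 2 * rho r x * Lam r x) (at x)"
    by (rule DERIV_cong[OF DERIV_power[OF rho_deriv[OF assms]]]) simp
  show ?thesis unfolding Lam_def[abs_def]
    by (rule DERIV_cong[OF DERIV_diff[OF 1 2]]) (simp add: Lam'_def)
qed

lemma Lam'_bound: obtains C where "C > 0" "\<And>r x. 0 \<le> r \<Longrightarrow> \<bar>Lam' r x\<bar> \<le> C"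
proof -
  obtain C2 where C2: "C2 > 0" "\<And>r x. 0 \<le> r \<Longrightarrow> \<bar>A 2 r x\<bar> \<le> C2 * A 0 r x" using A_bound[of 2] by blast
  obtain C3 where C3: "C3 > 0" "\<And>r x. 0 \<le> r \<Longrightarrow> \<bar>A 3 r x\<bar> \<le> C3 * A 0 r x" using A_bound[of 3] by blast
  have "\<bar>Lam' r x\<bar> \<le> C3 + C2 + 2" if r: "0 \<le> r" for r x
  proof -
    have 1: "\<bar>A 3 r x / A 0 r x\<bar> \<le> C3" "\<bar>A 2 r x / A 0 r x\<bar> \<le> C2"
      using C2(2)[OF r] C3(2)[OF r] A_pos[of r x] by (simp_all add: abs_divide divide_le_eq)
    have 2: "\<bar>A 2 r x / A 0 r x * rho r x\<bar> \<le> C2 * 1"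
      unfolding abs_mult using 1 C2 rho_bound by (intro mult_mono) auto
    have 3: "\<bar>rho r x * Lam r x\<bar> \<le> 1 * 1"
      unfolding abs_mult using rho_bound Lam_abs by (intro mult_mono) auto
    show ?thesis using 1 2 3 unfolding Lam'_def by linarith
  qed
  then show ?thesis using C2 C3 by (intro that[of "C3 + C2 + 2"]) auto
qed

text \<open>A displacement y multiplies \<open>cosh\<close> by at most
  \<open>exp \<bar>y\<bar>\<close>, and the power m < 1 does no worse. Errors met at x + y can thus
  be stated relative to \<open>A 0 r x\<close>, a form that further averaging preserves.\<close>

lemma A_shift: assumes r: "0 \<le> r" shows "A 0 r (x + y) \<le> exp \<bar>y\<bar> * A 0 r x"
proof -
  have "A 0 r (x + y) = (\<integral>g. coshpow m 0 (x + g * sqrt r + y) \<partial>std_normal_distribution)"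
    by (simp add: A_def heat_def algebra_simps)
  also have "\<dots> \<le> (\<integral>g. exp \<bar>y\<bar> * coshpow m 0 (x + g * sqrt r) \<partial>std_normal_distribution)"
  proof (rule integral_mono)
    fix g :: real
    define z where "z = x + g * sqrt r"
    have "cosh (z + y) powr m \<le> (exp \<bar>y\<bar> * cosh z) powr m"
      using m_pos cosh_add_le cosh_real_nonneg by (intro powr_mono2) auto
    also have "\<dots> = exp (m * \<bar>y\<bar>) * cosh z powr m"
      by (simp add: powr_mult powr_def[of "exp _"] cosh_real_nonneg)
    also have "\<dots> \<le> exp \<bar>y\<bar> * cosh z powr m"
      using m_less m_pos mult_left_le_one_le[of "\<bar>y\<bar>" m] by (intro mult_right_mono) auto
    finally show "coshpow m 0 (x + g * sqrt r + y) \<le> exp \<bar>y\<bar> * coshpow m 0 (x + g * sqrt r)"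
      by (simp add: coshpow_0 z_def)
  next
    show "integrable std_normal_distribution (\<lambda>g. coshpow m 0 (x + g * sqrt r + y))"
      using tame_integrable[OF tame_cw, of 0 "x + y" "sqrt r"] by (simp add: algebra_simps)
  qed (intro integrable_mult_right tame_integrable tame_cw)
  also have "\<dots> = exp \<bar>y\<bar> * A 0 r x" by (simp add: A_def heat_def)
  finally show ?thesis .
qed

lemma A_lipschitz: assumes r: "0 \<le> r" shows "\<bar>A 0 r (x + y) - A 0 r x\<bar> \<le> A 0 r x * (\<bar>y\<bar> * exp \<bar>y\<bar>)"
proof -
  have "\<bar>A 0 r (x + y) - (\<Sum>k<1. A k r x / fact k * y ^ k)\<bar> \<le> (exp \<bar>y\<bar> * A 0 r x) * \<bar>y\<bar> ^ 1"
  proof (rule taylor_remainder_le[of "\<lambda>k. A k r"])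
    fix t assume t: "\<bar>t\<bar> \<le> \<bar>y\<bar>"
    have "\<bar>A 1 r (x + t)\<bar> = A 0 r (x + t) * \<bar>rho r (x + t)\<bar>"
      using A_pos[of r "x + t"] by (simp add: rho_def abs_divide)
    also have "\<dots> \<le> A 0 r (x + t) * 1" 
      using A_pos[of r "x + t"] rho_bound by (intro mult_left_mono) auto
    also have "\<dots> \<le> exp \<bar>t\<bar> * A 0 r x" using A_shift[OF r] by simp
    also have "\<dots> \<le> exp \<bar>y\<bar> * A 0 r x" using t A_pos[of r x] by (intro mult_right_mono) auto
    finally show "\<bar>A 1 r (x + t)\<bar> \<le> exp \<bar>y\<bar> * A 0 r x" .
  qed (rule A_deriv[OF r])
  then show ?thesis by (simp add: mult_ac)
qed

lemma rho_lipschitz: "0 \<le> r \<Longrightarrow> \<bar>rho r (x + y) - rho r x\<bar> \<le> \<bar>y\<bar>"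
  using lipschitz_of_deriv_bound[OF rho_deriv Lam_abs] by simp

text \<open>Jensen: \<open>A 0 r\<close> is convex because its second derivative is
  \<open>A 0 r * (Lam + rho^2)\<close>, and a convex function lies above its tangent at x.\<close>

lemma A_heat_ge: assumes r: "0 \<le> r" and h: "0 \<le> h" "h \<le> 1" shows "A 0 r x \<le> A 0 (h + r) x"
proof -
  let ?l = "\<lambda>z. A 0 r x + A 1 r x * (z - x)"
  have "convex_on UNIV (A 0 r)"
  proof (rule f''_ge0_imp_convex[of UNIV "A 0 r" "A 1 r" "A 2 r"])
    fix z
    have "0 \<le> A 2 r z / A 0 r z" using Lam_bounds(1)[of r z] unfolding Lam_def
      using zero_le_power2[of "rho r z"] by linarith
    then show "0 \<le> A 2 r z" using A_pos[of r z] by (simp add: zero_le_divide_iff)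
  qed (use A_deriv[OF r, of 0] A_deriv[OF r, of 1] in \<open>auto simp: numeral_2_eq_2\<close>)
  then have le: "?l z \<le> A 0 r z" for z
    using convex_on_imp_above_tangent[of UNIV "A 0 r" x z "A 1 r x"] A_deriv[OF r, of 0 x] by (auto simp: algebra_simps)
  have "\<bar>z\<bar> \<le> 2 * cosh z" for z :: real
    using exp_ge_add_one_self[of "\<bar>z\<bar>"] exp_abs_le_cosh[of z] by linarith
  then have "tame (\<lambda>z. z)" by (intro tameI) auto
  then have t: "tame ?l" by (intro tame_add tame_const tame_cmult tame_diff)
  \<comment> \<open>An affine function obeys the expansion with zero remainder, so averaging keeps
    its value at the base point.\<close>
  have "\<bar>heat h ?l x - (A 0 r x + 0 * h)\<bar> \<le> 0 * (2 * exp ((real 0 + 1)\<^sup>2 / 2)) * sqrt h ^ 0"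
    by (rule heat_expand[OF t h, of x _ "A 1 r x"]) simp
  then have "A 0 r x = heat h ?l x" by simp
  also have "\<dots> \<le> heat h (A 0 r) x" by (intro heat_mono t A_tame r le)
  finally show ?thesis using A_semigroup[OF r h(1)] by simp
qed

text \<open>Subtracting the tangent leaves a function with derivative
  \<open>Lam r z - Lam r x\<close>, which is at most \<open>C * \<bar>y\<bar>\<close> within
  distance \<open>\<bar>y\<bar>\<close> of x.\<close>

lemma rho_taylor:
  assumes r: "0 \<le> r" and C: "\<And>x. \<bar>Lam' r x\<bar> \<le> C"
  shows "\<bar>rho r (x + y) - rho r x - Lam r x * y\<bar> \<le> C * \<bar>y\<bar> * \<bar>y\<bar>"
proof -
  have C0: "0 \<le> C" using order.trans[OF abs_ge_zero C[of x]] .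
  define g where "g z = rho r z - Lam r x * z" for z
  have d: "(g has_real_derivative (Lam r z - Lam r x)) (at z within S)" for z S
    unfolding g_def[abs_def]
    by (rule DERIV_subset[OF DERIV_diff[OF rho_deriv[OF r]]]) (auto intro!: derivative_eq_intros)
  have "norm (g (x + y) - g x) \<le> C * \<bar>y\<bar> * norm (x + y - x)"
  proof (rule field_differentiable_bound[of "{x - \<bar>y\<bar>..x + \<bar>y\<bar>}", OF _ d])
    fix z assume z: "z \<in> {x - \<bar>y\<bar>..x + \<bar>y\<bar>}"
    have "\<bar>Lam r (x + (z - x)) - Lam r x\<bar> \<le> C * \<bar>z - x\<bar>"
      by (rule lipschitz_of_deriv_bound[OF Lam_deriv[OF r] C])
    also have "\<dots> \<le> C * \<bar>y\<bar>" using z C0 by (intro mult_left_mono) auto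
    finally show "norm (Lam r z - Lam r x) \<le> C * \<bar>y\<bar>" by simp
  qed auto
  then show ?thesis by (simp add: g_def algebra_simps)
qed

section \<open>The Jensen gap of \<open>rho\<close> along the heat flow\<close>

lemma tame_A_times: "0 \<le> r \<Longrightarrow> b \<in> borel_measurable borel \<Longrightarrow> (\<And>z. \<bar>b z\<bar> \<le> D) \<Longrightarrow> tame (\<lambda>z. A 0 r z * b z)"
  using tame_bounded_mult[OF A_tame, of r b D 0] by (simp add: mult.commute)

lemma tame_A_rho2: "0 \<le> r \<Longrightarrow> tame (\<lambda>z. A 0 r z * (rho r z)\<^sup>2)"
  by (rule tame_A_times[where D = 1]) (auto simp: abs_square_le_1 rho_bound)

lemma tame_A_Lam2: "0 \<le> r \<Longrightarrow> tame (\<lambda>z. A 0 r z * (Lam r z)\<^sup>2)"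
  by (rule tame_A_times[where D = 1]) (auto simp: abs_square_le_1 Lam_abs)

lemma tame_A_rho_centred: "0 \<le> r \<Longrightarrow> tame (\<lambda>z. A 0 r z * (rho r z - k)\<^sup>2)"
proof (rule tame_A_times[where D = "(1 + \<bar>k\<bar>)\<^sup>2"])
  fix z
  have "\<bar>rho r z - k\<bar> \<le> 1 + \<bar>k\<bar>" using rho_bound[of r z] by linarith
  then show "\<bar>(rho r z - k)\<^sup>2\<bar> \<le> (1 + \<bar>k\<bar>)\<^sup>2"
    by (simp add: abs_le_square_iff[symmetric])
qed auto

text \<open>Besides \<open>A 0 r * rho^2\<close>, the opened square contains only multiples of
  \<open>A 0 r\<close> and of \<open>A 0 r * rho = A 1 r\<close>, both carried exactly by the flow.
  So the gap does not see the centring constant, which may be chosen freely.\<close>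

lemma heat_rho_centred:
  assumes r: "0 \<le> r" and h: "0 \<le> h"
  shows "heat h (\<lambda>z. A 0 r z * (rho r z - k)\<^sup>2) x - A 0 (h + r) x * (rho (h + r) x - k)\<^sup>2
    = heat h (\<lambda>z. A 0 r z * (rho r z)\<^sup>2) x - A 0 (h + r) x * (rho (h + r) x)\<^sup>2"
proof -
  have e: "(\<lambda>z. A 0 r z * (rho r z - k)\<^sup>2) = (\<lambda>z. (A 0 r z * (rho r z)\<^sup>2 - (2 * k) * A 1 r z) + k\<^sup>2 * A 0 r z)"
    by (auto simp: fun_eq_iff power2_eq_square algebra_simps A_rho[symmetric] simp del: One_nat_def)
  show ?thesis
    unfolding e using r h
    by (simp add: heat_add heat_diff heat_cmult tame_add tame_diff tame_cmult tame_A_rho2 A_tame A_semigroup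
       del: One_nat_def)
       (simp add: A_rho[symmetric] power2_eq_square algebra_simps del: One_nat_def)
qed

text \<open>With k = \<open>rho r x\<close>, the function \<open>A 1 r - k * A 0 r\<close> vanishes
  at x, so its average over time h is of order h. That average is \<open>A 0 (h + r) x\<close> times
  the change of \<open>rho\<close>; its square is of order h^2, and
  \<open>h^2 \<le> sqrt h ^ 3\<close>.\<close>

lemma heat_centred_first_order:
  obtains C where "C > 0" "\<And>r h x. 0 \<le> r \<Longrightarrow> 0 \<le> h \<Longrightarrow> h \<le> 1 \<Longrightarrow>
    A 0 (h + r) x * (rho (h + r) x - rho r x)\<^sup>2 \<le> C * A 0 r x * sqrt h ^ 3"
proof -
  obtain C2 where C2: "C2 > 0" "\<And>r x. 0 \<le> r \<Longrightarrow> \<bar>A 2 r x\<bar> \<le> C2 * A 0 r x" using A_bound[of 2] by blast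
  obtain C3 where C3: "C3 > 0" "\<And>r x. 0 \<le> r \<Longrightarrow> \<bar>A 3 r x\<bar> \<le> C3 * A 0 r x" using A_bound[of 3] by blast
  define K where "K = (C3 + C2) * (2 * exp ((real 2 + 1)\<^sup>2 / 2))"
  have K: "K > 0" using C2 C3 by (simp add: K_def)
  have "A 0 (h + r) x * (rho (h + r) x - rho r x)\<^sup>2 \<le> K\<^sup>2 * A 0 r x * sqrt h ^ 3"
    if r: "0 \<le> r" and h: "0 \<le> h" "h \<le> 1" for r h x
  proof -
    define k where "k = rho r x"
    have k1: "\<bar>k\<bar> \<le> 1" using rho_bound by (simp add: k_def)
    define F where "F j z = A (Suc j) r z - k * A j r z" for j z
    have F0: "F 0 x = 0" using A_rho[of r x] by (simp add: F_def k_def mult.commute)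
    have dF: "(F j has_real_derivative F (Suc j) z) (at z)" for j z
      unfolding F_def[abs_def] by (intro DERIV_diff DERIV_cmult A_deriv r)
    have "\<bar>heat h (F 0) x - (0 + 0 * h)\<bar> \<le> ((C3 + C2) * A 0 r x) * (2 * exp ((real 2 + 1)\<^sup>2 / 2)) * sqrt h ^ 2"
    proof (rule heat_expand[OF _ h, where ?a1.0 = "F 1 x"])
      show "tame (F 0)" unfolding F_def[abs_def] by (intro tame_diff tame_cmult A_tame r)
      fix y
      have "\<bar>F 0 (x + y) - (\<Sum>j<2. F j x / fact j * y ^ j)\<bar> \<le> ((C3 + C2) * (exp \<bar>y\<bar> * A 0 r x)) * \<bar>y\<bar> ^ 2"
      proof (rule taylor_remainder_le[of F, OF dF])
        fix t assume t: "\<bar>t\<bar> \<le> \<bar>y\<bar>"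
        have "\<bar>F 2 (x + t)\<bar> \<le> \<bar>A 3 r (x + t)\<bar> + \<bar>k\<bar> * \<bar>A 2 r (x + t)\<bar>"
          unfolding F_def abs_mult[symmetric] by (simp add: numeral_3_eq_3 numeral_2_eq_2)
        also have "\<dots> \<le> C3 * A 0 r (x + t) + 1 * (C2 * A 0 r (x + t))"
          using C2 C3 k1 r by (intro add_mono mult_mono) auto
        also have "\<dots> = (C3 + C2) * A 0 r (x + t)" by (simp add: algebra_simps)
        also have "\<dots> \<le> (C3 + C2) * (exp \<bar>t\<bar> * A 0 r x)"
          using C2 C3 A_shift[OF r] by (intro mult_left_mono) auto
        also have "\<dots> \<le> (C3 + C2) * (exp \<bar>y\<bar> * A 0 r x)"
          using C2 C3 t A_pos[of r x] by (intro mult_left_mono mult_right_mono) auto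
        finally show "\<bar>F 2 (x + t)\<bar> \<le> (C3 + C2) * (exp \<bar>y\<bar> * A 0 r x)" .
      qed
      then show "\<bar>F 0 (x + y) - (0 + F 1 x * y + 0 * y\<^sup>2)\<bar> \<le> (C3 + C2) * A 0 r x * (\<bar>y\<bar> ^ 2 * exp \<bar>y\<bar>)"
        by (simp add: numeral_2_eq_2 F0 mult_ac)
    qed
    then have "\<bar>heat h (F 0) x\<bar> \<le> K * A 0 r x * h" using h by (simp add: K_def mult_ac)
    moreover have "heat h (F 0) x = A 0 (h + r) x * (rho (h + r) x - k)"
    proof -
      have "heat h (F 0) x = A 1 (h + r) x - k * A 0 (h + r) x"
        unfolding F_def[abs_def] using r h by (simp add: heat_diff heat_cmult tame_cmult A_tame A_semigroup)
      then show ?thesis by (simp add: A_rho[symmetric] algebra_simps del: One_nat_def)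
    qed
    ultimately have le: "(A 0 (h + r) x * (rho (h + r) x - k))\<^sup>2 \<le> (K * A 0 r x * h)\<^sup>2"
      using K h A_pos[of r x] by (intro abs_le_square_iff[THEN iffD1]) (auto simp: abs_of_nonneg)
    \<comment> \<open>The square carries two factors \<open>A 0 (h + r) x\<close>; replacing one by
      the smaller \<open>A 0 r x\<close> lets it be cancelled.\<close>
    have ge: "A 0 r x \<le> A 0 (h + r) x" by (rule A_heat_ge[OF r h])
    have h23: "h\<^sup>2 \<le> sqrt h ^ 3"
    proof -
      have "h\<^sup>2 = sqrt h ^ 4" using h by (simp add: power4_eq_xxxx power2_eq_square mult.assoc[symmetric])
      also have "\<dots> \<le> sqrt h ^ 3" using h by (intro power_decreasing) auto
      finally show ?thesis .
    qed
    have "A 0 r x * (A 0 (h + r) x * (rho (h + r) x - k)\<^sup>2) \<le> A 0 (h + r) x * (A 0 (h + r) x * (rho (h + r) x - k)\<^sup>2)"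
      using ge A_pos[of "h + r" x] by (intro mult_right_mono) auto
    also have "\<dots> \<le> A 0 r x * (K\<^sup>2 * A 0 r x * h\<^sup>2)" using le by (simp add: power2_eq_square mult_ac)
    finally have "A 0 (h + r) x * (rho (h + r) x - k)\<^sup>2 \<le> K\<^sup>2 * A 0 r x * h\<^sup>2"
      using A_pos[of r x] by (simp add: mult_le_cancel_left)
    also have "\<dots> \<le> K\<^sup>2 * A 0 r x * sqrt h ^ 3" using h23 A_pos[of r x] by (intro mult_left_mono) auto
    finally show ?thesis by (simp add: k_def)
  qed
  then show ?thesis using K by (intro that[of "K\<^sup>2"]) auto
qed

text \<open>After centring at \<open>rho r x\<close>, the integrand is quadratic in the
  displacement, with slope l = \<open>Lam r x\<close>, so its average is
  \<open>A 0 r x * l^2 * h\<close> up to order h^(3/2). The subtracted centred term is of the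
  error's order by \<open>heat_centred_first_order\<close>, and averaging
  \<open>A 0 r * Lam^2\<close> over time h moves it by order sqrt h only.\<close>

lemma heat_variance_expand:
  obtains C where "C > 0" "\<And>r h x. 0 \<le> r \<Longrightarrow> 0 \<le> h \<Longrightarrow> h \<le> 1 \<Longrightarrow>
    \<bar>heat h (\<lambda>z. A 0 r z * (rho r z)\<^sup>2) x - A 0 (h + r) x * (rho (h + r) x)\<^sup>2
      - h * heat h (\<lambda>z. A 0 r z * (Lam r z)\<^sup>2) x\<bar> \<le> C * A 0 r x * sqrt h ^ 3"
proof -
  obtain C1 where C1: "C1 > 0" "\<And>r h x. 0 \<le> r \<Longrightarrow> 0 \<le> h \<Longrightarrow> h \<le> 1 \<Longrightarrow>
    A 0 (h + r) x * (rho (h + r) x - rho r x)\<^sup>2 \<le> C1 * A 0 r x * sqrt h ^ 3"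
    using heat_centred_first_order by blast
  obtain C where C: "C > 0" "\<And>r x. 0 \<le> r \<Longrightarrow> \<bar>Lam' r x\<bar> \<le> C" using Lam'_bound by blast
  define K2 K3 where "K2 = 2 * exp ((real 1 + 1)\<^sup>2 / 2)" and "K3 = 2 * exp ((real 3 + 1)\<^sup>2 / 2)"
  define E where "E = (2 * C + 1) * K3 + C1 + (2 * C + 1) * K2"
  have "\<bar>heat h (\<lambda>z. A 0 r z * (rho r z)\<^sup>2) x - A 0 (h + r) x * (rho (h + r) x)\<^sup>2
      - h * heat h (\<lambda>z. A 0 r z * (Lam r z)\<^sup>2) x\<bar> \<le> E * A 0 r x * sqrt h ^ 3"
    if r: "0 \<le> r" and h: "0 \<le> h" "h \<le> 1" for r h x
  proof -
    define a l where "a = A 0 r x" and "l = Lam r x"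
    have a: "0 < a" using A_pos by (simp add: a_def)
    have l: "\<bar>l\<bar> \<le> 1" using Lam_abs by (simp add: l_def)
    have Alip: "\<bar>A 0 r (x + y) - a\<bar> \<le> a * (\<bar>y\<bar> * exp \<bar>y\<bar>)" for y
      using A_lipschitz[OF r] by (simp add: a_def)
    have Ash: "A 0 r (x + y) \<le> exp \<bar>y\<bar> * a" for y
      using A_shift[OF r] by (simp add: a_def)
    have one: "\<bar>heat h (\<lambda>z. A 0 r z * (rho r z - rho r x)\<^sup>2) x - (0 + (a * l\<^sup>2) * h)\<bar>
      \<le> ((2 * C + 1) * a) * (2 * exp ((real 3 + 1)\<^sup>2 / 2)) * sqrt h ^ 3"
    proof (rule heat_expand[OF tame_A_rho_centred[OF r] h, where ?a1.0 = 0])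
      fix y
      define e where "e = rho r (x + y) - rho r x"
      have "\<bar>e\<^sup>2 - (l * y)\<^sup>2\<bar> = \<bar>e - l * y\<bar> * \<bar>e + l * y\<bar>"
        by (simp add: power2_eq_square square_diff_square_factored mult.commute flip: abs_mult)
      also have "\<dots> \<le> (C * \<bar>y\<bar> * \<bar>y\<bar>) * (\<bar>y\<bar> + 1 * \<bar>y\<bar>)"
      proof (rule mult_mono)
        show "\<bar>e - l * y\<bar> \<le> C * \<bar>y\<bar> * \<bar>y\<bar>" unfolding e_def l_def using rho_taylor[OF r C(2)[OF r]] .
        have "\<bar>l * y\<bar> \<le> 1 * \<bar>y\<bar>" unfolding abs_mult using l by (intro mult_right_mono) auto
        then show "\<bar>e + l * y\<bar> \<le> \<bar>y\<bar> + 1 * \<bar>y\<bar>"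
          using rho_lipschitz[OF r, of x y] unfolding e_def by linarith
      qed (use C in auto)
      also have "\<dots> = 2 * C * \<bar>y\<bar> ^ 3" by (simp add: power3_eq_cube)
      finally have 1: "\<bar>e\<^sup>2 - (l * y)\<^sup>2\<bar> \<le> 2 * C * \<bar>y\<bar> ^ 3" .
      have "\<bar>A 0 r (x + y) * e\<^sup>2 - a * (l * y)\<^sup>2\<bar>
         = \<bar>A 0 r (x + y) * (e\<^sup>2 - (l * y)\<^sup>2) + (A 0 r (x + y) - a) * (l * y)\<^sup>2\<bar>"
        by (simp add: algebra_simps)
      also have "\<dots> \<le> \<bar>A 0 r (x + y) * (e\<^sup>2 - (l * y)\<^sup>2)\<bar> + \<bar>(A 0 r (x + y) - a) * (l * y)\<^sup>2\<bar>"
        by (rule abs_triangle_ineq)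
      also have "\<dots> \<le> (exp \<bar>y\<bar> * a) * (2 * C * \<bar>y\<bar> ^ 3) + (a * (\<bar>y\<bar> * exp \<bar>y\<bar>)) * \<bar>y\<bar>\<^sup>2"
      proof (rule add_mono)
        show "\<bar>A 0 r (x + y) * (e\<^sup>2 - (l * y)\<^sup>2)\<bar> \<le> (exp \<bar>y\<bar> * a) * (2 * C * \<bar>y\<bar> ^ 3)"
          unfolding abs_mult using 1 Ash[of y] a A_pos[of r "x + y"] by (intro mult_mono) auto
        have "(l * y)\<^sup>2 \<le> \<bar>y\<bar>\<^sup>2"
          using mult_left_le_one_le[of "\<bar>y\<bar>" "\<bar>l\<bar>"] l
          by (simp add: abs_le_square_iff[symmetric] abs_mult)
        then show "\<bar>(A 0 r (x + y) - a) * (l * y)\<^sup>2\<bar> \<le> (a * (\<bar>y\<bar> * exp \<bar>y\<bar>)) * \<bar>y\<bar>\<^sup>2"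
          unfolding abs_mult using Alip[of y] a by (intro mult_mono) auto
      qed
      also have "\<dots> = (2 * C + 1) * a * (\<bar>y\<bar> ^ 3 * exp \<bar>y\<bar>)" by (simp add: power3_eq_cube power2_eq_square algebra_simps)
      finally show "\<bar>A 0 r (x + y) * (rho r (x + y) - rho r x)\<^sup>2 - (0 + 0 * y + a * l\<^sup>2 * y\<^sup>2)\<bar>
        \<le> (2 * C + 1) * a * (\<bar>y\<bar> ^ 3 * exp \<bar>y\<bar>)"
        by (simp add: e_def power_mult_distrib mult.assoc)
    qed
    have two: "\<bar>heat h (\<lambda>z. A 0 r z * (Lam r z)\<^sup>2) x - (a * l\<^sup>2 + 0 * h)\<bar>
      \<le> ((2 * C + 1) * a) * (2 * exp ((real 1 + 1)\<^sup>2 / 2)) * sqrt h ^ 1"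
    proof (rule heat_expand[OF tame_A_Lam2[OF r] h, where ?a1.0 = 0])
      fix y
      define e where "e = Lam r (x + y)"
      have e: "\<bar>e\<bar> \<le> 1" using Lam_abs by (simp add: e_def)
      have "\<bar>e\<^sup>2 - l\<^sup>2\<bar> = \<bar>e - l\<bar> * \<bar>e + l\<bar>"
        by (simp add: power2_eq_square square_diff_square_factored mult.commute flip: abs_mult)
      also have "\<dots> \<le> (C * \<bar>y\<bar>) * 2"
      proof (rule mult_mono)
        show "\<bar>e - l\<bar> \<le> C * \<bar>y\<bar>" unfolding e_def l_def
          by (rule lipschitz_of_deriv_bound[OF Lam_deriv[OF r] C(2)[OF r]])
        show "\<bar>e + l\<bar> \<le> 2" using e l by linarith
      qed (use C in auto)
      finally have 1: "\<bar>e\<^sup>2 - l\<^sup>2\<bar> \<le> 2 * C * \<bar>y\<bar>" by simp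
      have "\<bar>A 0 r (x + y) * e\<^sup>2 - a * l\<^sup>2\<bar>
         = \<bar>a * (e\<^sup>2 - l\<^sup>2) + (A 0 r (x + y) - a) * e\<^sup>2\<bar>"
        by (simp add: algebra_simps)
      also have "\<dots> \<le> \<bar>a * (e\<^sup>2 - l\<^sup>2)\<bar> + \<bar>(A 0 r (x + y) - a) * e\<^sup>2\<bar>"
        by (rule abs_triangle_ineq)
      also have "\<dots> \<le> a * (2 * C * (\<bar>y\<bar> * exp \<bar>y\<bar>)) + (a * (\<bar>y\<bar> * exp \<bar>y\<bar>)) * 1"
      proof (rule add_mono)
        have "2 * C * (\<bar>y\<bar> * 1) \<le> 2 * C * (\<bar>y\<bar> * exp \<bar>y\<bar>)" using C by (intro mult_left_mono) auto
        then show "\<bar>a * (e\<^sup>2 - l\<^sup>2)\<bar> \<le> a * (2 * C * (\<bar>y\<bar> * exp \<bar>y\<bar>))"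
          unfolding abs_mult using 1 a by (intro mult_mono) auto
        have "e\<^sup>2 \<le> 1" using e by (simp add: abs_square_le_1)
        then show "\<bar>(A 0 r (x + y) - a) * e\<^sup>2\<bar> \<le> (a * (\<bar>y\<bar> * exp \<bar>y\<bar>)) * 1"
          unfolding abs_mult using Alip[of y] a by (intro mult_mono) auto
      qed
      also have "\<dots> = (2 * C + 1) * a * (\<bar>y\<bar> ^ 1 * exp \<bar>y\<bar>)" by (simp add: algebra_simps)
      finally show "\<bar>A 0 r (x + y) * (Lam r (x + y))\<^sup>2 - (a * l\<^sup>2 + 0 * y + 0 * y\<^sup>2)\<bar>
        \<le> (2 * C + 1) * a * (\<bar>y\<bar> ^ 1 * exp \<bar>y\<bar>)"
        by (simp add: e_def)
    qed
    define T U V where "T = heat h (\<lambda>z. A 0 r z * (rho r z - rho r x)\<^sup>2) x"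
      and "U = A 0 (h + r) x * (rho (h + r) x - rho r x)\<^sup>2" and "V = heat h (\<lambda>z. A 0 r z * (Lam r z)\<^sup>2) x"
    have U: "0 \<le> U" "U \<le> C1 * a * sqrt h ^ 3"
      using C1(2)[OF r h, of x] A_pos[of "h + r" x] by (auto simp: U_def a_def)
    have h3: "h * sqrt h = sqrt h ^ 3" using h by (simp add: power3_eq_cube)
    have T: "\<bar>T - (a * l\<^sup>2) * h\<bar> \<le> (2 * C + 1) * a * K3 * sqrt h ^ 3"
      using one by (simp add: T_def K3_def)
    have V: "\<bar>V - a * l\<^sup>2\<bar> \<le> (2 * C + 1) * a * K2 * sqrt h"
      using two by (simp add: V_def K2_def)
    have "\<bar>h * V - h * (a * l\<^sup>2)\<bar> = h * \<bar>V - a * l\<^sup>2\<bar>"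
      using h by (simp add: abs_mult flip: right_diff_distrib)
    also have "\<dots> \<le> h * ((2 * C + 1) * a * K2 * sqrt h)" using V h by (intro mult_left_mono) auto
    also have "\<dots> = (2 * C + 1) * a * K2 * sqrt h ^ 3" by (simp add: h3[symmetric] mult_ac)
    finally have V': "\<bar>h * V - h * (a * l\<^sup>2)\<bar> \<le> (2 * C + 1) * a * K2 * sqrt h ^ 3" .
    have "\<bar>T - U - h * V\<bar> \<le> \<bar>T - (a * l\<^sup>2) * h\<bar> + U + \<bar>h * V - h * (a * l\<^sup>2)\<bar>"
      using U(1) by (simp add: mult.commute)
    also have "\<dots> \<le> (2 * C + 1) * a * K3 * sqrt h ^ 3 + C1 * a * sqrt h ^ 3 + (2 * C + 1) * a * K2 * sqrt h ^ 3"
      using T U V' by linarith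
    also have "\<dots> = E * a * sqrt h ^ 3" by (simp add: E_def algebra_simps)
    finally show ?thesis
      using heat_rho_centred[OF r h(1), of "rho r x" x] by (simp add: T_def U_def V_def a_def)
  qed
  moreover have "E > 0" using C C1 by (auto simp: E_def K2_def K3_def intro!: add_pos_pos)
  ultimately show ?thesis using that by blast
qed

text \<open>Here s is the elapsed time and \<open>a - s\<close> the time left before the atom. Up to
  the factor \<open>m^2 * Z\<close>, this is \<Gamma> below the atom in the clock s = \<xi>'(u);
  \<open>L\<close> will be its derivative.\<close>

definition R :: "real \<Rightarrow> real \<Rightarrow> real" where
  "R a s = heat s (\<lambda>z. A 0 (a - s) z * (rho (a - s) z)\<^sup>2) 0"

definition L :: "real \<Rightarrow> real \<Rightarrow> real" where
  "L a s = heat s (\<lambda>z. A 0 (a - s) z * (Lam (a - s) z)\<^sup>2) 0"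

text \<open>Splitting \<open>heat s'\<close> at s writes both values as averages over the same time
  s, and the local expansion is averaged. Its slope keeps \<open>Lam\<close> at remaining time
  \<open>a - s'\<close>, which is why \<open>L\<close> appears at the later end. The relative error
  averages to \<open>A 0 (s + r) 0\<close>, at most \<open>exp (a / 2)\<close>.\<close>

lemma R_step:
  obtains C where "\<And>s s'. 0 \<le> s \<Longrightarrow> s \<le> s' \<Longrightarrow> s' \<le> a \<Longrightarrow> s' - s \<le> 1 \<Longrightarrow>
    \<bar>R a s' - R a s - (s' - s) * L a s'\<bar> \<le> C * sqrt (s' - s) ^ 3"
proof -
  obtain C where C: "C > 0" "\<And>r h x. 0 \<le> r \<Longrightarrow> 0 \<le> h \<Longrightarrow> h \<le> 1 \<Longrightarrow>
    \<bar>heat h (\<lambda>z. A 0 r z * (rho r z)\<^sup>2) x - A 0 (h + r) x * (rho (h + r) x)\<^sup>2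
      - h * heat h (\<lambda>z. A 0 r z * (Lam r z)\<^sup>2) x\<bar> \<le> C * A 0 r x * sqrt h ^ 3"
    using heat_variance_expand by blast
  have "\<bar>R a s' - R a s - (s' - s) * L a s'\<bar> \<le> (C * exp (a / 2)) * sqrt (s' - s) ^ 3"
    if s: "0 \<le> s" "s \<le> s'" "s' \<le> a" "s' - s \<le> 1" for s s'
  proof -
    define r h where "r = a - s'" and "h = s' - s"
    have r: "0 \<le> r" and h: "0 \<le> h" "h \<le> 1" and hr: "a - s = h + r" using s by (auto simp: r_def h_def)
    let ?f = "\<lambda>x. heat h (\<lambda>z. A 0 r z * (rho r z)\<^sup>2) x - A 0 (h + r) x * (rho (h + r) x)\<^sup>2
      - h * heat h (\<lambda>z. A 0 r z * (Lam r z)\<^sup>2) x"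
    have R': "R a s' = heat s (heat h (\<lambda>z. A 0 r z * (rho r z)\<^sup>2)) 0"
      unfolding R_def r_def[symmetric] h_def using s r by (intro heat_split tame_A_rho2)
    have L': "L a s' = heat s (heat h (\<lambda>z. A 0 r z * (Lam r z)\<^sup>2)) 0"
      unfolding L_def r_def[symmetric] h_def using s r by (intro heat_split tame_A_Lam2)
    have t: "tame (heat h (\<lambda>z. A 0 r z * (rho r z)\<^sup>2))" "tame (heat h (\<lambda>z. A 0 r z * (Lam r z)\<^sup>2))"
      "tame (\<lambda>x. A 0 (h + r) x * (rho (h + r) x)\<^sup>2)"
      using r h by (auto intro!: tame_heat tame_A_rho2 tame_A_Lam2)
    have eq: "R a s' - R a s - (s' - s) * L a s' = heat s ?f 0"
      unfolding R' L' by (simp add: R_def hr heat_diff heat_cmult tame_diff tame_cmult t h_def[symmetric])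
    have "\<bar>R a s' - R a s - (s' - s) * L a s'\<bar> \<le> heat s (\<lambda>x. (C * sqrt h ^ 3) * A 0 r x) 0"
      unfolding eq by (intro heat_abs_le tame_diff tame_cmult t A_tame r order.trans[OF C(2)] h) (simp add: mult_ac)
    also have "\<dots> = (C * sqrt h ^ 3) * A 0 (s + r) 0"
      using s r by (simp add: heat_cmult A_semigroup)
    also have "\<dots> \<le> (C * sqrt h ^ 3) * exp (a / 2)"
    proof (intro mult_left_mono)
      have "A 0 (s + r) 0 \<le> heat (s + r) cosh 0"
        unfolding A_def using m_less by (intro heat_mono tame_cw tame_cosh coshpow_0_le_cosh) auto
      also have "\<dots> = exp ((s + r) / 2)" using s r by (simp add: heat_cosh)
      also have "\<dots> \<le> exp (a / 2)" using s by (simp add: r_def)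
      finally show "A 0 (s + r) 0 \<le> exp (a / 2)" .
    qed (use C h in auto)
    finally show ?thesis by (simp add: h_def mult_ac)
  qed
  then show ?thesis using that by blast
qed

text \<open>Centred at the averaged value \<open>rho (h + r) x\<close>, the gap is a weighted
  variance.\<close>

lemma heat_centred_nonneg:
  assumes r: "0 \<le> r" and h: "0 \<le> h"
  shows "A 0 (h + r) x * (rho (h + r) x)\<^sup>2 \<le> heat h (\<lambda>z. A 0 r z * (rho r z)\<^sup>2) x"
proof -
  have "0 \<le> heat h (\<lambda>z. A 0 r z * (rho r z - rho (h + r) x)\<^sup>2) x"
    by (intro heat_nonneg) (simp add: A_pos less_imp_le)
  then show ?thesis using heat_rho_centred[OF r h, of "rho (h + r) x" x] by simp
qed

text \<open>\<open>A \<cdot> Lam + A \<cdot> rho\<^sup>2 = A 2\<close> is transported exactly by the heat flow, so the Jensen gap of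
  \<open>Lam\<close> is controlled by that of \<open>rho\<close> without differentiating \<open>Lam\<close>.\<close>

lemma heat_Lam_ge:
  assumes r: "0 \<le> r" and h: "0 \<le> h"
  shows "A 0 (h + r) x * (Lam (h + r) x)\<^sup>2 + 2 * m * (A 0 (h + r) x * (rho (h + r) x)\<^sup>2)
    \<le> heat h (\<lambda>z. A 0 r z * (Lam r z)\<^sup>2) x + 2 * m * heat h (\<lambda>z. A 0 r z * (rho r z)\<^sup>2) x"
proof -
  define l where "l = Lam (h + r) x"
  define T where "T = heat h (\<lambda>z. A 0 r z * (rho r z)\<^sup>2) x - A 0 (h + r) x * (rho (h + r) x)\<^sup>2"
  have T: "0 \<le> T" using heat_centred_nonneg[OF r h, of x] by (simp add: T_def)
  have A2: "A 2 r z = A 0 r z * Lam r z + A 0 r z * (rho r z)\<^sup>2" for r z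
    by (simp add: Lam_def algebra_simps)
  have tl: "tame (\<lambda>z. A 0 r z * Lam r z)"
    by (rule tame_A_times[OF r _ Lam_abs]) auto
  have "A 2 (h + r) x = heat h (A 2 r) x" using A_semigroup[OF r h] by simp
  also have "\<dots> = heat h (\<lambda>z. A 0 r z * Lam r z) x + heat h (\<lambda>z. A 0 r z * (rho r z)\<^sup>2) x"
    unfolding A2[abs_def] by (intro heat_add tl tame_A_rho2 r)
  \<comment> \<open>The weighted mean of \<open>Lam\<close> loses exactly the amount
    \<open>T\<close> that the mean of \<open>rho^2\<close> gains.\<close>
  finally have lin: "heat h (\<lambda>z. A 0 r z * Lam r z) x = A 0 (h + r) x * l - T"
    by (simp add: A2 l_def T_def)
  have "0 \<le> heat h (\<lambda>z. A 0 r z * (Lam r z - l)\<^sup>2) x"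
    by (intro heat_nonneg) (simp add: A_pos less_imp_le)
  also have "(\<lambda>z. A 0 r z * (Lam r z - l)\<^sup>2) = (\<lambda>z. (A 0 r z * (Lam r z)\<^sup>2 - (2 * l) * (A 0 r z * Lam r z)) + l\<^sup>2 * A 0 r z)"
    by (auto simp: fun_eq_iff power2_eq_square algebra_simps)
  also have "heat h \<dots> x = heat h (\<lambda>z. A 0 r z * (Lam r z)\<^sup>2) x - 2 * l * (A 0 (h + r) x * l - T) + l\<^sup>2 * A 0 (h + r) x"
    using r h by (simp add: heat_add heat_diff heat_cmult tame_add tame_diff tame_cmult tl tame_A_Lam2 A_tame A_semigroup lin)
  finally have "A 0 (h + r) x * l\<^sup>2 \<le> heat h (\<lambda>z. A 0 r z * (Lam r z)\<^sup>2) x + 2 * (l * T)"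
    by (simp add: power2_eq_square algebra_simps)
  also have "l * T \<le> m * T" using T Lam_bounds by (intro mult_right_mono) (auto simp: l_def)
  finally show ?thesis by (simp add: l_def T_def algebra_simps)
qed

lemma L_plus_R_mono:
  assumes s: "0 \<le> s" "s \<le> s'" "s' \<le> a"
  shows "L a s + 2 * m * R a s \<le> L a s' + 2 * m * R a s'"
proof -
  define r h where "r = a - s'" and "h = s' - s"
  have r: "0 \<le> r" and h: "0 \<le> h" and hr: "a - s = h + r" using s by (auto simp: r_def h_def)
  have t: "tame (\<lambda>z. A 0 r z * (rho r z)\<^sup>2)" "tame (\<lambda>z. A 0 r z * (Lam r z)\<^sup>2)"
      "tame (\<lambda>x. A 0 (h + r) x * (rho (h + r) x)\<^sup>2)" "tame (\<lambda>x. A 0 (h + r) x * (Lam (h + r) x)\<^sup>2)"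
    using r h by (auto intro!: tame_A_rho2 tame_A_Lam2)
  have R': "R a s' = heat s (heat h (\<lambda>z. A 0 r z * (rho r z)\<^sup>2)) 0"
    unfolding R_def r_def[symmetric] h_def using s r by (intro heat_split tame_A_rho2)
  have L': "L a s' = heat s (heat h (\<lambda>z. A 0 r z * (Lam r z)\<^sup>2)) 0"
    unfolding L_def r_def[symmetric] h_def using s r by (intro heat_split tame_A_Lam2)
  have "L a s + 2 * m * R a s = heat s (\<lambda>x. A 0 (h + r) x * (Lam (h + r) x)\<^sup>2 + (2 * m) * (A 0 (h + r) x * (rho (h + r) x)\<^sup>2)) 0"
    unfolding R_def L_def hr by (simp only: heat_add heat_cmult tame_cmult t)
  also have "\<dots> \<le> heat s (\<lambda>x. heat h (\<lambda>z. A 0 r z * (Lam r z)\<^sup>2) x + (2 * m) * heat h (\<lambda>z. A 0 r z * (rho r z)\<^sup>2) x) 0"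
    using heat_Lam_ge[OF r h] by (intro heat_mono tame_add tame_cmult tame_heat t h) auto
  also have "\<dots> = L a s' + 2 * m * R a s'"
    unfolding R' L' by (simp only: heat_add heat_cmult tame_cmult tame_heat t h)
  finally show ?thesis .
qed

lemma R_mono:
  assumes s: "0 \<le> s" "s \<le> s'" "s' \<le> a" shows "R a s \<le> R a s'"
proof -
  define r h where "r = a - s'" and "h = s' - s"
  have r: "0 \<le> r" and h: "0 \<le> h" and hr: "a - s = h + r" using s by (auto simp: r_def h_def)
  have R': "R a s' = heat s (heat h (\<lambda>z. A 0 r z * (rho r z)\<^sup>2)) 0"
    unfolding R_def r_def[symmetric] h_def using s r by (intro heat_split tame_A_rho2)
  have R: "R a s = heat s (\<lambda>z. A 0 (h + r) z * (rho (h + r) z)\<^sup>2) 0"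
    by (simp add: R_def hr)
  show ?thesis unfolding R' R
    using heat_centred_nonneg[OF r h] r h by (intro heat_mono tame_heat tame_A_rho2) auto
qed

lemma R_left_deriv: "s \<le> a \<Longrightarrow> (R a has_real_derivative L a s) (at s within {0..s})"
  and R_deriv: "0 < s \<Longrightarrow> s < a \<Longrightarrow> (R a has_real_derivative L a s) (at s)"
proof -
  obtain C where C: "\<And>s s'. 0 \<le> s \<Longrightarrow> s \<le> s' \<Longrightarrow> s' \<le> a \<Longrightarrow> s' - s \<le> 1 \<Longrightarrow>
    \<bar>R a s' - R a s - (s' - s) * L a s'\<bar> \<le> C * sqrt (s' - s) ^ 3" using R_step[of a] by blast
  show "s \<le> a \<Longrightarrow> (R a has_real_derivative L a s) (at s within {0..s})"
    by (rule left_deriv_of_left_expansion[OF C])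
  show "0 < s \<Longrightarrow> s < a \<Longrightarrow> (R a has_real_derivative L a s) (at s)"
    by (rule deriv_of_left_expansion[OF C])
qed

lemma L_bounds: "0 \<le> L a s" "0 \<le> s \<Longrightarrow> s \<le> a \<Longrightarrow> L a s \<le> exp (a / 2)"
proof -
  show "0 \<le> L a s" unfolding L_def by (intro heat_nonneg) (simp add: A_pos less_imp_le)
  assume s: "0 \<le> s" "s \<le> a"
  have "L a s \<le> heat s (A 0 (a - s)) 0"
    unfolding L_def using s Lam_abs
    by (intro heat_mono tame_A_Lam2 A_tame) (auto intro!: mult_left_le simp: abs_square_le_1 A_pos less_imp_le)
  also have "\<dots> = A 0 a 0" using s by (simp add: A_semigroup)
  also have "\<dots> \<le> heat a cosh 0"
    unfolding A_def using m_less by (intro heat_mono tame_cw tame_cosh coshpow_0_le_cosh) auto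
  finally show "L a s \<le> exp (a / 2)" using s by (simp add: heat_cosh)
qed

text \<open>The step expansion and the bound on \<open>L\<close> give a local Lipschitz estimate. It
  covers both end points, where \<open>R_deriv\<close> says nothing.\<close>

lemma R_continuous: "continuous_on {0..a} (R a)"
proof (cases "0 < a")
  case True
  obtain C where C: "\<And>s s'. 0 \<le> s \<Longrightarrow> s \<le> s' \<Longrightarrow> s' \<le> a \<Longrightarrow> s' - s \<le> 1 \<Longrightarrow>
    \<bar>R a s' - R a s - (s' - s) * L a s'\<bar> \<le> C * sqrt (s' - s) ^ 3" using R_step[of a] by blast
  define E where "E = \<bar>C\<bar> + exp (a / 2)"
  have E: "0 < E" by (simp add: E_def add_nonneg_pos)
  have le: "\<bar>R a s' - R a s\<bar> \<le> E * (s' - s)" if s: "0 \<le> s" "s \<le> s'" "s' \<le> a" "s' - s \<le> 1" for s s'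
  proof -
    define h where "h = s' - s"
    have h: "0 \<le> h" "h \<le> 1" using s by (auto simp: h_def)
    have L: "0 \<le> L a s'" "L a s' \<le> exp (a / 2)" using L_bounds s by (auto intro: order.trans)
    have "\<bar>R a s' - R a s\<bar> \<le> \<bar>R a s' - R a s - h * L a s'\<bar> + \<bar>h * L a s'\<bar>" by linarith
    also have "\<dots> \<le> C * sqrt h ^ 3 + h * exp (a / 2)"
      using C[OF s] L h by (intro add_mono) (auto simp: h_def[symmetric] abs_mult intro!: mult_left_mono)
    also have "C * sqrt h ^ 3 \<le> \<bar>C\<bar> * h"
      using h by (auto simp: sqrt_cube intro!: mult_mono mult_left_le)
    finally show ?thesis by (simp add: E_def h_def algebra_simps)
  qed
  show ?thesis
    unfolding continuous_on_iff
  proof (intro ballI allI impI)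
    fix x e :: real assume x: "x \<in> {0..a}" and e: "0 < e"
    show "\<exists>d>0. \<forall>x'\<in>{0..a}. dist x' x < d \<longrightarrow> dist (R a x') (R a x) < e"
    proof (intro exI[of _ "min 1 (e / E)"] conjI ballI impI)
      fix y assume y: "y \<in> {0..a}" "dist y x < min 1 (e / E)"
      have "\<bar>R a y - R a x\<bar> \<le> E * \<bar>y - x\<bar>"
        using le[of x y] le[of y x] x y by (cases "x \<le> y") (auto simp: dist_real_def abs_minus_commute)
      also have "\<dots> < e" using y E by (simp add: dist_real_def less_divide_eq mult.commute)
      finally show "dist (R a y) (R a x) < e" by (simp add: dist_real_def)
    qed (use e E in auto)
  qed
next
  case False
  then have "{0..a} = {} \<or> {0..a} = {0}" by auto
  then show ?thesis by auto
qed

text \<open>By symmetry: \<open>A 1 a 0\<close> is the Gaussian mean of an odd function, so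
  \<open>rho a 0 = 0\<close>.\<close>

lemma R_0: "R a 0 = 0"
proof -
  have "A 1 a 0 = - A 1 a 0"
  proof -
    have odd: "coshpow m 1 (- z) = - coshpow m 1 z" for z by (simp add: coshpow_1)
    have "A 1 a 0 = (\<integral>x. std_normal_density x * coshpow m 1 (x * sqrt a) \<partial>lborel)"
      by (simp add: A_def heat_def integral_std_normal_eq)
    also have "\<dots> = (\<integral>x. std_normal_density (- x) * coshpow m 1 (- x * sqrt a) \<partial>lborel)"
      by (subst lborel_integral_real_affine[where c = "-1" and t = 0]) auto
    also have "\<dots> = - (\<integral>x. std_normal_density x * coshpow m 1 (x * sqrt a) \<partial>lborel)"
      using odd by (simp add: normal_density_def)
    also have "\<dots> = - A 1 a 0"
      by (simp add: A_def heat_def integral_std_normal_eq)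
    finally show ?thesis .
  qed
  then show ?thesis by (simp add: R_def rho_def)
qed

text \<open>Since \<open>R\<close> itself increases, the coefficient 2 m can be raised to 2; the
  resulting threshold for \<open>a\<close> is then free of m.\<close>

lemma L_plus_2R_mono:
  assumes s: "0 \<le> s" "s \<le> s'" "s' \<le> a"
  shows "L a s + 2 * R a s \<le> L a s' + 2 * R a s'"
proof -
  have "(1 - m) * R a s \<le> (1 - m) * R a s'" using R_mono[OF s] m_less by (intro mult_left_mono) auto
  then show ?thesis using L_plus_R_mono[OF s] by (simp add: algebra_simps)
qed

text \<open>With no time left, the weight is cosh^m and \<open>Lam\<close> is m / cosh^2. This end
  value is what the slope from above the atom has to match.\<close>

lemma L_end: "L a a = m\<^sup>2 * heat a (coshpow (m - 4) 0) 0"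
proof -
  have "A 0 0 x * (Lam 0 x)\<^sup>2 = m\<^sup>2 * coshpow (m - 4) 0 x" for x
  proof -
    have Lam: "Lam 0 x = m * (1 - (tanh x)\<^sup>2)"
      by (simp add: Lam_def rho_def A_def coshpow_0 coshpow_1 numeral_2_eq_2 coshpow_2 power_mult_distrib)
    have "cosh x powr (m - 4) = cosh x powr m / cosh x ^ 4"
      by (simp add: powr_diff powr_numeral)
    moreover have "1 - (tanh x)\<^sup>2 = 1 / (cosh x)\<^sup>2"
      by (simp add: tanh_square_real)
    ultimately show ?thesis
      by (simp add: A_def Lam coshpow_0 power_mult_distrib power_divide flip: power_mult)
  qed
  then show ?thesis by (simp add: L_def heat_cmult)
qed

end

section \<open>Two-step Gaussian expectations\<close>

text \<open>For a Brownian motion \<open>B\<close> this is the mean of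
  \<open>v (B a) * f (B (a + s))\<close>, with the Markov property at time a built in.\<close>

definition two_step :: "real \<Rightarrow> (real \<Rightarrow> real) \<Rightarrow> (real \<Rightarrow> real) \<Rightarrow> real \<Rightarrow> real" where
  "two_step a v f s = heat a (\<lambda>x. v x * heat s f x) 0"

locale smooth_pair =
  fixes a :: real and v :: "real \<Rightarrow> real" and F :: "nat \<Rightarrow> real \<Rightarrow> real"
  assumes a_nonneg: "0 \<le> a"
    and v_meas [measurable]: "v \<in> borel_measurable borel" and v_bound: "\<And>x. \<bar>v x\<bar> \<le> 1"
    and tower: "tame_tower F" and bounded_tower: "\<And>k. \<exists>C. \<forall>x. \<bar>F k x\<bar> \<le> C"
begin

lemma tame_F: "tame (F k)"
  using tower by (simp add: tame_tower_def)

lemma F_deriv: "(F k has_real_derivative F (Suc k) x) (at x)"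
  using tower by (simp add: tame_tower_def)

lemma tame_v_heat: "0 \<le> s \<Longrightarrow> tame (\<lambda>x. v x * heat s (F k) x)"
  by (rule tame_bounded_mult[OF tame_heat[OF tame_F] v_meas v_bound])

lemma two_step_perturb:
  assumes g: "tame g" "\<And>x. \<bar>g x\<bar> \<le> C" and s: "0 \<le> s"
  shows "\<bar>heat a (\<lambda>x. v x * heat s g x) 0\<bar> \<le> C"
proof -
  have "\<bar>heat s g x\<bar> \<le> C" for x
    using heat_abs_le[OF g(1) tame_const g(2), of s x] by (simp add: heat_const)
  then have "\<bar>v x * heat s g x\<bar> \<le> 1 * C" for x
    unfolding abs_mult by (intro mult_mono v_bound) auto
  then show ?thesis
    using heat_abs_le[of "\<lambda>x. v x * heat s g x" "\<lambda>x. 1 * C" a 0] g s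
    by (simp add: heat_const tame_const tame_bounded_mult[OF tame_heat v_meas v_bound])
qed

lemma two_step_add:
  assumes s: "0 \<le> s" and h: "0 \<le> h"
  shows "two_step a v (F k) (s + h) = heat a (\<lambda>x. v x * heat s (heat h (F k)) x) 0"
  using heat_semigroup[OF s h tame_F] by (simp add: two_step_def)

text \<open>The generator of the flow is half the second derivative, whence \<open>F (k + 2)\<close>
  and the factor 1/2. A bound on the third derivative makes the error uniform in space, and
  averaging against \<open>v\<close> preserves it.\<close>

lemma two_step_expand:
  obtains C where "C > 0" "\<And>s h. 0 \<le> s \<Longrightarrow> 0 \<le> h \<Longrightarrow> h \<le> 1 \<Longrightarrow>
    \<bar>two_step a v (F k) (s + h) - two_step a v (F k) s - h * (two_step a v (F (k + 2)) s / 2)\<bar> \<le> C * sqrt h ^ 3"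
proof -
  obtain B where B1: "\<And>x. \<bar>F (k + 3) x\<bar> \<le> B" using bounded_tower by blast
  define B' where "B' = B + 1"
  have B: "\<bar>F (k + 3) x\<bar> \<le> B'" for x using B1[of x] by (simp add: B'_def)
  have B0: "0 < B'" using order.trans[OF abs_ge_zero B1[of 0]] by (simp add: B'_def)
  define C where "C = B' * (2 * exp ((real 3 + 1)\<^sup>2 / 2))"
  have "\<bar>two_step a v (F k) (s + h) - two_step a v (F k) s - h * (two_step a v (F (k + 2)) s / 2)\<bar> \<le> C * sqrt h ^ 3"
    if s: "0 \<le> s" and h: "0 \<le> h" "h \<le> 1" for s h
  proof -
    define g where "g x = heat h (F k) x - F k x - (h / 2) * F (k + 2) x" for x
    have tg: "tame g" unfolding g_def[abs_def] by (intro tame_diff tame_cmult tame_heat tame_F h)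
    have gb: "\<bar>g x\<bar> \<le> C * sqrt h ^ 3" for x
    proof -
      have "\<bar>heat h (F k) x - (F k x + (F (k + 2) x / 2) * h)\<bar> \<le> B' * (2 * exp ((real 3 + 1)\<^sup>2 / 2)) * sqrt h ^ 3"
      proof (rule heat_expand[OF tame_F h, where ?a1.0 = "F (k + 1) x"])
        fix y
        have "\<bar>F (k + 0) (x + y) - (\<Sum>j<3. F (k + j) x / fact j * y ^ j)\<bar> \<le> B' * \<bar>y\<bar> ^ 3"
          by (rule taylor_remainder_le[of "\<lambda>j. F (k + j)"]) (use F_deriv B in auto)
        also have "\<dots> \<le> B' * (\<bar>y\<bar> ^ 3 * exp \<bar>y\<bar>)"
          using B0 mult_left_mono[of 1 "exp \<bar>y\<bar>" "\<bar>y\<bar> ^ 3"] by (intro mult_left_mono) auto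
        finally show "\<bar>F k (x + y) - (F k x + F (k + 1) x * y + F (k + 2) x / 2 * y\<^sup>2)\<bar> \<le> B' * (\<bar>y\<bar> ^ 3 * exp \<bar>y\<bar>)"
          by (simp add: numeral_3_eq_3 numeral_2_eq_2)
      qed
      then show ?thesis by (simp add: g_def C_def algebra_simps)
    qed
    have hg: "heat s g x = heat s (heat h (F k)) x - heat s (F k) x - (h / 2) * heat s (F (k + 2)) x" for x
      unfolding g_def[abs_def] using h by (simp only: heat_diff heat_cmult tame_diff tame_cmult tame_heat tame_F)
    have th: "tame (\<lambda>x. v x * heat s (heat h (F k)) x)"
      by (rule tame_bounded_mult[OF tame_heat[OF tame_heat[OF tame_F h(1)] s] v_meas v_bound])
    have "(\<lambda>x. v x * heat s g x) = (\<lambda>x. v x * heat s (heat h (F k)) x - v x * heat s (F k) x - (h / 2) * (v x * heat s (F (k + 2)) x))"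
      by (simp add: fun_eq_iff hg algebra_simps)
    then have "heat a (\<lambda>x. v x * heat s g x) 0 = heat a (\<lambda>x. v x * heat s (heat h (F k)) x) 0
        - heat a (\<lambda>x. v x * heat s (F k) x) 0 - (h / 2) * heat a (\<lambda>x. v x * heat s (F (k + 2)) x) 0"
      using s by (simp only: heat_diff heat_cmult tame_diff tame_cmult th tame_v_heat)
    then have "heat a (\<lambda>x. v x * heat s g x) 0 = two_step a v (F k) (s + h) - two_step a v (F k) s - h * (two_step a v (F (k + 2)) s / 2)"
      unfolding two_step_add[OF s h(1)] by (simp add: two_step_def)
    then show ?thesis using two_step_perturb[OF tg gb s] by simp
  qed
  moreover have "C > 0" using B0 by (simp add: C_def)
  ultimately show ?thesis by (intro that[of C]) auto
qed

lemma two_step_lipschitz: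
  obtains C where "C > 0" "\<And>s h. 0 \<le> s \<Longrightarrow> 0 \<le> h \<Longrightarrow> h \<le> 1 \<Longrightarrow>
    \<bar>two_step a v (F k) (s + h) - two_step a v (F k) s\<bar> \<le> C * sqrt h"
proof -
  obtain C where C: "C > 0" "\<And>s h. 0 \<le> s \<Longrightarrow> 0 \<le> h \<Longrightarrow> h \<le> 1 \<Longrightarrow>
    \<bar>two_step a v (F k) (s + h) - two_step a v (F k) s - h * (two_step a v (F (k + 2)) s / 2)\<bar> \<le> C * sqrt h ^ 3"
    using two_step_expand[of k] by blast
  obtain B where B: "\<And>x. \<bar>F (k + 2) x\<bar> \<le> B" using bounded_tower by blast
  have B0: "0 \<le> B" using order.trans[OF abs_ge_zero B[of 0]] .
  have "\<bar>two_step a v (F k) (s + h) - two_step a v (F k) s\<bar> \<le> (C + B) * sqrt h"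
    if s: "0 \<le> s" and h: "0 \<le> h" "h \<le> 1" for s h
  proof -
    have sh: "sqrt h \<le> 1" using h by simp
    have "h = sqrt h * sqrt h" using h by simp
    also have "\<dots> \<le> 1 * sqrt h" using sh h by (intro mult_right_mono) auto
    finally have hs: "h \<le> sqrt h" by simp
    have b: "\<bar>two_step a v (F (k + 2)) s / 2\<bar> \<le> B"
      using two_step_perturb[OF tame_F B s] by (simp add: two_step_def)
    have "\<bar>h * (two_step a v (F (k + 2)) s / 2)\<bar> \<le> sqrt h * B"
      unfolding abs_mult using b hs h by (intro mult_mono) auto
    moreover have "sqrt h ^ 3 \<le> sqrt h ^ 1" using sh h by (intro power_decreasing) auto
    then have "C * sqrt h ^ 3 \<le> C * sqrt h" using C(1) by (intro mult_left_mono) auto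
    ultimately show ?thesis using C(2)[OF s h] by (simp add: algebra_simps)
  qed
  then show ?thesis using C B0 by (intro that[of "C + B"]) auto
qed

text \<open>The expansion only steps forward, with the slope at the earlier time. For y < s the
  slope must be moved from y to s; the Hoelder bound on it makes this cost another h * sqrt
  h.\<close>

lemma two_step_deriv:
  assumes s: "0 \<le> s"
  shows "(two_step a v (F k) has_real_derivative two_step a v (F (k + 2)) s / 2) (at s within {0..})"
proof -
  obtain C where C: "C > 0" "\<And>s h. 0 \<le> s \<Longrightarrow> 0 \<le> h \<Longrightarrow> h \<le> 1 \<Longrightarrow>
    \<bar>two_step a v (F k) (s + h) - two_step a v (F k) s - h * (two_step a v (F (k + 2)) s / 2)\<bar> \<le> C * sqrt h ^ 3"
    using two_step_expand[of k] by blast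
  obtain C' where C': "C' > 0" "\<And>s h. 0 \<le> s \<Longrightarrow> 0 \<le> h \<Longrightarrow> h \<le> 1 \<Longrightarrow>
    \<bar>two_step a v (F (k + 2)) (s + h) - two_step a v (F (k + 2)) s\<bar> \<le> C' * sqrt h"
    using two_step_lipschitz[of "k + 2"] by blast
  let ?H = "two_step a v (F k)" and ?D = "\<lambda>s. two_step a v (F (k + 2)) s / 2"
  show ?thesis
  proof (rule has_derivative_from_remainder[where C = "C + C'"])
    fix y assume y: "y \<in> {0..}" "\<bar>y - s\<bar> \<le> 1"
    show "\<bar>?H y - ?H s - (y - s) * ?D s\<bar> \<le> (C + C') * sqrt \<bar>y - s\<bar> ^ 3"
    proof (cases "s \<le> y")
      case True
      then have "\<bar>?H y - ?H s - (y - s) * ?D s\<bar> \<le> C * sqrt (y - s) ^ 3"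
        using C(2)[OF s, of "y - s"] y by simp
      also have "\<dots> \<le> (C + C') * sqrt (y - s) ^ 3" using True C'(1) by (intro mult_right_mono) auto
      finally show ?thesis using True by simp
    next
      case False
      define h where "h = s - y"
      have h: "0 \<le> h" "h \<le> 1" "s = y + h" "0 \<le> y" using False y by (auto simp: h_def)
      have 1: "\<bar>?H s - ?H y - h * ?D y\<bar> \<le> C * sqrt h ^ 3" using C(2)[OF h(4,1,2)] h(3) by simp
      have "\<bar>h * (?D s - ?D y)\<bar> \<le> h * (C' * sqrt h)"
        unfolding abs_mult using C'(2)[OF h(4,1,2)] h by (intro mult_mono) auto
      then have "\<bar>h * ?D s - h * ?D y\<bar> \<le> C' * sqrt h ^ 3" using h(1) by (simp add: sqrt_cube algebra_simps)
      then have "\<bar>?H y - ?H s - (- h) * ?D s\<bar> \<le> C * sqrt h ^ 3 + C' * sqrt h ^ 3" using 1 by linarith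
      then show ?thesis using False by (simp add: h_def algebra_simps)
    qed
  qed
qed

end

section \<open>Rearrangement for symmetric decreasing functions\<close>

lemma heat_eq_lborel:
  assumes r: "0 < r" and [measurable]: "f \<in> borel_measurable borel"
  shows "heat r f x = (\<integral>y. normal_density x (sqrt r) y * f y \<partial>lborel)"
proof -
  have "(\<integral>y. normal_density x (sqrt r) y * f y \<partial>lborel)
    = \<bar>sqrt r\<bar> *\<^sub>R (\<integral>g. normal_density x (sqrt r) (x + sqrt r * g) * f (x + sqrt r * g) \<partial>lborel)"
    using r by (intro lborel_integral_real_affine) auto
  also have "\<dots> = (\<integral>g. std_normal_density g * f (x + sqrt r * g) \<partial>lborel)"
    using r by (simp add: normal_density_def real_sqrt_mult power_mult_distrib flip: integral_mult_right_zero)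
       (simp add: field_simps)
  finally show ?thesis
    by (simp add: heat_def integral_std_normal_eq mult.commute)
qed

definition symmetric_decreasing :: "(real \<Rightarrow> real) \<Rightarrow> bool" where
  "symmetric_decreasing f \<longleftrightarrow> (\<forall>x y. \<bar>x\<bar> \<le> \<bar>y\<bar> \<longrightarrow> f y \<le> f x)"

lemma symmetric_decreasing_even: "symmetric_decreasing f \<Longrightarrow> f (- x) = f x"
  unfolding symmetric_decreasing_def by (intro antisym) auto

lemma symmetric_decreasing_mult:
  "symmetric_decreasing f \<Longrightarrow> symmetric_decreasing g \<Longrightarrow> (\<And>x. 0 \<le> f x) \<Longrightarrow> (\<And>x. 0 \<le> g x) \<Longrightarrow>
    symmetric_decreasing (\<lambda>x. f x * g x)"
  unfolding symmetric_decreasing_def by (auto intro!: mult_mono)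

lemma symmetric_decreasing_normal_density: "symmetric_decreasing (normal_density 0 \<sigma>)"
  unfolding symmetric_decreasing_def normal_density_def
  by (auto intro!: mult_left_mono divide_right_mono simp: abs_le_square_iff)

lemma symmetric_decreasing_coshpow: "e \<le> 0 \<Longrightarrow> symmetric_decreasing (coshpow e 0)"
  unfolding symmetric_decreasing_def coshpow_0
proof (intro allI impI)
  fix x y :: real assume e: "e \<le> 0" and xy: "\<bar>x\<bar> \<le> \<bar>y\<bar>"
  have "cosh x \<le> cosh y"
    using xy cosh_real_nonneg_le_iff[of "\<bar>x\<bar>" "\<bar>y\<bar>"] by simp
  then show "cosh y powr e \<le> cosh x powr e"
    using e by (intro powr_mono2') auto
qed

text \<open>Pair \<open>y\<close> with its mirror image in the midpoint of \<open>x\<close> and \<open>x'\<close>.\<close>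

lemma symmetric_decreasing_heat:
  assumes w: "symmetric_decreasing w" "w \<in> borel_measurable borel" "\<And>x. \<bar>w x\<bar> \<le> C" and s: "0 \<le> s"
  shows "symmetric_decreasing (heat s w)"
proof (cases "s = 0")
  case True then show ?thesis using w by (simp add: symmetric_decreasing_def)
next
  case False
  then have s: "0 < s" using s by simp
  note [measurable] = w(2)
  let ?d = "\<lambda>x y. normal_density x (sqrt s) y"
  have even: "heat s w (- x) = heat s w x" for x
  proof -
    have "heat s w (- x) = (\<integral>y. ?d (- x) (- y) * w (- y) \<partial>lborel)"
      unfolding heat_eq_lborel[OF s w(2)] by (subst lborel_integral_real_affine[where c = "-1" and t = 0]) auto
    also have "\<dots> = heat s w x"
      unfolding heat_eq_lborel[OF s w(2)]
      by (simp add: symmetric_decreasing_even[OF w(1)] normal_density_def power2_commute)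
    finally show ?thesis .
  qed
  have int: "integrable lborel (\<lambda>y. ?d x y * u y)" if [measurable]: "u \<in> borel_measurable borel" and "\<And>y. \<bar>u y\<bar> \<le> C" for x u
    by (rule Bochner_Integration.integrable_bound[of _ "\<lambda>y. C * ?d x y"])
       (use that order.trans[OF abs_ge_zero that(2)] s in \<open>auto simp: abs_mult mult.commute intro!: mult_right_mono integrable_mult_right\<close>)
  have mono: "heat s w x' \<le> heat s w x" if x: "0 \<le> x" "x < x'" for x x'
  proof -
    define t where "t = x + x'"
    have refl: "(\<integral>y. ?d (t - z) y * w (t - y) \<partial>lborel) = (\<integral>y. ?d z y * w y \<partial>lborel)" for z
    proof -
      have "?d (t - z) (t + -1 * y) = ?d z y" for y
        by (simp add: normal_density_def power2_commute[of z y])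
      then show ?thesis
        using lborel_integral_real_affine[of "-1" "\<lambda>y. ?d (t - z) y * w (t - y)" t] by simp
    qed
    have t: "t - x = x'" "t - x' = x" by (auto simp: t_def)
    \<comment> \<open>Left of the midpoint t / 2 both factors are nonnegative, right of it both are
      nonpositive. Opened up, the integral is twice the wanted difference.\<close>
    have "0 \<le> (\<integral>y. (?d x y - ?d x' y) * (w y - w (t - y)) \<partial>lborel)"
    proof (rule Bochner_Integration.integral_nonneg)
      fix y
      show "0 \<le> (?d x y - ?d x' y) * (w y - w (t - y))"
      proof (cases "2 * y \<le> t")
        case True
        have "\<bar>y - x\<bar> \<le> \<bar>y - x'\<bar>" "\<bar>y\<bar> \<le> \<bar>t - y\<bar>" using True x by (auto simp: t_def)
        then have "?d x' y \<le> ?d x y" "w (t - y) \<le> w y"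
          using w(1) by (auto simp: symmetric_decreasing_def normal_density_def abs_le_square_iff intro!: mult_left_mono divide_right_mono)
        then show ?thesis by simp
      next
        case False
        have "\<bar>y - x'\<bar> \<le> \<bar>y - x\<bar>" "\<bar>t - y\<bar> \<le> \<bar>y\<bar>" using False x by (auto simp: t_def)
        then have "?d x y \<le> ?d x' y" "w y \<le> w (t - y)"
          using w(1) by (auto simp: symmetric_decreasing_def normal_density_def abs_le_square_iff intro!: mult_left_mono divide_right_mono)
        then show ?thesis by (intro mult_nonpos_nonpos) auto
      qed
    qed
    also have "\<dots> = (\<integral>y. (?d x y * w y - ?d x y * w (t - y)) - (?d x' y * w y - ?d x' y * w (t - y)) \<partial>lborel)"
      by (simp add: algebra_simps)
    also have "\<dots> = 2 * (heat s w x - heat s w x')"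
      using int[of w x] int[of w x'] int[of "\<lambda>y. w (t - y)" x] int[of "\<lambda>y. w (t - y)" x'] w(3)
      by (simp add: refl[of x, unfolded t] refl[of x', unfolded t] heat_eq_lborel[OF s w(2)])
    finally show ?thesis by simp
  qed
  show ?thesis
    unfolding symmetric_decreasing_def
  proof (intro allI impI)
    fix x y :: real assume xy: "\<bar>x\<bar> \<le> \<bar>y\<bar>"
    have abs: "heat s w \<bar>z\<bar> = heat s w z" for z using even[of z] by (auto simp: abs_if)
    have "heat s w \<bar>y\<bar> \<le> heat s w \<bar>x\<bar>" using mono[of "\<bar>x\<bar>" "\<bar>y\<bar>"] xy by (cases "\<bar>x\<bar> = \<bar>y\<bar>") auto
    then show "heat s w y \<le> heat s w x" by (simp only: abs)
  qed
qed

text \<open>\<open>(f x - f (x + t)) (g x - g (x + t)) \<ge> 0\<close> integrates to twice the difference of the two sides.\<close>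

lemma symmetric_decreasing_overlap:
  assumes f: "symmetric_decreasing f" "integrable lborel f"
    and g: "symmetric_decreasing g" "g \<in> borel_measurable borel" "\<And>x. \<bar>g x\<bar> \<le> C"
  shows "(\<integral>x. f x * g (x + t) \<partial>lborel) \<le> (\<integral>x. f x * g x \<partial>lborel)"
proof -
  have [measurable]: "f \<in> borel_measurable borel" "g \<in> borel_measurable borel" using f g by auto
  have int: "integrable lborel (\<lambda>y. f' y * u y)" if "integrable lborel f'" and [measurable]: "u \<in> borel_measurable borel" and "\<And>y. \<bar>u y\<bar> \<le> C" for f' u
  proof (rule Bochner_Integration.integrable_bound[of _ "\<lambda>y. C * f' y"])
    show "AE x in lborel. norm (f' x * u x) \<le> norm (C * f' x)"
      using that order.trans[OF abs_ge_zero that(3)] by (auto simp: abs_mult mult.commute[of C] intro!: mult_left_mono AE_I2)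
    show "(\<lambda>y. f' y * u y) \<in> borel_measurable lborel" using that(1) by measurable
  qed (use that in auto)
  have ft: "integrable lborel (\<lambda>x. f (x + t))"
    using lborel_integrable_real_affine[OF f(2), of 1 t] by (simp add: add.commute)
  have shift: "(\<integral>x. h (x + t) \<partial>lborel) = (\<integral>x. h x \<partial>lborel)" for h :: "real \<Rightarrow> real"
    by (subst (2) lborel_integral_real_affine[where c = 1 and t = t]) (auto simp: add.commute)
  have cross: "(\<integral>x. f (x + t) * g x \<partial>lborel) = (\<integral>x. f x * g (x + t) \<partial>lborel)"
  proof -
    have "(\<integral>x. f (x + t) * g x \<partial>lborel) = (\<integral>x. f (- x) * g (- x - t) \<partial>lborel)"
      by (subst lborel_integral_real_affine[where c = "-1" and t = "- t"]) (auto simp: algebra_simps)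
    also have "\<dots> = (\<integral>x. f x * g (x + t) \<partial>lborel)"
      using symmetric_decreasing_even[OF f(1)] symmetric_decreasing_even[OF g(1), of "x + t" for x]
      by (simp add: algebra_simps)
    finally show ?thesis .
  qed
  have "0 \<le> (\<integral>x. (f x - f (x + t)) * (g x - g (x + t)) \<partial>lborel)"
  proof (rule Bochner_Integration.integral_nonneg)
    fix x
    show "0 \<le> (f x - f (x + t)) * (g x - g (x + t))"
      using f(1) g(1) unfolding symmetric_decreasing_def
      by (cases "\<bar>x\<bar> \<le> \<bar>x + t\<bar>") (auto intro!: mult_nonneg_nonneg mult_nonpos_nonpos)
  qed
  also have "\<dots> = (\<integral>x. (f x * g x - f x * g (x + t)) - (f (x + t) * g x - f (x + t) * g (x + t)) \<partial>lborel)"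
    by (simp add: algebra_simps)
  also have "\<dots> = (\<integral>x. f x * g x \<partial>lborel) - (\<integral>x. f x * g (x + t) \<partial>lborel)
      - ((\<integral>x. f (x + t) * g x \<partial>lborel) - (\<integral>x. f (x + t) * g (x + t) \<partial>lborel))"
    using int[OF f(2), of g] int[OF f(2), of "\<lambda>x. g (x + t)"] int[OF ft, of g] int[OF ft, of "\<lambda>x. g (x + t)"] g(3)
    by simp
  also have "(\<integral>x. f (x + t) * g (x + t) \<partial>lborel) = (\<integral>x. f x * g x \<partial>lborel)"
    by (rule shift[of "\<lambda>x. f x * g x"])
  finally show ?thesis by (simp add: cross)
qed

text \<open>The additional time \<open>h = s' - s\<close> only displaces \<open>W = heat s w\<close>
  by a Gaussian amount. By Fubini the later value is an average of overlaps of the Gaussian density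
  times \<open>v\<close> with translates of \<open>W\<close>, none larger than the overlap without
  translation.\<close>

lemma two_step_antimono:
  assumes a: "0 < a" and v: "symmetric_decreasing v" "v \<in> borel_measurable borel" "\<And>x. 0 \<le> v x" "\<And>x. v x \<le> 1"
    and w: "symmetric_decreasing w" "w \<in> borel_measurable borel" "\<And>x. \<bar>w x\<bar> \<le> C"
    and s: "0 \<le> s" "s \<le> s'"
  shows "two_step a v w s' \<le> two_step a v w s"
proof -
  interpret N: prob_space std_normal_distribution by (rule prob_space_std_normal)
  interpret pair_sigma_finite lborel std_normal_distribution ..
  note [measurable] = v(2) w(2)
  define h where "h = s' - s"
  have h: "0 \<le> h" using s by (simp add: h_def)
  define W where "W = heat s w"
  have tw: "tame w" by (rule tame_bounded[OF w(2,3)])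
  have W: "symmetric_decreasing W" "W \<in> borel_measurable borel" "\<And>x. \<bar>W x\<bar> \<le> C"
  proof -
    show "symmetric_decreasing W" unfolding W_def by (rule symmetric_decreasing_heat[OF w s(1)])
    show "W \<in> borel_measurable borel" unfolding W_def by measurable
    show "\<bar>W x\<bar> \<le> C" for x
      using heat_abs_le[OF tw tame_const w(3), of s x] by (simp add: W_def heat_const)
  qed
  note [measurable] = W(2)
  define f where "f x = normal_density 0 (sqrt a) x * v x" for x
  have f: "symmetric_decreasing f" "integrable lborel f"
  proof -
    show "symmetric_decreasing f" unfolding f_def
      by (intro symmetric_decreasing_mult symmetric_decreasing_normal_density v) auto
    show "integrable lborel f" unfolding f_def
      by (rule Bochner_Integration.integrable_bound[of _ "normal_density 0 (sqrt a)"])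
         (use a v in \<open>auto simp: abs_mult intro!: mult_left_le\<close>)
  qed
  have [measurable]: "f \<in> borel_measurable borel" using f by auto
  have eq: "two_step a v u' r = (\<integral>x. f x * heat r u' x \<partial>lborel)" if [measurable]: "u' \<in> borel_measurable borel" for u' r
    unfolding two_step_def by (subst heat_eq_lborel[OF a]) (auto simp: f_def mult.assoc)
  have int: "integrable (lborel \<Otimes>\<^sub>M std_normal_distribution) (\<lambda>(x, g). f x * W (x + g * sqrt h))"
    proof (rule Fubini_integrable)
      show "integrable lborel (\<lambda>x. \<integral>g. norm (case (x, g) of (x, g) \<Rightarrow> f x * W (x + g * sqrt h)) \<partial>std_normal_distribution)"
      proof (rule Bochner_Integration.integrable_bound[of _ "\<lambda>x. C * f x"])
        show "AE x in lborel. norm (\<integral>g. norm (case (x, g) of (x, g) \<Rightarrow> f x * W (x + g * sqrt h)) \<partial>std_normal_distribution) \<le> norm (C * f x)"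
        proof (rule AE_I2)
          fix x
          have C: "0 \<le> C" using order.trans[OF abs_ge_zero W(3)] .
          have "(\<integral>g. \<bar>f x * W (x + g * sqrt h)\<bar> \<partial>std_normal_distribution) \<le> (\<integral>g. \<bar>f x\<bar> * C \<partial>std_normal_distribution)"
          proof (rule integral_mono)
            have "integrable std_normal_distribution (\<lambda>g. W (x + g * sqrt h))"
              by (rule tame_integrable[OF tame_bounded[OF W(2,3)]])
            then show "integrable std_normal_distribution (\<lambda>g. \<bar>f x * W (x + g * sqrt h)\<bar>)" by auto
          qed (use W(3) in \<open>auto simp: abs_mult intro!: mult_left_mono\<close>)
          then show "norm (\<integral>g. norm (case (x, g) of (x, g) \<Rightarrow> f x * W (x + g * sqrt h)) \<partial>std_normal_distribution) \<le> norm (C * f x)"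
            using C N.prob_space by (simp add: abs_mult mult.commute)
        qed
      qed (use f in auto)
      show "AE x in lborel. integrable std_normal_distribution (\<lambda>y. case (x, y) of (x, g) \<Rightarrow> f x * W (x + g * sqrt h))"
        using tame_integrable[OF tame_bounded[OF W(2,3)]] by auto
    qed measurable
  have "two_step a v w s' = (\<integral>x. f x * heat h W x \<partial>lborel)"
    using eq[of w s'] heat_semigroup[OF h s(1) tw] by (simp add: W_def h_def)
  also have "\<dots> = (\<integral>x. \<integral>g. f x * W (x + g * sqrt h) \<partial>std_normal_distribution \<partial>lborel)"
    by (simp add: heat_def)
  also have "\<dots> = (\<integral>g. \<integral>x. f x * W (x + g * sqrt h) \<partial>lborel \<partial>std_normal_distribution)"
    by (rule Fubini_integral[OF int, symmetric])
  also have "\<dots> \<le> (\<integral>g. (\<integral>x. f x * W x \<partial>lborel) \<partial>std_normal_distribution)"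
    by (intro integral_mono symmetric_decreasing_overlap[OF f W] integrable_snd[OF int]) auto
  also have "\<dots> = two_step a v w s" using eq[of w s] N.prob_space by (simp add: W_def)
  finally show ?thesis .
qed

section \<open>Brownian expectations\<close>

lemma brownian_increment:
  assumes "standard_brownian_motion P B" "0 \<le> s" "s < t"
  shows "distributed P lborel (\<lambda>\<omega>. B t \<omega> - B s \<omega>) (normal_density 0 (sqrt (t - s)))"
  using assms unfolding standard_brownian_motion_def by blast

lemma brownian_expectation_1:
  assumes B: "standard_brownian_motion P B" and t: "0 \<le> t" and [measurable]: "f \<in> borel_measurable borel"
  shows "prob_space.expectation P (\<lambda>\<omega>. f (B t \<omega>)) = heat t f 0"
proof -
  interpret prob_space P using B by (simp add: standard_brownian_motion_def)
  have meas [measurable]: "B u \<in> borel_measurable P" if "0 \<le> u" for u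
    using B that by (simp add: standard_brownian_motion_def)
  have B0: "AE \<omega> in P. B 0 \<omega> = 0" using B by (simp add: standard_brownian_motion_def)
  note [measurable] = meas[OF t] meas[of 0, simplified]
  show ?thesis
  proof (cases "t = 0")
    case True
    have "expectation (\<lambda>\<omega>. f (B 0 \<omega>)) = expectation (\<lambda>\<omega>. f 0)"
      by (rule integral_cong_AE) (use B0 in \<open>auto elim: AE_mp\<close>)
    then show ?thesis using True prob_space by simp
  next
    case False
    then have t: "0 < t" using t by simp
    have "distributed P lborel (\<lambda>\<omega>. B t \<omega> - B 0 \<omega>) (normal_density 0 (sqrt t))"
      using brownian_increment[OF B _ t] by simp
    from distributed_integral[OF this, of f]
    have "heat t f 0 = expectation (\<lambda>\<omega>. f (B t \<omega> - B 0 \<omega>))"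
      by (simp add: heat_eq_lborel[OF t])
    also have "\<dots> = expectation (\<lambda>\<omega>. f (B t \<omega>))"
      by (rule integral_cong_AE) (use B0 in \<open>auto elim: AE_mp\<close>)
    finally show ?thesis ..
  qed
qed

lemma brownian_increments:
  assumes B: "standard_brownian_motion P B" and s: "0 < s" "s < t"
  shows "distr P (borel \<Otimes>\<^sub>M borel) (\<lambda>\<omega>. (B s \<omega> - B 0 \<omega>, B t \<omega> - B s \<omega>))
    = distr (std_normal_distribution \<Otimes>\<^sub>M std_normal_distribution) (borel \<Otimes>\<^sub>M borel)
        (\<lambda>z. (fst z * sqrt s, snd z * sqrt (t - s)))"
proof -
  interpret prob_space P using B by (simp add: standard_brownian_motion_def)
  interpret N: prob_space std_normal_distribution by (rule prob_space_std_normal)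
  interpret NN: pair_prob_space std_normal_distribution std_normal_distribution ..
  \<comment> \<open>The grid 0 < s < t, with two increments. They start from \<open>B 0\<close>,
    which is zero only almost surely, and is removed later under the expectation.\<close>
  define g where "g i = (if i = 0 then 0 else if i = 1 then s else t)" for i :: nat
  have iv: "indep_vars (\<lambda>_. borel) (\<lambda>i \<omega>. B (g (Suc i)) \<omega> - B (g i) \<omega>) {..<2}"
  proof -
    have "0 \<le> g 0 \<and> (\<forall>i<2. g i < g (Suc i))" using s by (auto simp: g_def less_2_cases_iff)
    then show ?thesis using B unfolding standard_brownian_motion_def by blast
  qed
  have ind: "indep_var borel (\<lambda>\<omega>. B s \<omega> - B 0 \<omega>) borel (\<lambda>\<omega>. B t \<omega> - B s \<omega>)"
  proof -
    have "{..<2} = insert 0 {1 :: nat}" by auto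
    then show ?thesis
      using indep_vars_sum[of "{1}" 0 "\<lambda>i \<omega>. B (g (Suc i)) \<omega> - B (g i) \<omega>"] iv by (simp add: g_def)
  qed
  have d: "distributed P lborel (\<lambda>\<omega>. B s \<omega> - B 0 \<omega>) (normal_density 0 (sqrt s))"
    "distributed P lborel (\<lambda>\<omega>. B t \<omega> - B s \<omega>) (normal_density 0 (sqrt (t - s)))"
    using brownian_increment[OF B, of 0 s] brownian_increment[OF B, of s t] s by simp_all
  have ind': "NN.indep_var borel (\<lambda>z. fst z * sqrt s) borel (\<lambda>z. snd z * sqrt (t - s))"
    using NN.indep_var_compose[OF std_normal_pair(1), of "\<lambda>x. x * sqrt s" borel "\<lambda>x. x * sqrt (t - s)" borel]
    by (simp add: comp_def)
  have d': "distributed (std_normal_distribution \<Otimes>\<^sub>M std_normal_distribution) lborel (\<lambda>z. fst z * sqrt s) (normal_density 0 (sqrt s))"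
    "distributed (std_normal_distribution \<Otimes>\<^sub>M std_normal_distribution) lborel (\<lambda>z. snd z * sqrt (t - s)) (normal_density 0 (sqrt (t - s)))"
    using s by (auto intro!: distributed_std_normal_scale NN.prob_space_axioms std_normal_pair)
  have c: "distr M borel X = distr M lborel X" for M and X :: "_ \<Rightarrow> real"
    by (rule distr_cong) auto
  note eqs = d[THEN distributed_distr_eq_density] d'[THEN distributed_distr_eq_density]
  have "distr P (borel \<Otimes>\<^sub>M borel) (\<lambda>\<omega>. (B s \<omega> - B 0 \<omega>, B t \<omega> - B s \<omega>))
      = density lborel (normal_density 0 (sqrt s)) \<Otimes>\<^sub>M density lborel (normal_density 0 (sqrt (t - s)))"
    using ind unfolding indep_var_distribution_eq by (simp only: c eqs)
  also have "\<dots> = distr (std_normal_distribution \<Otimes>\<^sub>M std_normal_distribution) (borel \<Otimes>\<^sub>M borel)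
        (\<lambda>z. (fst z * sqrt s, snd z * sqrt (t - s)))"
    using ind' unfolding NN.indep_var_distribution_eq by (simp only: c eqs)
  finally show ?thesis .
qed

text \<open>The Markov property at s: \<open>B t\<close> is \<open>B s\<close> plus an independent
  Gaussian of variance t - s, so Fubini on the law of the two increments averages \<open>g\<close>
  first.\<close>

lemma brownian_expectation_2:
  assumes B: "standard_brownian_motion P B" and s: "0 < s" "s \<le> t"
    and v: "v \<in> borel_measurable borel" "\<And>x. \<bar>v x\<bar> \<le> C" and g: "tame g"
  shows "prob_space.expectation P (\<lambda>\<omega>. v (B s \<omega>) * g (B t \<omega>)) = heat s (\<lambda>x. v x * heat (t - s) g x) 0"
proof (cases "s = t")
  case True
  note [measurable] = v(1) tame_measurable[OF g]
  show ?thesis using brownian_expectation_1[OF B, of t "\<lambda>x. v x * g x"] s True by simp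
next
  case False
  then have st: "s < t" using s by simp
  interpret prob_space P using B by (simp add: standard_brownian_motion_def)
  interpret N: prob_space std_normal_distribution by (rule prob_space_std_normal)
  interpret NN: pair_prob_space std_normal_distribution std_normal_distribution ..
  note [measurable] = v(1) tame_measurable[OF g]
  have meas [measurable]: "B u \<in> borel_measurable P" if "0 \<le> u" for u
    using B that by (simp add: standard_brownian_motion_def)
  have B0: "AE \<omega> in P. B 0 \<omega> = 0" using B by (simp add: standard_brownian_motion_def)
  note [measurable] = meas[of s] meas[of t] meas[of 0, simplified]
  have [measurable]: "B s \<in> borel_measurable P" "B t \<in> borel_measurable P" using s by (auto intro!: meas)
  let ?h = "\<lambda>(x, y). v x * g (x + y)"
  have "expectation (\<lambda>\<omega>. v (B s \<omega>) * g (B t \<omega>)) = expectation (\<lambda>\<omega>. ?h (B s \<omega> - B 0 \<omega>, B t \<omega> - B s \<omega>))"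
    by (rule integral_cong_AE) (use B0 in \<open>auto elim: AE_mp\<close>)
  also have "\<dots> = (\<integral>z. ?h z \<partial>distr P (borel \<Otimes>\<^sub>M borel) (\<lambda>\<omega>. (B s \<omega> - B 0 \<omega>, B t \<omega> - B s \<omega>)))"
    by (subst integral_distr) auto
  also have "\<dots> = (\<integral>z. ?h (fst z * sqrt s, snd z * sqrt (t - s)) \<partial>(std_normal_distribution \<Otimes>\<^sub>M std_normal_distribution))"
    unfolding brownian_increments[OF B s(1) st] by (subst integral_distr) auto
  also have "\<dots> = (\<integral>x. \<integral>y. v (x * sqrt s) * g (x * sqrt s + y * sqrt (t - s)) \<partial>std_normal_distribution \<partial>std_normal_distribution)"
  proof -
    have "integrable (std_normal_distribution \<Otimes>\<^sub>M std_normal_distribution) (\<lambda>z. C * g (0 + fst z * sqrt s + snd z * sqrt (t - s)))"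
      using s by (intro integrable_mult_right tame_pair_integrable g) auto
    then have "integrable (std_normal_distribution \<Otimes>\<^sub>M std_normal_distribution) (\<lambda>z. ?h (fst z * sqrt s, snd z * sqrt (t - s)))"
      by (rule Bochner_Integration.integrable_bound)
         (use v order.trans[OF abs_ge_zero v(2)] in \<open>auto simp: abs_mult intro!: mult_right_mono\<close>)
    from NN.integral_fst'[OF this] show ?thesis by simp
  qed
  also have "\<dots> = heat s (\<lambda>x. v x * heat (t - s) g x) 0"
    by (simp add: heat_def)
  finally show ?thesis .
qed

lemma integral_two_atoms:
  assumes "0 < m" "m < 1" shows "(\<integral>t. f t \<partial>two_atoms m q) = m * f 0 + (1 - m) * (f q :: real)"
  using assms by (simp add: two_atoms_def algebra_simps)

lemma W_two_atoms:
  assumes "0 < m" "m < 1" "0 < q" "0 \<le> u"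
  shows "W_fun \<Phi> (two_atoms m q) M u \<omega> = m * (\<Phi> (M u \<omega>) u - \<Phi> (M 0 \<omega>) 0)
    + (if q \<le> u then (1 - m) * (\<Phi> (M u \<omega>) u - \<Phi> (M q \<omega>) q) else 0)"
  using assms unfolding W_fun_def set_lebesgue_integral_def
  by (subst integral_two_atoms) (auto simp: indicator_def)

section \<open>The two-atom Parisi measure\<close>

lemma has_derivative_glue:
  fixes f :: "real \<Rightarrow> real"
  assumes "(f has_real_derivative D) (at x within S)" "(f has_real_derivative D) (at x within T)"
  shows "(f has_real_derivative D) (at x within S \<union> T)"
  using assms by (simp add: has_field_derivative_iff Lim_within_Un)

lemma deriv01_eq:
  assumes "(f has_real_derivative D) (at u within {0..1})" "0 \<le> u" "u \<le> 1"
  shows "deriv01 f u = D"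
  unfolding deriv01_def
  by (rule vector_derivative_within_cbox[of 0 1, simplified])
     (use assms in \<open>auto simp: has_real_derivative_iff_has_vector_derivative\<close>)

locale parisi = cosh_weight m for m +
  fixes P :: "'w measure" and B :: "real \<Rightarrow> 'w \<Rightarrow> real" and \<beta> q :: real and p :: nat
  assumes B: "standard_brownian_motion P B" and p: "3 \<le> p" and beta: "0 < \<beta>"
    and q: "0 < q" "q < 1"
begin

text \<open>The primes are one behind: \<open>X\<close>, \<open>X'\<close>, \<open>X''\<close> are
  the first, second and third derivatives of the mixture \<xi>.\<close>

definition X :: "real \<Rightarrow> real" where "X u = \<beta>\<^sup>2 * p * u ^ (p - 1)"
definition X' :: "real \<Rightarrow> real" where "X' u = \<beta>\<^sup>2 * p * (p - 1) * u ^ (p - 2)"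
definition X'' :: "real \<Rightarrow> real" where "X'' u = \<beta>\<^sup>2 * p * (p - 1) * (p - 2) * u ^ (p - 3)"
definition a :: real where "a = X q"
text \<open>The Gaussian mean of cosh^m at time a, which normalises the tilt so that
  \<open>exp W\<close> has mean one.\<close>

definition Z :: real where "Z = A 0 a 0"
text \<open>The factor that \<open>exp W\<close> keeps at the atom, from the weight 1 - m
  there.\<close>

definition v :: "real \<Rightarrow> real" where "v = coshpow (m - 1) 0"

abbreviation \<Gamma> :: "real \<Rightarrow> real" where "\<Gamma> \<equiv> Gamma_mu P B (mixture \<beta> p) m q"

lemma X_deriv: "(X has_real_derivative X' u) (at u within S)"
  and X'_deriv: "(X' has_real_derivative X'' u) (at u within S)"
proof -
  obtain n where n: "p = n + 3" using p by (metis le_add_diff_inverse2)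
  show "(X has_real_derivative X' u) (at u within S)" "(X' has_real_derivative X'' u) (at u within S)"
    unfolding X_def[abs_def] X'_def[abs_def] X'_def X''_def unfolding n
    by (rule DERIV_cong[OF DERIV_cmult[OF DERIV_pow]], simp add: numeral_3_eq_3)+
qed

lemma deriv_mixture: "deriv (mixture \<beta> p) = X"
proof
  fix u
  have "(mixture \<beta> p has_real_derivative X u) (at u)"
    unfolding mixture_def[abs_def] X_def by (auto intro!: derivative_eq_intros)
  then show "deriv (mixture \<beta> p) u = X u" by (rule DERIV_imp_deriv)
qed

lemma deriv_X: "deriv X = X'"
  using X_deriv by (auto intro: DERIV_imp_deriv)

lemma X_0 [simp]: "X 0 = 0" using p by (simp add: X_def)

lemma X_mono: "0 \<le> u \<Longrightarrow> u \<le> u' \<Longrightarrow> X u \<le> X u'"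
  unfolding X_def by (intro mult_left_mono power_mono) auto

lemma X_strict_mono: "0 \<le> u \<Longrightarrow> u < u' \<Longrightarrow> X u < X u'"
  unfolding X_def using beta p by (intro mult_strict_left_mono power_strict_mono) auto

lemma X_nonneg: "0 \<le> u \<Longrightarrow> 0 \<le> X u"
  using X_mono[of 0 u] by simp

lemma a_pos: "0 < a" unfolding a_def using X_strict_mono[of 0 q] q by simp

lemma Z_pos: "0 < Z" unfolding Z_def by (rule A_pos)

lemma X'_pos: "0 < u \<Longrightarrow> 0 < X' u"
  using beta p by (simp add: X'_def)

lemma u_X': "u * X' u = (real p - 1) * X u"
proof -
  obtain n where n: "p = n + 3" using p by (metis le_add_diff_inverse2)
  show ?thesis unfolding X_def X'_def unfolding n by (simp add: numeral_3_eq_3 algebra_simps)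
qed

lemma u_X'': "u * X'' u = (real p - 2) * X' u"
proof -
  obtain n where n: "p = n + 3" using p by (metis le_add_diff_inverse2)
  show ?thesis unfolding X'_def X''_def unfolding n by (simp add: numeral_3_eq_3 algebra_simps)
qed

lemma v_bound: "0 < v x" "v x \<le> 1"
  using m_less coshpow_0_pos[of "m - 1" x] powr_mono[of "m - 1" 0 "cosh x"] cosh_real_ge_1[of x]
  by (simp_all add: v_def coshpow_0)

lemma Phi_low:
  assumes u: "0 \<le> u" "u \<le> q"
  shows "Phi (mixture \<beta> p) m q x u = (X 1 - a) / 2 + ln (A 0 (a - X u) x) / m"
\<comment> \<open>At \<open>u = q\<close> the definition of \<open>Phi\<close> takes its other
  branch; the remaining time is 0 there and the formulas agree.\<close>
proof (cases "u = q")
  case True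
  then show ?thesis
    using m_pos by (simp add: Phi_def deriv_mixture a_def A_def coshpow_0 ln_powr)
next
  case False
  then have uq: "u < q" using u by simp
  define c where "c = (X 1 - a) / 2"
  have "exp (m * (ln (cosh y) + c)) = exp (m * c) * coshpow m 0 y" for y :: real
    by (simp add: coshpow_0 powr_def distrib_left exp_add mult.commute)
  then have "(\<integral>g. exp (m * (ln (cosh (x + g * sqrt (a - X u))) + c)) \<partial>std_normal_distribution)
     = exp (m * c) * A 0 (a - X u) x"
    by (simp add: A_def heat_def)
  then have "Phi (mixture \<beta> p) m q x u = 1 / m * ln (exp (m * c) * A 0 (a - X u) x)"
    using uq by (simp add: Phi_def deriv_mixture a_def[symmetric] c_def)
  also have "\<dots> = c + ln (A 0 (a - X u) x) / m"
    using m_pos A_pos[of "a - X u" x] by (simp add: ln_mult field_simps)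
  finally show ?thesis by (simp add: c_def)
qed

lemma Phi_high: "q \<le> u \<Longrightarrow> Phi (mixture \<beta> p) m q x u = ln (cosh x) + (X 1 - X u) / 2"
  by (simp add: Phi_def deriv_mixture)

lemma Gamma_low:
  assumes u: "0 \<le> u" "u \<le> q"
  shows "\<Gamma> u = R a (X u) / (m\<^sup>2 * Z)"
proof -
  interpret prob_space P using B by (simp add: standard_brownian_motion_def)
  define r where "r = a - X u"
  have r: "0 \<le> r" using X_mono[OF u] by (simp add: r_def a_def)
  have Xu: "0 \<le> X u" by (rule X_nonneg[OF u(1)])
  have d: "deriv (\<lambda>x. Phi (mixture \<beta> p) m q x u) x = rho r x / m" for x
  proof (rule DERIV_imp_deriv)
    show "((\<lambda>x. Phi (mixture \<beta> p) m q x u) has_real_derivative rho r x / m) (at x)"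
      unfolding Phi_low[OF u] r_def[symmetric]
      using A_deriv[OF r, of 0 x] A_pos[of r x] m_pos by (auto intro!: derivative_eq_intros simp: rho_def)
  qed
  define F where "F x = (rho r x / m)\<^sup>2 * (A 0 r x / Z)" for x
  have meas [measurable]: "B u \<in> borel_measurable P" if "0 \<le> u" for u
    using B that by (simp add: standard_brownian_motion_def)
  have B0: "AE \<omega> in P. B 0 \<omega> = 0" using B by (simp add: standard_brownian_motion_def)
  \<comment> \<open>At \<open>u = q\<close> the second atom is already counted, but contributes the
    difference of two equal values.\<close>
  have W: "W_fun (Phi (mixture \<beta> p) m q) (two_atoms m q) (\<lambda>u. B (X u)) u \<omega>
      = ln (A 0 r (B (X u) \<omega>)) - ln (A 0 a (B 0 \<omega>))" for \<omega>
    using u q m_pos m_less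
    by (subst W_two_atoms) (auto simp: Phi_low r_def right_diff_distrib distrib_left)
  have "\<Gamma> u = expectation (\<lambda>\<omega>. F (B (X u) \<omega>))"
    unfolding Gamma_mu_def Gamma_fun_def deriv_mixture W d
  proof (rule integral_cong_AE)
    have [measurable]: "B (X u) \<in> borel_measurable P" "B 0 \<in> borel_measurable P"
      by (auto intro: meas Xu)
    show "(\<lambda>\<omega>. F (B (X u) \<omega>)) \<in> borel_measurable P" unfolding F_def by measurable
    show "(\<lambda>\<omega>. (rho r (B (X u) \<omega>) / m)\<^sup>2 * exp (ln (A 0 r (B (X u) \<omega>)) - ln (A 0 a (B 0 \<omega>)))) \<in> borel_measurable P"
      by measurable
    have "(rho r (B (X u) \<omega>) / m)\<^sup>2 * exp (ln (A 0 r (B (X u) \<omega>)) - ln (A 0 a (B 0 \<omega>))) = F (B (X u) \<omega>)"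
      if "B 0 \<omega> = 0" for \<omega>
      using A_pos[of r "B (X u) \<omega>"] A_pos[of a 0] by (simp add: that F_def exp_diff Z_def)
    then show "AE \<omega> in P. (rho r (B (X u) \<omega>) / m)\<^sup>2 * exp (ln (A 0 r (B (X u) \<omega>)) - ln (A 0 a (B 0 \<omega>))) = F (B (X u) \<omega>)"
      using B0 by (auto elim: AE_mp)
  qed
  also have "\<dots> = heat (X u) F 0"
    by (rule brownian_expectation_1[OF B Xu]) (simp add: F_def)
  also have "F = (\<lambda>x. (1 / (m\<^sup>2 * Z)) * (A 0 r x * (rho r x)\<^sup>2))"
    by (simp add: F_def fun_eq_iff power_divide)
  also have "heat (X u) \<dots> 0 = R a (X u) / (m\<^sup>2 * Z)"
    unfolding heat_cmult by (simp add: R_def r_def)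
  finally show ?thesis .
qed

text \<open>Above the atom \<open>exp W\<close> is proportional to
  \<open>v (B a) * cosh (B (X u))\<close>, and tanh^2 cosh = cosh - 1 / cosh. The average of cosh is
  explicit and cancels against the normalisation to give 1; only the negative power remains.\<close>

lemma Gamma_high:
  assumes u: "q \<le> u"
  shows "\<Gamma> u = 1 - exp (- ((X u - a) / 2)) * two_step a v (coshpow (-1) 0) (X u - a) / Z"
proof -
  interpret prob_space P using B by (simp add: standard_brownian_motion_def)
  have u0: "0 \<le> u" using u q by simp
  define s where "s = X u - a"
  have s: "0 \<le> s" using X_mono[OF _ u] q by (simp add: s_def a_def)
  have Xu: "0 \<le> X u" by (rule X_nonneg[OF u0])
  have d: "deriv (\<lambda>x. Phi (mixture \<beta> p) m q x u) x = tanh x" for x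
  proof (rule DERIV_imp_deriv)
    show "((\<lambda>x. Phi (mixture \<beta> p) m q x u) has_real_derivative tanh x) (at x)"
      unfolding Phi_high[OF u] by (auto intro!: derivative_eq_intros simp: tanh_def)
  qed
  define c where "c = (X 1 - a) / 2"
  define g where "g y = cosh y - coshpow (-1) 0 y" for y :: real
  define k where "k = exp (- (s / 2)) / Z"
  have [measurable]: "(cosh :: real \<Rightarrow> real) \<in> borel_measurable borel" "(tanh :: real \<Rightarrow> real) \<in> borel_measurable borel"
    by (intro borel_measurable_continuous_onI continuous_intros; simp)+
  have meas: "B u \<in> borel_measurable P" if "0 \<le> u" for u
    using B that by (simp add: standard_brownian_motion_def)
  have B0: "AE \<omega> in P. B 0 \<omega> = 0" using B by (simp add: standard_brownian_motion_def)
  define w where "w \<omega> = ln (cosh (B (X u) \<omega>)) - (1 - m) * ln (cosh (B a \<omega>)) - s / 2 - ln (A 0 a (B 0 \<omega>))" for \<omega>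
  have W: "W_fun (Phi (mixture \<beta> p) m q) (two_atoms m q) (\<lambda>u. B (X u)) u \<omega> = w \<omega>" for \<omega>
    using u u0 q m_pos m_less
    by (subst W_two_atoms) (auto simp: Phi_low[of 0] Phi_high a_def[symmetric] w_def s_def field_simps)
  have "\<Gamma> u = expectation (\<lambda>\<omega>. k * (v (B a \<omega>) * g (B (X u) \<omega>)))"
    unfolding Gamma_mu_def Gamma_fun_def deriv_mixture W d
  proof (rule integral_cong_AE)
    have [measurable]: "B (X u) \<in> borel_measurable P" "B 0 \<in> borel_measurable P" "B a \<in> borel_measurable P"
      using a_pos by (auto intro: meas Xu)
    show "(\<lambda>\<omega>. k * (v (B a \<omega>) * g (B (X u) \<omega>))) \<in> borel_measurable P"
      unfolding g_def v_def by measurable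
    show "(\<lambda>\<omega>. (tanh (B (X u) \<omega>))\<^sup>2 * exp (w \<omega>)) \<in> borel_measurable P"
      unfolding w_def by measurable
    have "(tanh (B (X u) \<omega>))\<^sup>2 * exp (w \<omega>) = k * (v (B a \<omega>) * g (B (X u) \<omega>))"
      if "B 0 \<omega> = 0" for \<omega>
    proof -
      define x y where "x = B a \<omega>" and "y = B (X u) \<omega>"
      have e1: "exp ((1 - m) * ln (cosh x)) = 1 / v x"
      proof -
        have "exp ((1 - m) * ln (cosh x)) = cosh x powr (- (m - 1))" by (simp add: powr_def)
        also have "\<dots> = 1 / v x" unfolding powr_minus_divide by (simp add: v_def coshpow_0)
        finally show ?thesis .
      qed
      have e: "exp (w \<omega>) = cosh y * v x * k"
      proof -
        have "exp (w \<omega>) = exp (ln (cosh y)) / exp ((1 - m) * ln (cosh x)) / exp (s / 2) / exp (ln (A 0 a 0))"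
          unfolding w_def that x_def y_def by (simp only: exp_diff)
        then show ?thesis
          unfolding e1 exp_ln[OF A_pos] exp_ln[OF cosh_real_pos] by (simp add: Z_def k_def exp_minus field_simps)
      qed
      have "(tanh y)\<^sup>2 * cosh y = (sinh y)\<^sup>2 / cosh y"
        by (simp add: tanh_def power_divide power2_eq_square)
      also have "\<dots> = ((cosh y)\<^sup>2 - 1) / cosh y" by (simp add: cosh_square_eq)
      also have "((cosh y)\<^sup>2 - 1) / cosh y = g y"
        by (simp add: g_def coshpow_0 powr_minus_divide diff_divide_distrib power2_eq_square)
      finally have t: "(tanh y)\<^sup>2 * cosh y = g y" .
      show ?thesis unfolding e x_def[symmetric] y_def[symmetric] t[symmetric] by simp
    qed
    then show "AE \<omega> in P. (tanh (B (X u) \<omega>))\<^sup>2 * exp (w \<omega>) = k * (v (B a \<omega>) * g (B (X u) \<omega>))"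
      using B0 by (auto elim: AE_mp)
  qed
  also have "\<dots> = k * heat a (\<lambda>x. v x * heat s g x) 0"
  proof -
    have v1: "\<bar>v x\<bar> \<le> 1" for x
      using v_bound[of x] by simp
    have "tame g" unfolding g_def by (intro tame_diff tame_cosh tame_coshpow) simp
    then have "expectation (\<lambda>\<omega>. v (B a \<omega>) * g (B (X u) \<omega>)) = heat a (\<lambda>x. v x * heat (X u - a) g x) 0"
      using a_pos s v1 by (intro brownian_expectation_2[OF B]) (auto simp: s_def v_def)
    then show ?thesis by (simp add: s_def)
  qed
  also have "(\<lambda>x. v x * heat s g x) = (\<lambda>x. exp (s / 2) * coshpow m 0 x - v x * heat s (coshpow (-1) 0) x)"
  proof
    fix x
    have h: "heat s g x = exp (s / 2) * cosh x - heat s (coshpow (-1) 0) x"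
      unfolding g_def[abs_def] using s by (simp add: heat_diff tame_cosh tame_coshpow heat_cosh)
    have vc: "coshpow m 0 x = v x * cosh x"
      by (simp add: v_def coshpow_0 powr_diff)
    show "v x * heat s g x = exp (s / 2) * coshpow m 0 x - v x * heat s (coshpow (-1) 0) x"
      unfolding h vc by (simp add: algebra_simps)
  qed
  also have "heat a \<dots> 0 = exp (s / 2) * Z - two_step a v (coshpow (-1) 0) s"
  proof -
    have v1: "\<bar>v x\<bar> \<le> 1" for x
      using v_bound[of x] by simp
    have "tame (\<lambda>x. v x * heat s (coshpow (-1) 0) x)"
      by (rule tame_bounded_mult[OF tame_heat[OF tame_coshpow s] _ v1]) (auto simp: v_def)
    then show ?thesis
      by (simp add: heat_diff heat_cmult tame_cmult tame_cw Z_def A_def two_step_def)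
  qed
  also have "k * (exp (s / 2) * Z - two_step a v (coshpow (-1) 0) s)
      = 1 - exp (- (s / 2)) * two_step a v (coshpow (-1) 0) s / Z"
    using Z_pos by (simp add: k_def right_diff_distrib exp_minus)
  finally show ?thesis by (simp add: s_def)
qed

section \<open>The profile of \<Gamma> above the atom\<close>

abbreviation "H e \<equiv> two_step a v (coshpow e 0)"

lemma smooth_pair: "e \<le> 0 \<Longrightarrow> smooth_pair a v (coshpow e)"
proof
  assume e: "e \<le> 0"
  fix k
  obtain C where C: "C > 0" "\<And>x. \<bar>coshpow e k x\<bar> \<le> C * coshpow e 0 x" using coshpow_bound[of e k] by blast
  have "coshpow e 0 x \<le> 1" for x
    using e powr_mono[of e 0 "cosh x"] cosh_real_ge_1[of x] by (simp add: coshpow_0)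
  then have "\<bar>coshpow e k x\<bar> \<le> C * 1" for x
    using C by (intro order.trans[OF C(2)] mult_left_mono) auto
  then show "\<exists>C. \<forall>x. \<bar>coshpow e k x\<bar> \<le> C" by blast
next
  assume "e \<le> 0" then show "tame_tower (coshpow e)" by (intro tame_tower_coshpow) simp
qed (use a_pos v_bound in \<open>auto simp: less_imp_le abs_of_pos v_def[symmetric]\<close>, simp add: v_def)

text \<open>The second derivative of 1 / cosh is 1 / cosh - 2 / cosh^3. The term
  \<open>H (-1) s / 2\<close> is later cancelled by differentiating the factor exp(- s / 2) in
  \<open>G\<close>, so that \<open>G'\<close> contains \<open>H (-3)\<close> alone.\<close>

lemma H1_deriv: "0 \<le> s \<Longrightarrow> (H (-1) has_real_derivative H (-1) s / 2 - H (-3) s) (at s within {0..})"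
proof -
  assume s: "0 \<le> s"
  interpret S: smooth_pair a v "coshpow (-1)" by (rule smooth_pair) simp
  interpret T: smooth_pair a v "coshpow (-3)" by (rule smooth_pair) simp
  have eq: "coshpow (-1) (0 + 2) = (\<lambda>x. coshpow (-1) 0 x - 2 * coshpow (-3) 0 x)"
  proof
    fix x :: real
    have "coshpow (-1) 2 x = (2 * (tanh x)\<^sup>2 - 1) * cosh x powr -1"
      by (simp add: numeral_2_eq_2 coshpow_2)
    also have "(tanh x)\<^sup>2 = 1 - 1 / (cosh x)\<^sup>2"
      by (rule tanh_square_real)
    finally show "coshpow (-1) (0 + 2) x = coshpow (-1) 0 x - 2 * coshpow (-3) 0 x"
      by (simp add: coshpow_0 powr_minus_divide powr_numeral field_simps power2_eq_square power3_eq_cube numeral_2_eq_2)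
  qed
  have t1: "tame (coshpow (-1) 0)" "tame (coshpow (-3) 0)" by (auto intro: tame_coshpow)
  have hs: "heat s (coshpow (-1) (0 + 2)) x = heat s (coshpow (-1) 0) x - 2 * heat s (coshpow (-3) 0) x" for x
    unfolding eq by (simp only: heat_diff heat_cmult tame_cmult t1)
  have e2: "(\<lambda>x. v x * heat s (coshpow (-1) (0 + 2)) x) = (\<lambda>x. v x * heat s (coshpow (-1) 0) x - 2 * (v x * heat s (coshpow (-3) 0) x))"
    unfolding hs by (simp add: fun_eq_iff algebra_simps)
  have "two_step a v (coshpow (-1) (0 + 2)) s = H (-1) s - 2 * H (-3) s"
    unfolding two_step_def e2 using S.tame_v_heat[OF s, of 0] T.tame_v_heat[OF s, of 0]
    by (simp only: heat_diff heat_cmult tame_cmult)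
  then show ?thesis using S.two_step_deriv[OF s, of 0] by (simp add: diff_divide_distrib)
qed

definition Q' :: "real \<Rightarrow> real" where "Q' s = two_step a v (coshpow (-3) 2) s / 2"

lemma H3_deriv: "0 \<le> s \<Longrightarrow> (H (-3) has_real_derivative Q' s) (at s within {0..})"
proof -
  interpret T: smooth_pair a v "coshpow (-3)" by (rule smooth_pair) simp
  show "0 \<le> s \<Longrightarrow> (H (-3) has_real_derivative Q' s) (at s within {0..})"
    using T.two_step_deriv[of s 0] by (simp add: Q'_def numeral_2_eq_2)
qed

lemma H3_antimono: "0 \<le> s \<Longrightarrow> s \<le> s' \<Longrightarrow> H (-3) s' \<le> H (-3) s"
proof (rule two_step_antimono[where C = 1])
  have "coshpow (-3) 0 x \<le> 1" for x
    using powr_mono[of "-3" 0 "cosh x"] cosh_real_ge_1[of x] by (simp add: coshpow_0)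
  then show "\<bar>coshpow (-3) 0 x\<bar> \<le> 1" for x using coshpow_0_pos[of "-3" x] by simp
qed (use a_pos v_bound m_less in \<open>auto simp: less_imp_le v_def symmetric_decreasing_coshpow\<close>)

text \<open>At s > 0 the derivative of \<open>H (-3)\<close> is two-sided, and a positive value
  would contradict \<open>H3_antimono\<close>.\<close>

lemma Q'_nonpos: assumes s: "0 < s" shows "Q' s \<le> 0"
proof (rule ccontr)
  assume "\<not> Q' s \<le> 0"
  moreover have "at s within {0..} = at s within UNIV"
    by (rule at_within_nhd[of s "{0<..}"]) (use s in auto)
  then have "(H (-3) has_real_derivative Q' s) (at s)" using H3_deriv[of s] s by simp
  ultimately obtain d where d: "0 < d" "\<And>h. 0 < h \<Longrightarrow> h < d \<Longrightarrow> H (-3) s < H (-3) (s + h)"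
    using DERIV_pos_inc_right[of "H (-3)" "Q' s" s] by auto
  show False using d(2)[of "d / 2"] d(1) H3_antimono[of s "s + d / 2"] s by auto
qed

lemma H3_pos: assumes "0 \<le> s" shows "0 < H (-3) s"
proof -
  interpret T: smooth_pair a v "coshpow (-3)" by (rule smooth_pair) simp
  show ?thesis
    unfolding two_step_def
    by (intro heat_pos T.tame_v_heat[OF assms, of 0] mult_pos_pos v_bound tame_coshpow coshpow_0_pos) simp
qed

text \<open>\<open>G\<close> and its first two derivatives describe \<Gamma> for u \<ge> q in the
  clock t = \<xi>'(u) \<ge> a.\<close>

definition G :: "real \<Rightarrow> real" where "G t = 1 - exp (- ((t - a) / 2)) * H (-1) (t - a) / Z"
definition G' :: "real \<Rightarrow> real" where "G' t = exp (- ((t - a) / 2)) * H (-3) (t - a) / Z"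
definition G'' :: "real \<Rightarrow> real" where
  "G'' t = exp (- ((t - a) / 2)) * (Q' (t - a) - H (-3) (t - a) / 2) / Z"

lemma shift_deriv:
  assumes f: "(f has_real_derivative D) (at (t - a) within {0..})"
  shows "((\<lambda>t. f (t - a)) has_real_derivative D) (at t within {a..})"
proof -
  have "(\<lambda>t. t - a) ` {a..} \<subseteq> {0..}" by auto
  then have "(f has_real_derivative D) (at (t - a) within (\<lambda>t. t - a) ` {a..})"
    using f by (rule DERIV_subset[rotated])
  then have "((f \<circ> (\<lambda>t. t - a)) has_real_derivative D * 1) (at t within {a..})"
    by (rule DERIV_image_chain) (auto intro!: derivative_eq_intros)
  then show ?thesis by (simp add: comp_def)
qed

lemma G_deriv: "a \<le> t \<Longrightarrow> (G has_real_derivative G' t) (at t within {a..})"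
proof -
  assume t: "a \<le> t"
  have h: "((\<lambda>t. H (-1) (t - a)) has_real_derivative H (-1) (t - a) / 2 - H (-3) (t - a)) (at t within {a..})"
    using t by (intro shift_deriv H1_deriv) simp
  have e: "((\<lambda>t. exp (- ((t - a) / 2))) has_real_derivative - exp (- ((t - a) / 2)) / 2) (at t within {a..})"
    by (auto intro!: derivative_eq_intros)
  show "(G has_real_derivative G' t) (at t within {a..})"
    unfolding G_def[abs_def]
    by (rule DERIV_cong[OF DERIV_diff[OF DERIV_const DERIV_cdivide[OF DERIV_mult[OF e h]]]])
       (use Z_pos in \<open>simp add: G'_def field_simps\<close>)
qed

lemma G'_deriv: "a \<le> t \<Longrightarrow> (G' has_real_derivative G'' t) (at t within {a..})"
proof -
  assume t: "a \<le> t"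
  have h: "((\<lambda>t. H (-3) (t - a)) has_real_derivative Q' (t - a)) (at t within {a..})"
    using t by (intro shift_deriv H3_deriv) simp
  have e: "((\<lambda>t. exp (- ((t - a) / 2))) has_real_derivative - exp (- ((t - a) / 2)) / 2) (at t within {a..})"
    by (auto intro!: derivative_eq_intros)
  show "(G' has_real_derivative G'' t) (at t within {a..})"
    unfolding G'_def[abs_def]
    by (rule DERIV_cong[OF DERIV_cdivide[OF DERIV_mult[OF e h]]])
       (use Z_pos in \<open>simp add: G''_def field_simps\<close>)
qed

lemma G'_pos: "a \<le> t \<Longrightarrow> 0 < G' t"
  unfolding G'_def using Z_pos H3_pos[of "t - a"] by simp

lemma G''_le: "a < t \<Longrightarrow> G'' t \<le> - (G' t / 2)"
proof -
  assume t: "a < t"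
  have "exp (- ((t - a) / 2)) * Q' (t - a) / Z \<le> 0"
    using Z_pos Q'_nonpos[of "t - a"] t by (simp add: divide_nonpos_pos mult_nonneg_nonpos)
  then show ?thesis by (simp add: G''_def G'_def right_diff_distrib diff_divide_distrib)
qed

lemma Gamma_G: "q \<le> u \<Longrightarrow> \<Gamma> u = G (X u)"
  by (simp add: Gamma_high G_def)

section \<open>The profile below the atom and the junction at \<open>q\<close>\<close>

definition k :: "real \<Rightarrow> real" where "k s = R a s / (m\<^sup>2 * Z)"

lemma Gamma_k: "0 \<le> u \<Longrightarrow> u \<le> q \<Longrightarrow> \<Gamma> u = k (X u)"
  by (simp add: Gamma_low k_def)

text \<open>cosh^(m-1) cosh^(-3) = cosh^(m-4), so the slope of \<open>k\<close> from the left and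
  that of \<open>G\<close> from the right agree at a. Hence \<Gamma> is differentiable at q, and the
  hypothesis on \<Gamma>'(q) becomes a bound for the right branch.\<close>

lemma L_end_G': "L a a / (m\<^sup>2 * Z) = G' a"
proof -
  have "v x * coshpow (-3) 0 x = coshpow (m - 4) 0 x" for x
    by (simp add: v_def coshpow_0 flip: powr_add)
  then show ?thesis using m_pos by (simp add: L_end G'_def two_step_def)
qed

lemma X_image: "0 \<le> c \<Longrightarrow> X ` {c..d} \<subseteq> {X c..X d}"
  by (auto intro!: X_mono elim: order.trans)

lemma a_le_X: "q \<le> u \<Longrightarrow> a \<le> X u"
  unfolding a_def using q by (intro X_mono) auto

lemma Gamma_deriv:
  assumes u: "q \<le> u" "u \<le> 1"
  shows "(\<Gamma> has_real_derivative G' (X u) * X' u) (at u within {0..1})"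
proof -
  have right: "(\<Gamma> has_real_derivative G' (X u) * X' u) (at u within {q..1})"
  proof -
    have "X ` {q..1} \<subseteq> {a..}" using X_mono q by (auto simp: a_def)
    then have "(G has_real_derivative G' (X u)) (at (X u) within X ` {q..1})"
      using u by (intro DERIV_subset[OF G_deriv] a_le_X) auto
    then have "((G \<circ> X) has_real_derivative G' (X u) * X' u) (at u within {q..1})"
      by (rule DERIV_image_chain) (rule X_deriv)
    then show ?thesis
      using u by (auto intro: has_field_derivative_transform_within[where d = 1] simp: Gamma_G)
  qed
  show ?thesis
  proof (cases "u = q")
    case False
    then have "at u within {0..1} = at u within {q..1}"
      using u q by (intro at_within_nhd[of u "{q<..}"]) auto
    then show ?thesis using right by simp
  next
    case True
    have "(R a has_real_derivative L a a) (at (X u) within {0..a})"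
      using R_left_deriv[of a a] by (simp add: a_def True)
    then have "(k has_real_derivative G' (X u)) (at (X u) within {0..a})"
      unfolding k_def[abs_def] True a_def[symmetric] L_end_G'[symmetric] by (rule DERIV_cdivide)
    then have "(k has_real_derivative G' (X u)) (at (X u) within X ` {0..q})"
      by (rule DERIV_subset) (use X_image[of 0 q] in \<open>auto simp: a_def\<close>)
    then have "((k \<circ> X) has_real_derivative G' (X u) * X' u) (at u within {0..q})"
      by (rule DERIV_image_chain) (rule X_deriv)
    then have "(\<Gamma> has_real_derivative G' (X u) * X' u) (at u within {0..q})"
      using u True q by (auto intro: has_field_derivative_transform_within[where d = 1] simp: Gamma_k)
    then have "(\<Gamma> has_real_derivative G' (X u) * X' u) (at u within {0..q} \<union> {q..1})"
      using right by (rule has_derivative_glue)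
    moreover have "{0..q} \<union> {q..1} = {0..1}" using q by auto
    ultimately show ?thesis by simp
  qed
qed

lemma deriv01_Gamma: "q \<le> u \<Longrightarrow> u \<le> 1 \<Longrightarrow> deriv01 \<Gamma> u = G' (X u) * X' u"
  using Gamma_deriv q by (intro deriv01_eq) auto

definition D2 :: "real \<Rightarrow> real" where "D2 u = G'' (X u) * X' u * X' u + G' (X u) * X'' u"

lemma GX'_deriv:
  assumes u: "q \<le> u" "u \<le> 1"
  shows "((\<lambda>u. G' (X u) * X' u) has_real_derivative D2 u) (at u within {q..1})"
proof -
  have "X ` {q..1} \<subseteq> {a..}" using X_mono q by (auto simp: a_def)
  then have "(G' has_real_derivative G'' (X u)) (at (X u) within X ` {q..1})"
    using u by (intro DERIV_subset[OF G'_deriv] a_le_X) auto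
  then have "((G' \<circ> X) has_real_derivative G'' (X u) * X' u) (at u within {q..1})"
    by (rule DERIV_image_chain) (rule X_deriv)
  then have "((\<lambda>u. G' (X u)) has_real_derivative G'' (X u) * X' u) (at u within {q..1})"
    by (simp add: comp_def)
  from DERIV_mult[OF this X'_deriv] show ?thesis
    by (simp add: D2_def algebra_simps)
qed

text \<open>The formula for \<open>deriv01 \<Gamma>\<close> is known only from q onwards. For u > q
  a whole neighbourhood within [0, 1] lies in that range, so the derivative relative to
  \<open>{q..1}\<close> is the derivative relative to \<open>{0..1}\<close>.\<close>

lemma deriv01_Gamma_deriv:
  assumes u: "q < u" "u \<le> 1"
  shows "(deriv01 \<Gamma> has_real_derivative D2 u) (at u within {0..1})"
proof -
  have "(deriv01 \<Gamma> has_real_derivative D2 u) (at u within {q..1})"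
    using GX'_deriv[of u] u by (auto intro: has_field_derivative_transform_within[where d = 1] simp: deriv01_Gamma)
  moreover have "at u within {0..1} = at u within {q..1}"
    using u q by (intro at_within_nhd[of u "{q<..}"]) auto
  ultimately show ?thesis by simp
qed

text \<open>Multiplication by u turns \<open>X'\<close> and \<open>X''\<close> into (p - 1) X and (p
  - 2) X'. With \<open>G'' \<le> - G' / 2\<close> and \<open>G' > 0\<close> the claim reduces to p -
  2 < (p - 1) X u / 2; strictness comes from X u > a.\<close>

lemma D2_neg:
  assumes thr: "2 * (real p - 2) \<le> (real p - 1) * a" and u: "q < u" "u \<le> 1"
  shows "D2 u < 0"
proof -
  have au: "a < X u" using X_strict_mono[of q u] q u by (simp add: a_def)
  have u0: "0 < u" using u q by simp
  have "u * D2 u = G'' (X u) * X' u * (u * X' u) + G' (X u) * (u * X'' u)"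
    by (simp add: D2_def algebra_simps)
  also have "\<dots> = X' u * (G'' (X u) * ((real p - 1) * X u) + G' (X u) * (real p - 2))"
    by (simp add: u_X' u_X'' algebra_simps)
  also have "\<dots> < X' u * 0"
  proof (rule mult_strict_left_mono)
    have "G'' (X u) * ((real p - 1) * X u) \<le> - (G' (X u) / 2) * ((real p - 1) * X u)"
      using G''_le[OF au] p au a_pos by (intro mult_right_mono) auto
    also have "\<dots> < - (G' (X u) / 2) * ((real p - 1) * a)"
      using G'_pos[of "X u"] au p by (intro mult_strict_left_mono_neg mult_strict_left_mono) auto
    also have "\<dots> \<le> - (G' (X u) / 2) * (2 * (real p - 2))"
      using G'_pos[of "X u"] au thr by (intro mult_left_mono_neg) auto
    also have "\<dots> = - (G' (X u) * (real p - 2))" by (simp add: field_simps)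
    finally show "G'' (X u) * ((real p - 1) * X u) + G' (X u) * (real p - 2) < 0" by linarith
  qed (rule X'_pos[OF u0])
  finally show ?thesis using u0 by (simp add: mult_less_0_iff)
qed

section \<open>The constraint f(q) = 0 and the conclusions\<close>

lemma k_continuous: "continuous_on {0..a} k"
  unfolding k_def[abs_def] using m_pos Z_pos by (intro continuous_intros R_continuous) auto

lemma X_continuous: "continuous_on S X"
  by (rule DERIV_continuous_on[OF X_deriv])

lemma X'_continuous: "continuous_on S X'"
  by (rule DERIV_continuous_on[OF X'_deriv])

lemma Gamma_continuous: "continuous_on {0..1} \<Gamma>"
proof -
  have "continuous_on {0..q} (\<lambda>u. k (X u))"
    using X_image[of 0 q] by (intro continuous_on_compose2[OF k_continuous X_continuous]) (auto simp: a_def)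
  then have 1: "continuous_on {0..q} \<Gamma>" by (subst continuous_on_cong[OF refl Gamma_k]) auto
  have 2: "continuous_on {q..1} \<Gamma>"
    by (rule DERIV_continuous_on[OF DERIV_subset[OF Gamma_deriv]]) (use q in auto)
  have "continuous_on ({0..q} \<union> {q..1}) \<Gamma>" by (intro continuous_on_closed_Un 1 2) auto
  moreover have "{0..q} \<union> {q..1} = {0..1}" using q by auto
  ultimately show ?thesis by simp
qed

text \<open>The substitution t = \<xi>'(u), through a primitive of \<open>k\<close> composed with
  \<open>X\<close>.\<close>

lemma integral_k_X:
  "((\<lambda>u. X' u * k (X u)) has_integral integral {0..a} k) {0..q}"
proof -
  define F where "F s = integral {0..s} k" for s
  have "(F has_real_derivative k s) (at s within {0..a})" if "s \<in> {0..a}" for s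
    unfolding F_def has_real_derivative_iff_has_vector_derivative
    by (rule integral_has_vector_derivative[OF k_continuous that])
  then have "(F has_real_derivative k (X u)) (at (X u) within X ` {0..q})" if "u \<in> {0..q}" for u
    by (rule DERIV_subset) (use that X_image[of 0 q] X_mono[of u q] X_nonneg[of u] in \<open>auto simp: a_def\<close>)
  then have "((F \<circ> X) has_real_derivative k (X u) * X' u) (at u within {0..q})" if "u \<in> {0..q}" for u
    using that by (intro DERIV_image_chain X_deriv) auto
  then have "((\<lambda>u. k (X u) * X' u) has_integral (F \<circ> X) q - (F \<circ> X) 0) {0..q}"
    using q by (intro fundamental_theorem_of_calculus) (auto simp: has_real_derivative_iff_has_vector_derivative comp_def)
  then show ?thesis by (simp add: F_def a_def mult.commute)
qed

text \<open>By homogeneity \<open>u * X' = (p - 1) X\<close>, so the derivative of u X is p / (p -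
  1) times u X'.\<close>

lemma integral_u_X':
  "((\<lambda>u. X' u * u) has_integral q * a * (real p - 1) / p) {0..q}"
proof -
  have "((\<lambda>u. (real p - 1) / p * (u * X u)) has_real_derivative X' u * u) (at u within {0..q})" for u
  proof -
    have "((\<lambda>u. (real p - 1) / p * (u * X u)) has_real_derivative (real p - 1) / p * (X u + u * X' u)) (at u within {0..q})"
      by (rule DERIV_cmult[OF DERIV_cong[OF DERIV_mult[OF DERIV_ident X_deriv]]]) simp
    moreover have "(real p - 1) / p * (X u + u * X' u) = X' u * u"
    proof -
      have "(real p - 1) * (X u + u * X' u) = real p * (u * X' u)"
        unfolding u_X' by (simp add: algebra_simps)
      then show ?thesis using p by (simp add: field_simps)
    qed
    ultimately show ?thesis by simp
  qed
  then have "((\<lambda>u. X' u * u) has_integral (real p - 1) / p * (q * X q) - (real p - 1) / p * (0 * X 0)) {0..q}"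
    using q by (intro fundamental_theorem_of_calculus) (auto simp: has_real_derivative_iff_has_vector_derivative)
  then show ?thesis by (simp add: a_def mult_ac)
qed

lemma f_mu_eq: "f_mu P B (mixture \<beta> p) m q u = 1 / 2 * integral {0..u} (\<lambda>t. X' t * (\<Gamma> t - t))"
  by (simp add: f_mu_def f_fun_def deriv_mixture deriv_X)

text \<open>f(q) = 0 says that \<Gamma> and the identity have the same integral against \<xi>'' over
  [0, q]. In the clock \<xi>' the first becomes the integral of \<open>k\<close> over [0, a]; the
  second is explicit, and \<open>k a = q\<close> turns it into the mean required by
  \<open>threshold\<close>.\<close>

lemma threshold_a:
  assumes f: "f_mu P B (mixture \<beta> p) m q q = 0" and G: "\<Gamma> q = q"
  shows "2 * (real p - 2) \<le> (real p - 1) * a"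
proof (rule threshold[OF a_pos k_continuous])
  have c: "0 < m\<^sup>2 * Z" using m_pos Z_pos by simp
  show "(k has_real_derivative L a s / (m\<^sup>2 * Z)) (at s)" if "0 < s" "s < a" for s
    unfolding k_def[abs_def] using that by (intro DERIV_cdivide R_deriv)
  show "L a s / (m\<^sup>2 * Z) + 2 * k s \<le> L a s' / (m\<^sup>2 * Z) + 2 * k s'" if "0 \<le> s" "s \<le> s'" "s' \<le> a" for s s'
    using divide_right_mono[OF L_plus_2R_mono[OF that], of "m\<^sup>2 * Z"] c
    by (simp add: k_def add_divide_distrib)
  show "k 0 = 0" by (simp add: k_def R_0)
  have kq: "k a = q" using Gamma_k[of q] q G by (simp add: a_def)
  then show "0 < k a" using q by simp
  have "((\<lambda>u. X' u * k (X u) - X' u * u) has_integral integral {0..a} k - q * a * (real p - 1) / p) {0..q}"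
    by (intro has_integral_diff integral_k_X integral_u_X')
  then have "((\<lambda>u. X' u * (\<Gamma> u - u)) has_integral integral {0..a} k - q * a * (real p - 1) / p) {0..q}"
    by (rule has_integral_eq[rotated]) (simp add: Gamma_k algebra_simps)
  then have "integral {0..a} k - q * a * (real p - 1) / p = 0"
    using f by (simp add: f_mu_eq integral_unique)
  then show "integral {0..a} k = k a * a * (real p - 1) / real p" by (simp add: kq)
qed (use p in simp)

text \<open>The slope of \<Gamma> is at most 1 at q and strictly decreases afterwards, so \<Gamma> u
  - u falls strictly from its value 0 at q.\<close>

lemma Gamma_less:
  assumes thr: "2 * (real p - 2) \<le> (real p - 1) * a" and G: "\<Gamma> q = q" and d: "deriv01 \<Gamma> q \<le> 1"
    and u: "q < u" "u \<le> 1"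
  shows "\<Gamma> u < u"
proof -
  have int: "at x within {q..1} = at x" "at x within {0..1} = at x" if "q < x" "x < u" for x
    using that u q by (auto intro!: at_within_Icc_at)
  have d1: "G' (X x) * X' x < 1" if x: "q < x" "x \<le> u" for x
  proof -
    have "G' (X x) * X' x < G' (X q) * X' q"
    proof (rule DERIV_neg_imp_decreasing_open[OF x(1), of "\<lambda>x. G' (X x) * X' x"])
      show "continuous_on {q..x} (\<lambda>x. G' (X x) * X' x)"
        by (rule continuous_on_subset[OF DERIV_continuous_on[OF GX'_deriv]]) (use x u in auto)
      fix y assume y: "q < y" "y < x"
      then have "((\<lambda>x. G' (X x) * X' x) has_real_derivative D2 y) (at y)"
        using GX'_deriv[of y] int(1)[of y] x u by auto
      then show "\<exists>D. ((\<lambda>x. G' (X x) * X' x) has_real_derivative D) (at y) \<and> D < 0"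
        using D2_neg[OF thr, of y] y x u by auto
    qed
    then show ?thesis using d deriv01_Gamma[of q] q by simp
  qed
  have "\<Gamma> u - u < \<Gamma> q - q"
  proof (rule DERIV_neg_imp_decreasing_open[OF u(1), of "\<lambda>u. \<Gamma> u - u"])
    show "continuous_on {q..u} (\<lambda>u. \<Gamma> u - u)"
      by (intro continuous_intros continuous_on_subset[OF Gamma_continuous]) (use u q in auto)
    fix x assume x: "q < x" "x < u"
    have "(\<Gamma> has_real_derivative G' (X x) * X' x) (at x)"
      using Gamma_deriv[of x] int(2)[OF x] x u by auto
    then have "((\<lambda>u. \<Gamma> u - u) has_real_derivative G' (X x) * X' x - 1) (at x)"
      by (auto intro!: derivative_eq_intros)
    then show "\<exists>D. ((\<lambda>u. \<Gamma> u - u) has_real_derivative D) (at x) \<and> D < 0"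
      using d1[of x] x by auto
  qed
  then show ?thesis using G by simp
qed

text \<open>The integrand \<xi>''(t) (\<Gamma>(t) - t) is negative beyond q, so the integral drops
  strictly below its value 0 at q.\<close>

lemma f_mu_neg:
  assumes f: "f_mu P B (mixture \<beta> p) m q q = 0" and less: "\<And>u. q < u \<Longrightarrow> u \<le> 1 \<Longrightarrow> \<Gamma> u < u"
    and u: "q < u" "u \<le> 1"
  shows "f_mu P B (mixture \<beta> p) m q u < 0"
proof -
  let ?h = "\<lambda>t. X' t * (\<Gamma> t - t)"
  have cont: "continuous_on {0..1} ?h" by (intro continuous_intros X'_continuous Gamma_continuous)
  have "integral {0..u} ?h < integral {0..q} ?h"
  proof (rule DERIV_neg_imp_decreasing_open[OF u(1), of "\<lambda>u. integral {0..u} ?h"])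
    show "continuous_on {q..u} (\<lambda>u. integral {0..u} ?h)"
      by (rule continuous_on_subset[OF indefinite_integral_continuous_1[OF integrable_continuous_interval[OF cont]]])
         (use u q in auto)
    fix x assume x: "q < x" "x < u"
    have "((\<lambda>u. integral {0..u} ?h) has_vector_derivative ?h x) (at x within {0..1})"
      using x u q by (intro integral_has_vector_derivative cont) auto
    then have "((\<lambda>u. integral {0..u} ?h) has_real_derivative ?h x) (at x)"
      using x u q at_within_Icc_at[of 0 x 1] by (simp add: has_real_derivative_iff_has_vector_derivative)
    moreover have "?h x < 0" using less[of x] X'_pos[of x] x u q by (simp add: mult_pos_neg)
    ultimately show "\<exists>D. ((\<lambda>u. integral {0..u} ?h) has_real_derivative D) (at x) \<and> D < 0" by blast
  qed
  then show ?thesis using f by (simp add: f_mu_eq)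
qed

end

theorem proposition3p3:
  fixes p :: nat and \<beta> m q :: real
    and P :: "'w measure" and B :: "real \<Rightarrow> 'w \<Rightarrow> real"
  assumes "standard_brownian_motion P B"
    and "p \<ge> 3" and "\<beta> > 0"
    and "0 < m" and "m < 1" and "0 < q" and "q < 1"
    and "f_mu P B (mixture \<beta> p) m q q = 0"
    and "Gamma_mu P B (mixture \<beta> p) m q q = q"
    and "deriv01 (Gamma_mu P B (mixture \<beta> p) m q) q \<le> 1"
  shows "(\<forall>u. q < u \<and> u \<le> 1 \<longrightarrow>
            Gamma_mu P B (mixture \<beta> p) m q differentiable (at u within {0..1}) \<and>
            deriv01 (Gamma_mu P B (mixture \<beta> p) m q) differentiable (at u within {0..1}) \<and>
            deriv01 (deriv01 (Gamma_mu P B (mixture \<beta> p) m q)) u < 0 \<and>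
            Gamma_mu P B (mixture \<beta> p) m q u < u) \<and>
         (\<forall>u. q < u \<and> u \<le> 1 \<longrightarrow> f_mu P B (mixture \<beta> p) m q u < 0)"
proof -
  interpret parisi m P B \<beta> q p
    using assms by unfold_locales
  have thr: "2 * (real p - 2) \<le> (real p - 1) * a" using assms by (intro threshold_a)
  have less: "\<Gamma> u < u" if "q < u" "u \<le> 1" for u
    using Gamma_less[OF thr] assms that by blast
  have "\<Gamma> differentiable (at u within {0..1})" "deriv01 \<Gamma> differentiable (at u within {0..1})"
    "deriv01 (deriv01 \<Gamma>) u < 0" if u: "q < u" "u \<le> 1" for u
  proof -
    show "\<Gamma> differentiable (at u within {0..1})"
      using Gamma_deriv[of u] u by (auto simp: real_differentiable_def)
    show "deriv01 \<Gamma> differentiable (at u within {0..1})"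
      using deriv01_Gamma_deriv[OF u] by (auto simp: real_differentiable_def)
    show "deriv01 (deriv01 \<Gamma>) u < 0"
      using deriv01_eq[OF deriv01_Gamma_deriv[OF u]] D2_neg[OF thr u] u q by simp
  qed
  then show ?thesis using less f_mu_neg[OF _ less] assms by blast
qed

end
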